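(* Let $l\ge3$ be an odd integer, $q\in\mathbb C$ a primitive $l$-th root of unity, and let $U=U_q^{fin}(\mathfrak{sl}_2)$ be the small quantum group over $\mathbb C$ with center $\mathfrak Z$. Let $\widetilde{\mathfrak Z}=\mathfrak J(\mathfrak R_r)\subset\mathfrak Z$ and $\mathfrak Z'=\phi^{-1}(\mathfrak R_r)\subset\mathfrak Z$. Then $\widetilde{\mathfrak Z}+\mathfrak Z'=\mathfrak Z$.
   Context: $U$ is the $\mathbb C$-algebra generated by $E,F,K^{\pm1}$ with relations $KEK^{-1}=q^2E$, $KFK^{-1}=q^{-2}F$, $[E,F]=\frac{K-K^{-1}}{q-q^{-1}}$, $E^l=F^l=0$, $K^l=1$. It is a Hopf algebra of dimension $l^3$ with $\Delta(E)=E\otimes1+K\otimes E$, $\Delta(F)=F\otimes K^{-1}+1\otimes F$, $\Delta(K)=K\otimes K$; its antipode satisfies $S^2(a)=K^{-1}aK$. The dual $U^*$ is an algebra under convolution. $C_r=\{p\in U^*: p(ab)=p(bS^{-2}(a))\ \forall a,b\in U\}$. $\mathfrak R_r\subset C_r$ is the span of the functionals $a\mapsto \mathrm{tr}_L(Ka)$, $L$ running over the simple $U$-modules. The map $\phi$: let $\lambda_r\in U^*$ be a nonzero right integral ($\lambda_r p=p(1)\lambda_r$ for all $p\in U^*$; unique up to scalar). $\phi:U\to U^*$, $\phi(a)(b)=\lambda_r(S(a)b)$, is a linear bijection, and $\phi(\mathfrak Z)=C_r$. The map $\mathfrak J$: $U$ is quasitriangular with universal $R$-matrix $$R=\frac1{l}\sum_{i,j=0}^{l-1}q^{-2ij}K^i\otimes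 K^j\cdot\sum_{m=0}^{l-1}\frac{q^{m(m-1)/2}(q-q^{-1})^{m}}{[m]!}F^{m}\otimes E^{m},\qquad [m]!=\prod_{s=1}^m\frac{q^s-q^{-s}}{q-q^{-1}}.$$ Put $R_{12}=R$ and $R_{21}$ its flip. $\mathfrak J:U^*\to U$, $\mathfrak J(p)=(p\otimes\mathrm{id})(R_{21}R_{12})$. It restricts to an algebra isomorphism $C_r\to\mathfrak Z$. *)

theory Defs
  imports
    "HOL-Library.Poly_Mapping"
    "HOL-Library.Product_Plus"
    "HOL-Algebra.QuotRing"
    "Jordan_Normal_Form.VS_Connect"
begin

section \<open>Free algebras and their tensor squares\<close>

datatype gen = Gen_E | Gen_F | Gen_K | Gen_Kinv

datatype word = Word (letters: "gen list")

instantiation word :: monoid_add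
begin

definition zero_word :: word where
  "zero_word = Word []"

definition plus_word :: "word \<Rightarrow> word \<Rightarrow> word" where
  "plus_word v w = Word (letters v @ letters w)"

instance
  by standard (simp_all add: zero_word_def plus_word_def)

end

text \<open>
  The product on \<^typ>\<open>'m \<Rightarrow>\<^sub>0 complex\<close> is convolution along the monoid \<open>'m\<close>. Hence words under
  concatenation give the free algebra on the four letters, and pairs of words (with
  componentwise concatenation) give the tensor square of the free algebra.
\<close>

type_synonym free_alg = "word \<Rightarrow>\<^sub>0 complex"
type_synonym free_alg2 = "word \<times> word \<Rightarrow>\<^sub>0 complex"

definition scal :: "complex \<Rightarrow> ('m::monoid_add \<Rightarrow>\<^sub>0 complex)" where
  "scal c = Poly_Mapping.single 0 c"

definition gen :: "gen \<Rightarrow> free_alg" where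
  "gen g = Poly_Mapping.single (Word [g]) 1"

abbreviation gE :: free_alg where "gE \<equiv> gen Gen_E"
abbreviation gF :: free_alg where "gF \<equiv> gen Gen_F"
abbreviation gK :: free_alg where "gK \<equiv> gen Gen_K"
abbreviation gKinv :: free_alg where "gKinv \<equiv> gen Gen_Kinv"

definition tens :: "free_alg \<Rightarrow> free_alg \<Rightarrow> free_alg2" where
  "tens a b = (\<Sum>v\<in>Poly_Mapping.keys a. \<Sum>w\<in>Poly_Mapping.keys b.
     Poly_Mapping.single (v, w) (Poly_Mapping.lookup a v * Poly_Mapping.lookup b w))"

text \<open>The algebra homomorphism, resp. antihomomorphism, with prescribed values on the letters.\<close>

definition alg_ext :: "(gen \<Rightarrow> ('m::monoid_add \<Rightarrow>\<^sub>0 complex)) \<Rightarrow> free_alg \<Rightarrow> ('m \<Rightarrow>\<^sub>0 complex)" where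
  "alg_ext f a = (\<Sum>w\<in>Poly_Mapping.keys a.
     scal (Poly_Mapping.lookup a w) * prod_list (map f (letters w)))"

definition antialg_ext :: "(gen \<Rightarrow> ('m::monoid_add \<Rightarrow>\<^sub>0 complex)) \<Rightarrow> free_alg \<Rightarrow> ('m \<Rightarrow>\<^sub>0 complex)" where
  "antialg_ext f a = (\<Sum>w\<in>Poly_Mapping.keys a.
     scal (Poly_Mapping.lookup a w) * prod_list (map f (rev (letters w))))"


section \<open>The small quantum group\<close>

definition relators :: "nat \<Rightarrow> complex \<Rightarrow> free_alg set" where
  "relators l q =
    {gK * gKinv - 1, gKinv * gK - 1,
     gK * gE * gKinv - scal (q powi 2) * gE,
     gK * gF * gKinv - scal (q powi (-2)) * gF,
     gE * gF - gF * gE - scal (1 / (q - inverse q)) * (gK - gKinv),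
     gE ^ l, gF ^ l, gK ^ l - 1}"

definition rel_ideal :: "nat \<Rightarrow> complex \<Rightarrow> free_alg set" where
  "rel_ideal l q = Idl\<^bsub>class_ring\<^esub> (relators l q)"

definition U :: "nat \<Rightarrow> complex \<Rightarrow> free_alg set ring" where
  "U l q = class_ring Quot (rel_ideal l q)"

definition cls :: "nat \<Rightarrow> complex \<Rightarrow> free_alg \<Rightarrow> free_alg set" where
  "cls l q a = rel_ideal l q +>\<^bsub>class_ring\<^esub> a"

definition U_scale :: "nat \<Rightarrow> complex \<Rightarrow> complex \<Rightarrow> free_alg set \<Rightarrow> free_alg set" where
  "U_scale l q c x = cls l q (scal c) \<otimes>\<^bsub>U l q\<^esub> x"

definition ring_center :: "('a, 'b) ring_scheme \<Rightarrow> 'a set" where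
  "ring_center A = {z \<in> carrier A. \<forall>a\<in>carrier A. z \<otimes>\<^bsub>A\<^esub> a = a \<otimes>\<^bsub>A\<^esub> z}"

text \<open>
  The comultiplication on the free algebra; it induces the one of \<open>U\<close>.
\<close>

definition Delta :: "free_alg \<Rightarrow> free_alg2" where
  "Delta = alg_ext (\<lambda>g. case g of
       Gen_E \<Rightarrow> tens gE 1 + tens gK gE
     | Gen_F \<Rightarrow> tens gF gKinv + tens 1 gF
     | Gen_K \<Rightarrow> tens gK gK
     | Gen_Kinv \<Rightarrow> tens gKinv gKinv)"

text \<open>
  The values on the generators are the ones forced by \<^term>\<open>Delta\<close> and the antipode axiom: e.g. applying
  \<open>m \<circ> (S \<otimes> id)\<close> to \<open>Delta E\<close> gives \<open>S E + K\<^sup>-\<^sup>1 E = 0\<close>. The set \<open>X\<close> is a coset, and the image below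
  is a singleton because \<open>S\<close> preserves the ideal of relations.
\<close>

definition U_antipode :: "nat \<Rightarrow> complex \<Rightarrow> free_alg set \<Rightarrow> free_alg set" where
  "U_antipode l q X = the_elem ((\<lambda>t. cls l q (antialg_ext (\<lambda>g. case g of
       Gen_E \<Rightarrow> - (gKinv * gE)
     | Gen_F \<Rightarrow> - (gF * gK)
     | Gen_K \<Rightarrow> gKinv
     | Gen_Kinv \<Rightarrow> gK) t)) ` X)"


section \<open>The dual algebra and right integrals\<close>

text \<open>
  Functionals are extensional, that is, \<open>undefined\<close> off the carrier, so that equality of
  functionals is equality of functions.
\<close>

definition U_dual :: "nat \<Rightarrow> complex \<Rightarrow> (free_alg set \<Rightarrow> complex) set" where
  "U_dual l q = {p \<in> extensional (carrier (U l q)).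
     (\<forall>x\<in>carrier (U l q). \<forall>y\<in>carrier (U l q). p (x \<oplus>\<^bsub>U l q\<^esub> y) = p x + p y) \<and>
     (\<forall>c. \<forall>x\<in>carrier (U l q). p (U_scale l q c x) = c * p x)}"

text \<open>The functional \<open>p \<otimes> r\<close> on a lift to the free algebra of an element of \<open>U \<otimes> U\<close>.\<close>

definition tens_apply ::
  "nat \<Rightarrow> complex \<Rightarrow> (free_alg set \<Rightarrow> complex) \<Rightarrow> (free_alg set \<Rightarrow> complex) \<Rightarrow> free_alg2 \<Rightarrow> complex" where
  "tens_apply l q p r x = (\<Sum>(v, w)\<in>Poly_Mapping.keys x. Poly_Mapping.lookup x (v, w) *
     p (cls l q (Poly_Mapping.single v 1)) * r (cls l q (Poly_Mapping.single w 1)))"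

text \<open>
  The convolution \<open>(p r)(a) = (p \<otimes> r)(Delta a)\<close>; the image of the coset \<open>X\<close> is a singleton because
  \<^term>\<open>Delta\<close> maps the ideal \<open>I\<close> of relations into \<open>I \<otimes> T + T \<otimes> I\<close>, \<open>T\<close> being the free algebra.
\<close>

definition conv :: "nat \<Rightarrow> complex \<Rightarrow> (free_alg set \<Rightarrow> complex) \<Rightarrow> (free_alg set \<Rightarrow> complex) \<Rightarrow>
    (free_alg set \<Rightarrow> complex)" where
  "conv l q p r =
     (\<lambda>X\<in>carrier (U l q). the_elem ((\<lambda>t. tens_apply l q p r (Delta t)) ` X))"

definition right_integral :: "nat \<Rightarrow> complex \<Rightarrow> (free_alg set \<Rightarrow> complex) \<Rightarrow> bool" where
  "right_integral l q lam \<longleftrightarrow> lam \<in> U_dual l q \<and>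
     (\<forall>p\<in>U_dual l q. conv l q lam p = (\<lambda>x\<in>carrier (U l q). p \<one>\<^bsub>U l q\<^esub> * lam x))"

definition phi :: "nat \<Rightarrow> complex \<Rightarrow> (free_alg set \<Rightarrow> complex) \<Rightarrow> free_alg set \<Rightarrow>
    (free_alg set \<Rightarrow> complex)" where
  "phi l q lam a = (\<lambda>b\<in>carrier (U l q). lam (U_antipode l q a \<otimes>\<^bsub>U l q\<^esub> b))"


section \<open>Simple modules and their K-twisted traces\<close>

text \<open>
  Simple modules are finite-dimensional since \<open>U\<close> is, so up to isomorphism they are the
  irreducible matrix representations.
\<close>

definition simple_module :: "nat \<Rightarrow> complex \<Rightarrow> nat \<Rightarrow> (free_alg set \<Rightarrow> complex mat) \<Rightarrow> bool" where
  "simple_module l q n \<rho> \<longleftrightarrow>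
     0 < n \<and>
     \<rho> \<in> Ring.ring_hom (U l q) (ring_mat TYPE(complex) n ()) \<and>
     (\<forall>c. \<forall>a\<in>carrier (U l q). \<rho> (U_scale l q c a) = c \<cdot>\<^sub>m \<rho> a) \<and>
     (\<forall>W. VectorSpace.subspace class_ring W (module_vec TYPE(complex) n) \<and>
          (\<forall>a\<in>carrier (U l q). \<forall>w\<in>W. \<rho> a *\<^sub>v w \<in> W)
        \<longrightarrow> W = {0\<^sub>v n} \<or> W = carrier_vec n)"

definition mat_tr :: "complex mat \<Rightarrow> complex" where
  "mat_tr A = sum_list (diag_mat A)"

definition K_trace :: "nat \<Rightarrow> complex \<Rightarrow> (free_alg set \<Rightarrow> complex mat) \<Rightarrow> (free_alg set \<Rightarrow> complex)" where
  "K_trace l q \<rho> = (\<lambda>a\<in>carrier (U l q). mat_tr (\<rho> (cls l q gK \<otimes>\<^bsub>U l q\<^esub> a)))"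

definition R_r :: "nat \<Rightarrow> complex \<Rightarrow> (free_alg set \<Rightarrow> complex) set" where
  "R_r l q = {(\<lambda>a\<in>carrier (U l q). \<Sum>p\<in>P. c p * p a) | P c.
     finite P \<and> P \<subseteq> {K_trace l q \<rho> | n \<rho>. simple_module l q n \<rho>}}"


section \<open>The R-matrix and the maps into the center\<close>

definition q_fact :: "complex \<Rightarrow> nat \<Rightarrow> complex" where
  "q_fact q m = (\<Prod>s = 1..m. (q ^ s - inverse q ^ s) / (q - inverse q))"

text \<open>The R-matrix and its flip, as lifts to the tensor square of the free algebra.\<close>

definition R12 :: "nat \<Rightarrow> complex \<Rightarrow> free_alg2" where
  "R12 l q =
     scal (1 / of_nat l) *
     (\<Sum>i<l. \<Sum>j<l. scal (inverse q ^ (2 * i * j)) * tens (gK ^ i) (gK ^ j)) *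
     (\<Sum>m<l. scal (q ^ (m * (m - 1) div 2) * (q - inverse q) ^ m / q_fact q m) *
        tens (gF ^ m) (gE ^ m))"

definition R21 :: "nat \<Rightarrow> complex \<Rightarrow> free_alg2" where
  "R21 l q = Poly_Mapping.map_key prod.swap (R12 l q)"

text \<open>The map \<open>p \<otimes> id\<close>, on lifts of elements of \<open>U \<otimes> U\<close>.\<close>

definition tens_slice ::
  "nat \<Rightarrow> complex \<Rightarrow> (free_alg set \<Rightarrow> complex) \<Rightarrow> free_alg2 \<Rightarrow> free_alg set" where
  "tens_slice l q p x = cls l q (\<Sum>(v, w)\<in>Poly_Mapping.keys x.
     Poly_Mapping.single w (Poly_Mapping.lookup x (v, w) * p (cls l q (Poly_Mapping.single v 1))))"

definition J_map :: "nat \<Rightarrow> complex \<Rightarrow> (free_alg set \<Rightarrow> complex) \<Rightarrow> free_alg set" where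
  "J_map l q p = tens_slice l q p (R21 l q * R12 l q)"

definition Z_tilde :: "nat \<Rightarrow> complex \<Rightarrow> free_alg set set" where
  "Z_tilde l q = J_map l q ` R_r l q"

definition Z_prime :: "nat \<Rightarrow> complex \<Rightarrow> (free_alg set \<Rightarrow> complex) \<Rightarrow> free_alg set set" where
  "Z_prime l q lam = {a \<in> carrier (U l q). phi l q lam a \<in> R_r l q}"

end

theory Submission
  imports Defs
begin

text \<open>
  Decompose \<open>U\<close> by the idempotents \<open>e\<^sub>k\<close> of \<open>K\<close>. With the Casimir element \<open>C\<close>, its weight zero part is
  \<open>\<Oplus>\<^sub>k e\<^sub>k \<complex>[C]/(\<Psi>)\<close>, where \<open>\<Psi>\<close> is the product over \<open>k\<close> modulo \<open>l\<close> of the \<open>X - \<gamma>\<^sub>k\<close>, with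
  \<open>F E e\<^sub>k = (C - \<gamma>\<^sub>k) e\<^sub>k\<close>. An element \<open>\<Sum>\<^sub>k f\<^sub>k(C) e\<^sub>k\<close> is central if and only if each
  \<open>f\<^sub>k - f\<^bsub>k+2\<^esub>\<close> is a multiple \<open>t\<^sub>k \<Psi>/(X - \<gamma>\<^sub>k)\<close>; summing around the cycle gives
  \<open>t\<^sub>k + t\<^bsub>-k-2\<^esub> = 0\<close>, as \<open>\<gamma>\<^sub>k = \<gamma>\<^bsub>-k-2\<^esub>\<close> are the only coincidences.

  The image under \<open>J\<close> of the \<open>K\<close>-twisted trace of the simple module of highest weight \<open>n\<close> is central, and
  its components \<open>f\<^sub>k\<close> all have degree \<open>n\<close> and the same leading coefficient, so it is a polynomial of
  degree \<open>n\<close> in \<open>C\<close>. Hence these images span \<open>\<complex>[C]\<close>. On the other hand \<open>\<phi>\<close> sends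
  \<open>\<Sum>\<^sub>k e\<^sub>k \<Psi>/(X - \<gamma>\<^sub>n)(C)\<close>, the sum being over the weights \<open>k\<close> of that module, to a multiple of its
  twisted trace; for this element only \<open>t\<^sub>n\<close> and \<open>t\<^bsub>-n-2\<^esub>\<close> are nonzero. Subtracting a combination of
  such elements from a central element leaves an element of \<open>\<complex>[C]\<close>.

  The right integral is only given abstractly. Evaluating the integral property with matrix coefficients
  of the two-dimensional module shows that it vanishes on \<open>F\<^sup>a E\<^sup>c K\<^sup>b\<close> except for
  \<open>a = c = l - 1\<close>, \<open>b = -1\<close>; since it is nonzero, this also gives the linear independence of these monomials.
\<close>

section \<open>Algebras of finitely supported functions\<close>

text \<open>All computations take place with representatives in the free algebra and its tensor
  square, modulo congruences. Why \<open>J\<close> gives central elements: if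
  \<open>t (x y) = t (y x)\<close>, cyclicity expresses the difference of the traces of
  \<open>E^(m+1) F^(m+1)\<close> on neighbouring weights by the trace of \<open>E^m F^m\<close>.
  Summation by parts over the residues turns this into a recursion between the coefficients of
  \<open>f_k\<close> for \<open>m\<close> and \<open>m + 1\<close>, under which
  \<open>f_k - f_(k+2)\<close> telescopes to a multiple of \<open>Psi / (X - gam k)\<close>. For
  highest weight \<open>n\<close> this multiple is zero, because the \<open>n\<close>-th coefficient
  does not depend on \<open>k\<close> and the later ones vanish. Why \<open>phi\<close> gives
  twisted traces: \<open>lam\<close> reads off from \<open>h(C) e_k\<close> the coefficient of
  degree \<open>l - 1\<close> of \<open>h\<close>. After multiplication by
  \<open>Psi / (X - gam n)\<close> this becomes evaluation at \<open>gam n\<close>, the scalar by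
  which \<open>C\<close> acts on the module. As \<open>l\<close> is odd, the residues other than
  \<open>-1\<close> fall into pairs \<open>k\<close>, \<open>-k-2\<close>, represented by the
  highest weights \<open>0, 2, ..., l - 3\<close>; at the fixed point \<open>-1\<close> the relation
  \<open>t_k + t_(-k-2) = 0\<close> gives \<open>t_k = 0\<close>.\<close>

definition smul :: "complex \<Rightarrow> ('m::monoid_add \<Rightarrow>\<^sub>0 complex) \<Rightarrow> ('m \<Rightarrow>\<^sub>0 complex)" (infixr \<open>\<cdot>\<close> 75) where
  "c \<cdot> x = scal c * x"

lemma smul_eq_map: "c \<cdot> x = Poly_Mapping.map ((*) c) x"
  by (simp add: smul_def scal_def mult_map_scale_conv_mult)

lemma lookup_smul [simp]: "Poly_Mapping.lookup (c \<cdot> x) w = c * Poly_Mapping.lookup x w"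
  by (simp add: smul_eq_map Poly_Mapping.map.rep_eq when_def)

lemma smul_add_right: "c \<cdot> (x + y) = c \<cdot> x + c \<cdot> y"
  by (simp add: smul_def distrib_left)

lemma smul_add_left: "(c + d) \<cdot> x = c \<cdot> x + d \<cdot> x"
  by (rule poly_mapping_eqI) (simp add: lookup_add algebra_simps)

lemma smul_diff_right: "c \<cdot> (x - y) = c \<cdot> x - c \<cdot> y"
  by (simp add: smul_def right_diff_distrib)

lemma smul_diff_left: "(c - d) \<cdot> x = c \<cdot> x - d \<cdot> x"
  by (rule poly_mapping_eqI) (simp add: lookup_minus algebra_simps)

lemma smul_minus_right [simp]: "c \<cdot> (- x) = - (c \<cdot> x)"
  by (simp add: smul_def)

lemma smul_minus_left [simp]: "(- c) \<cdot> x = - (c \<cdot> x)"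
  by (rule poly_mapping_eqI) simp

lemma smul_smul [simp]: "c \<cdot> d \<cdot> x = (c * d) \<cdot> x"
  by (rule poly_mapping_eqI) simp

lemma smul_one [simp]: "1 \<cdot> x = x"
  by (rule poly_mapping_eqI) simp

lemma smul_zero_left [simp]: "0 \<cdot> x = 0"
  by (rule poly_mapping_eqI) simp

lemma smul_zero_right [simp]: "c \<cdot> 0 = 0"
  by (simp add: smul_def)

lemma smul_mult_left [simp]: "(c \<cdot> x) * y = c \<cdot> (x * y)"
  by (simp add: smul_def mult.assoc)

lemma single_eq_smul: "Poly_Mapping.single w c = c \<cdot> Poly_Mapping.single w 1"
  by (rule poly_mapping_eqI) (simp add: lookup_single when_def)

lemma smul_sum_right: "c \<cdot> (\<Sum>i\<in>A. f i) = (\<Sum>i\<in>A. c \<cdot> f i)"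
  by (simp add: smul_def sum_distrib_left)

lemma smul_sum_left: "(\<Sum>i\<in>A. f i) \<cdot> x = (\<Sum>i\<in>A. f i \<cdot> x)"
  by (induction A rule: infinite_finite_induct) (simp_all add: smul_add_left)

lemma poly_mapping_expand:
  "x = (\<Sum>w\<in>Poly_Mapping.keys x. Poly_Mapping.lookup x w \<cdot> Poly_Mapping.single w 1)"
proof (rule poly_mapping_eqI)
  fix v
  have "(\<Sum>w\<in>Poly_Mapping.keys x. Poly_Mapping.lookup x w * (1 when w = v)) =
      (\<Sum>w\<in>Poly_Mapping.keys x. if w = v then Poly_Mapping.lookup x v else 0)"
    by (rule sum.cong) (auto simp: when_def)
  then show "Poly_Mapping.lookup x v = Poly_Mapping.lookup
      (\<Sum>w\<in>Poly_Mapping.keys x. Poly_Mapping.lookup x w \<cdot> Poly_Mapping.single w 1) v"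
    by (simp add: lookup_sum lookup_single in_keys_iff)
qed

lemma poly_mapping_span_induct [case_names zero single add smul]:
  assumes "P 0" and "\<And>w. P (Poly_Mapping.single w 1)"
    and "\<And>x y. P x \<Longrightarrow> P y \<Longrightarrow> P (x + y)" and "\<And>c x. P x \<Longrightarrow> P (c \<cdot> x)"
  shows "P x"
proof -
  have "P (\<Sum>w\<in>A. Poly_Mapping.lookup x w \<cdot> Poly_Mapping.single w 1)" for A
    by (induction A rule: infinite_finite_induct) (auto intro: assms)
  then show ?thesis
    by (subst poly_mapping_expand)
qed

lemma smul_mult_right [simp]: "x * (c \<cdot> y) = c \<cdot> (x * y)"
proof -
  have "x * scal c = c \<cdot> x"
  proof (induction x rule: poly_mapping_span_induct)
    case (single w)
    then show ?case by (simp add: scal_def mult_single single_eq_smul[of w c])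
  qed (simp_all add: smul_add_right distrib_right mult.commute)
  then show ?thesis
    by (simp add: smul_def mult.assoc[symmetric])
qed

lemma scal_eq_smul: "scal c = c \<cdot> 1"
  by (simp add: smul_def)

lemma smul_power: "(c \<cdot> x) ^ n = (c ^ n) \<cdot> (x ^ n)"
  by (induction n) (simp_all add: mult.commute)

text \<open>The linear operations of the development are defined as sums over \<open>keys\<close>, a
  set that can shrink under cancellation. A summand that vanishes at coefficient 0 makes such a sum
  additive nevertheless.\<close>

lemma sum_keys_add:
  assumes "\<And>w. F w 0 = 0" and "\<And>w a b. F w (a + b) = F w a + F w b"
  shows "(\<Sum>w\<in>Poly_Mapping.keys (x + y). F w (Poly_Mapping.lookup (x + y) w)) =
    (\<Sum>w\<in>Poly_Mapping.keys x. F w (Poly_Mapping.lookup x w)) +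
    (\<Sum>w\<in>Poly_Mapping.keys y. F w (Poly_Mapping.lookup y w) :: 'b::comm_monoid_add)"
  by (rule setsum_keys_plus_distrib) (use assms in auto)

lemma sum_keys_smul:
  assumes "\<And>w. F w 0 = 0" and "\<And>w a. F w (c * a) = G (F w a)" and "G 0 = 0" "\<And>a b. G (a + b) = G a + G b"
  shows "(\<Sum>w\<in>Poly_Mapping.keys (c \<cdot> x). F w (Poly_Mapping.lookup (c \<cdot> x) w)) =
    G (\<Sum>w\<in>Poly_Mapping.keys x. F w (Poly_Mapping.lookup x w) :: 'b::comm_monoid_add)"
proof -
  have "(\<Sum>w\<in>Poly_Mapping.keys (c \<cdot> x). F w (Poly_Mapping.lookup (c \<cdot> x) w)) =
      (\<Sum>w\<in>Poly_Mapping.keys x. F w (Poly_Mapping.lookup (c \<cdot> x) w))"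
    by (rule sum.mono_neutral_left) (auto simp: in_keys_iff assms(1))
  also have "\<dots> = (\<Sum>w\<in>Poly_Mapping.keys x. G (F w (Poly_Mapping.lookup x w)))"
    by (simp add: assms(2))
  also have "\<dots> = G (\<Sum>w\<in>Poly_Mapping.keys x. F w (Poly_Mapping.lookup x w))"
    by (rule sum_comp_morphism[unfolded o_def]) (use assms in auto)
  finally show ?thesis .
qed

definition lin :: "(('m::monoid_add \<Rightarrow>\<^sub>0 complex) \<Rightarrow> complex) \<Rightarrow> bool" where
  "lin f \<longleftrightarrow> (\<forall>x y. f (x + y) = f x + f y) \<and> (\<forall>c x. f (c \<cdot> x) = c * f x)"

lemma linI: "(\<And>x y. f (x + y) = f x + f y) \<Longrightarrow> (\<And>c x. f (c \<cdot> x) = c * f x) \<Longrightarrow> lin f"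
  by (simp add: lin_def)

context
  fixes f :: "('m::monoid_add \<Rightarrow>\<^sub>0 complex) \<Rightarrow> complex"
  assumes f: "lin f"
begin

lemma lin_add: "f (x + y) = f x + f y"
  using f by (simp add: lin_def)

lemma lin_smul: "f (c \<cdot> x) = c * f x"
  using f by (simp add: lin_def)

lemma lin_0: "f 0 = 0"
  using lin_smul[of 0 0] by simp

lemma lin_minus: "f (- x) = - f x"
  using lin_smul[of "-1" x] by simp

lemma lin_diff: "f (x - y) = f x - f y"
  using lin_add[of x "- y"] lin_minus[of y] by simp

lemma lin_sum: "f (\<Sum>i\<in>A. g i) = (\<Sum>i\<in>A. f (g i))"
  by (induction A rule: infinite_finite_induct) (simp_all add: lin_0 lin_add)

lemmas lin_simps = lin_add lin_smul lin_0 lin_minus lin_diff lin_sum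

lemma lin_mult_both: "lin (\<lambda>x. f (u * x * v))"
  by (rule linI) (simp_all add: distrib_left distrib_right lin_add lin_smul)

lemma lin_mult_left: "lin (\<lambda>x. f (u * x))"
  by (rule linI) (simp_all add: distrib_left distrib_right lin_add lin_smul)

end

section \<open>Homomorphisms and antihomomorphisms out of the free algebra\<close>

lemma alg_ext_add: "alg_ext f (x + y) = alg_ext f x + alg_ext f y"
  unfolding alg_ext_def by (rule sum_keys_add) (simp_all add: scal_eq_smul smul_add_left distrib_right)

lemma alg_ext_smul: "alg_ext f (c \<cdot> x) = c \<cdot> alg_ext f x"
  unfolding alg_ext_def by (rule sum_keys_smul) (simp_all add: scal_eq_smul smul_add_right)

lemma alg_ext_single: "alg_ext f (Poly_Mapping.single w 1) = prod_list (map f (letters w))"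
  by (simp add: alg_ext_def scal_eq_smul)

lemma antialg_ext_add: "antialg_ext f (x + y) = antialg_ext f x + antialg_ext f y"
  unfolding antialg_ext_def by (rule sum_keys_add) (simp_all add: scal_eq_smul smul_add_left distrib_right)

lemma antialg_ext_smul: "antialg_ext f (c \<cdot> x) = c \<cdot> antialg_ext f x"
  unfolding antialg_ext_def by (rule sum_keys_smul) (simp_all add: scal_eq_smul smul_add_right)

lemma antialg_ext_single: "antialg_ext f (Poly_Mapping.single w 1) = prod_list (map f (rev (letters w)))"
  by (simp add: antialg_ext_def scal_eq_smul)

lemma alg_ext_0: "alg_ext f 0 = 0" and antialg_ext_0: "antialg_ext f 0 = 0"
  by (simp_all add: alg_ext_def antialg_ext_def)

lemma alg_ext_mult: "alg_ext f (x * y) = alg_ext f x * alg_ext f y"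
proof (induction x rule: poly_mapping_span_induct)
  case (single v)
  show ?case
  proof (induction y rule: poly_mapping_span_induct)
    case (single w)
    show ?case
      by (simp add: mult_single alg_ext_single plus_word_def)
  qed (simp_all add: alg_ext_add alg_ext_smul alg_ext_0 algebra_simps)
qed (simp_all add: alg_ext_add alg_ext_smul alg_ext_0 algebra_simps)

lemma antialg_ext_mult: "antialg_ext f (x * y) = antialg_ext f y * antialg_ext f x"
proof (induction x rule: poly_mapping_span_induct)
  case (single v)
  show ?case
  proof (induction y rule: poly_mapping_span_induct)
    case (single w)
    show ?case
      by (simp add: mult_single antialg_ext_single plus_word_def)
  qed (simp_all add: antialg_ext_add antialg_ext_smul antialg_ext_0 algebra_simps)
qed (simp_all add: antialg_ext_add antialg_ext_smul antialg_ext_0 algebra_simps)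

lemma single_Word: "Poly_Mapping.single (Word ws) 1 = prod_list (map gen ws)"
proof (induction ws)
  case Nil
  show ?case by (simp flip: zero_word_def)
next
  case (Cons g ws)
  have "Poly_Mapping.single (Word (g # ws)) (1::complex) =
      Poly_Mapping.single (Word [g]) 1 * Poly_Mapping.single (Word ws) 1"
    by (simp add: mult_single plus_word_def)
  then show ?case by (simp add: Cons gen_def)
qed

lemma alg_ext_gen: "alg_ext f (gen g) = f g" and antialg_ext_gen: "antialg_ext f (gen g) = f g"
  by (simp_all add: gen_def alg_ext_single antialg_ext_single)

lemma alg_ext_1: "alg_ext f 1 = 1" and antialg_ext_1: "antialg_ext f 1 = 1"
  using alg_ext_single[of f 0] antialg_ext_single[of f 0] by (simp_all, simp_all add: zero_word_def)

lemma alg_ext_minus: "alg_ext f (- x) = - alg_ext f x" and antialg_ext_minus: "antialg_ext f (- x) = - antialg_ext f x"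
  using alg_ext_smul[of f "-1" x] antialg_ext_smul[of f "-1" x] by simp_all

lemma alg_ext_diff: "alg_ext f (x - y) = alg_ext f x - alg_ext f y"
  and antialg_ext_diff: "antialg_ext f (x - y) = antialg_ext f x - antialg_ext f y"
  using alg_ext_add[of f x "- y"] antialg_ext_add[of f x "- y"]
  by (simp_all add: alg_ext_minus antialg_ext_minus)

lemma alg_ext_power: "alg_ext f (x ^ n) = alg_ext f x ^ n"
  by (induction n) (simp_all add: alg_ext_1 alg_ext_mult)

lemma antialg_ext_power: "antialg_ext f (x ^ n) = antialg_ext f x ^ n"
  by (induction n) (simp_all add: antialg_ext_1 antialg_ext_mult power_commutes)

lemma alg_ext_sum: "alg_ext f (\<Sum>i\<in>A. g i) = (\<Sum>i\<in>A. alg_ext f (g i))"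
  and antialg_ext_sum: "antialg_ext f (\<Sum>i\<in>A. g i) = (\<Sum>i\<in>A. antialg_ext f (g i))"
  by (induction A rule: infinite_finite_induct)
    (simp_all add: alg_ext_0 antialg_ext_0 alg_ext_add antialg_ext_add)

lemmas alg_ext_simps = alg_ext_add alg_ext_smul alg_ext_0 alg_ext_1 alg_ext_mult alg_ext_gen
  alg_ext_minus alg_ext_diff alg_ext_power alg_ext_sum
lemmas antialg_ext_simps = antialg_ext_add antialg_ext_smul antialg_ext_0 antialg_ext_1
  antialg_ext_mult antialg_ext_gen antialg_ext_minus antialg_ext_diff antialg_ext_power antialg_ext_sum

text \<open>Words grow on the left, which suits actions on modules and commutation with a fixed
  element.\<close>

lemma free_alg_induct [case_names one gen add smul]:
  assumes "P 1" and "\<And>g x. P x \<Longrightarrow> P (gen g * x)"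
    and "\<And>x y. P x \<Longrightarrow> P y \<Longrightarrow> P (x + y)" and "\<And>c x. P x \<Longrightarrow> P (c \<cdot> x)"
  shows "P (x :: free_alg)"
proof (induction x rule: poly_mapping_span_induct)
  case zero
  show ?case using assms(4)[OF assms(1), of 0] by simp
next
  case (single w)
  obtain ws where "w = Word ws" by (cases w)
  moreover have "P (prod_list (map gen ws))"
    by (induction ws) (auto intro: assms)
  ultimately show ?case by (simp add: single_Word)
qed (use assms in auto)

section \<open>Tensor products and the flip\<close>

lemma tens_add_left: "tens (x + y) b = tens x b + tens y b"
  unfolding tens_def
  by (rule sum_keys_add) (simp_all add: sum.distrib single_add distrib_right)

lemma tens_smul_left: "tens (c \<cdot> x) b = c \<cdot> tens x b"
  unfolding tens_def
proof (rule sum_keys_smul[where F = "\<lambda>v a. \<Sum>w\<in>Poly_Mapping.keys b. Poly_Mapping.single (v, w) (a * Poly_Mapping.lookup b w)"])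
  fix v a
  show "(\<Sum>w\<in>Poly_Mapping.keys b. Poly_Mapping.single (v, w) (c * a * Poly_Mapping.lookup b w)) =
     c \<cdot> (\<Sum>w\<in>Poly_Mapping.keys b. Poly_Mapping.single (v, w) (a * Poly_Mapping.lookup b w))"
    unfolding smul_sum_right by (rule sum.cong) (simp_all add: smul_eq_map map_single mult.assoc)
qed (simp_all add: smul_add_right)

lemma tens_eq: "tens a b = (\<Sum>w\<in>Poly_Mapping.keys b. \<Sum>v\<in>Poly_Mapping.keys a.
     Poly_Mapping.single (v, w) (Poly_Mapping.lookup a v * Poly_Mapping.lookup b w))"
  unfolding tens_def by (rule sum.swap)

lemma tens_add_right: "tens b (x + y) = tens b x + tens b y"
  unfolding tens_eq
  by (rule sum_keys_add) (simp_all add: sum.distrib single_add distrib_left)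

lemma tens_smul_right: "tens b (c \<cdot> x) = c \<cdot> tens b x"
  unfolding tens_eq
proof (rule sum_keys_smul[where F = "\<lambda>w a. \<Sum>v\<in>Poly_Mapping.keys b. Poly_Mapping.single (v, w) (Poly_Mapping.lookup b v * a)"])
  fix w a
  show "(\<Sum>v\<in>Poly_Mapping.keys b. Poly_Mapping.single (v, w) (Poly_Mapping.lookup b v * (c * a))) =
     c \<cdot> (\<Sum>v\<in>Poly_Mapping.keys b. Poly_Mapping.single (v, w) (Poly_Mapping.lookup b v * a))"
    unfolding smul_sum_right by (rule sum.cong) (simp_all add: smul_eq_map map_single ac_simps)
qed (simp_all add: smul_add_right)

lemma tens_0 [simp]: "tens 0 b = 0" "tens a 0 = 0"
  by (simp_all add: tens_def)

lemma tens_single: "tens (Poly_Mapping.single v 1) (Poly_Mapping.single w 1) = Poly_Mapping.single (v, w) 1"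
  by (simp add: tens_def)

lemma tens_1: "tens 1 1 = 1"
  using tens_single[of 0 0] by (simp flip: zero_prod_def)

lemma tens_mult: "tens a b * tens c d = tens (a * c) (b * d)"
proof (induction a rule: poly_mapping_span_induct)
  case (single v)
  show ?case
  proof (induction b rule: poly_mapping_span_induct)
    case (single w)
    show ?case
    proof (induction c rule: poly_mapping_span_induct)
      case (single v')
      show ?case
      proof (induction d rule: poly_mapping_span_induct)
        case (single w')
        show ?case by (simp add: tens_single mult_single)
      qed (simp_all add: tens_add_right tens_smul_right algebra_simps)
    qed (simp_all add: tens_add_left tens_smul_left algebra_simps)
  qed (simp_all add: tens_add_right tens_smul_right algebra_simps)
qed (simp_all add: tens_add_left tens_smul_left algebra_simps)

lemma tens_minus_left: "tens (- x) b = - tens x b" and tens_minus_right: "tens b (- x) = - tens b x"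
  using tens_smul_left[of "-1" x b] tens_smul_right[of b "-1" x] by simp_all

lemma tens_diff_left: "tens (x - y) b = tens x b - tens y b"
  and tens_diff_right: "tens b (x - y) = tens b x - tens b y"
  using tens_add_left[of x "- y" b] tens_add_right[of b x "- y"]
  by (simp_all add: tens_minus_left tens_minus_right)

lemma tens_sum_left: "tens (\<Sum>i\<in>A. f i) b = (\<Sum>i\<in>A. tens (f i) b)"
  and tens_sum_right: "tens b (\<Sum>i\<in>A. f i) = (\<Sum>i\<in>A. tens b (f i))"
  by (induction A rule: infinite_finite_induct) (simp_all add: tens_add_left tens_add_right)

lemma tens_power: "tens a b ^ n = tens (a ^ n) (b ^ n)"
  by (induction n) (simp_all add: tens_1 tens_mult)

lemma tens_span_induct [case_names zero tens add smul]:
  assumes "P 0" and "\<And>a b. P (tens a b)"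
    and "\<And>x y. P x \<Longrightarrow> P y \<Longrightarrow> P (x + y)" and "\<And>c x. P x \<Longrightarrow> P (c \<cdot> x)"
  shows "P x"
proof (induction x rule: poly_mapping_span_induct)
  case (single vw)
  show ?case using assms(2)[of "Poly_Mapping.single (fst vw) 1" "Poly_Mapping.single (snd vw) 1"]
    by (simp add: tens_single)
qed (use assms in auto)

definition tflip :: "free_alg2 \<Rightarrow> free_alg2" where
  "tflip = Poly_Mapping.map_key prod.swap"

lemma tflip_add: "tflip (x + y) = tflip x + tflip y"
  by (simp add: tflip_def map_key_plus)

lemma tflip_smul: "tflip (c \<cdot> x) = c \<cdot> tflip x"
  by (rule poly_mapping_eqI) (simp add: tflip_def map_key.rep_eq)

lemma tflip_sum: "tflip (\<Sum>i\<in>A. f i) = (\<Sum>i\<in>A. tflip (f i))"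
  by (induction A rule: infinite_finite_induct) (simp_all add: tflip_add, simp_all add: tflip_def)

lemma tflip_tens: "tflip (tens a b) = tens b a"
proof (induction a rule: poly_mapping_span_induct)
  case (single v)
  show ?case
  proof (induction b rule: poly_mapping_span_induct)
    case (single w)
    have "tflip (Poly_Mapping.single (prod.swap (w, v)) 1) = Poly_Mapping.single (w, v) (1::complex)"
      unfolding tflip_def by (rule map_key_single) (rule inj_swap)
    then show ?case by (simp add: tens_single)
  next
    case zero
    show ?case by (simp add: tflip_def)
  qed (simp_all add: tens_add_left tens_smul_left tens_add_right tens_smul_right tflip_add tflip_smul)
next
  case zero
  show ?case by (simp add: tflip_def)
qed (simp_all add: tens_add_left tens_smul_left tens_add_right tens_smul_right tflip_add tflip_smul)

section \<open>Congruences modulo a two-sided ideal\<close>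

text \<open>One calculus of congruences for two ideals: the relations in the free algebra, and their
  counterpart \<open>null2\<close> in the tensor square.\<close>

locale two_sided_ideal =
  fixes N :: "('m::monoid_add \<Rightarrow>\<^sub>0 complex) set"
  assumes zero_mem: "0 \<in> N" and add_mem: "x \<in> N \<Longrightarrow> y \<in> N \<Longrightarrow> x + y \<in> N"
    and mult_left_mem: "x \<in> N \<Longrightarrow> a * x \<in> N" and mult_right_mem: "x \<in> N \<Longrightarrow> x * a \<in> N"
begin

definition eqv :: "('m \<Rightarrow>\<^sub>0 complex) \<Rightarrow> ('m \<Rightarrow>\<^sub>0 complex) \<Rightarrow> bool" (infix \<open>\<doteq>\<close> 50) where
  "x \<doteq> y \<longleftrightarrow> x - y \<in> N"

lemma minus_mem: "x \<in> N \<Longrightarrow> - x \<in> N"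
  using mult_left_mem[of x "- 1"] by simp

lemma smul_mem: "x \<in> N \<Longrightarrow> c \<cdot> x \<in> N"
  by (simp add: smul_def mult_left_mem)

lemma eqv_refl [simp, intro]: "x \<doteq> x"
  by (simp add: eqv_def zero_mem)

lemma eqv_sym: "x \<doteq> y \<Longrightarrow> y \<doteq> x"
  unfolding eqv_def using minus_mem[of "x - y"] by simp

lemma eqv_trans [trans]: "x \<doteq> y \<Longrightarrow> y \<doteq> z \<Longrightarrow> x \<doteq> z"
  unfolding eqv_def using add_mem[of "x - y" "y - z"] by simp

lemma eqv_add: "x \<doteq> y \<Longrightarrow> x' \<doteq> y' \<Longrightarrow> x + x' \<doteq> y + y'"
  unfolding eqv_def using add_mem[of "x - y" "x' - y'"] by (simp add: algebra_simps)

lemma eqv_minus: "x \<doteq> y \<Longrightarrow> - x \<doteq> - y"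
  unfolding eqv_def using minus_mem[of "x - y"] by (simp add: algebra_simps)

lemma eqv_diff: "x \<doteq> y \<Longrightarrow> x' \<doteq> y' \<Longrightarrow> x - x' \<doteq> y - y'"
  using eqv_add[OF _ eqv_minus] by simp

lemma eqv_mult: "x \<doteq> y \<Longrightarrow> x' \<doteq> y' \<Longrightarrow> x * x' \<doteq> y * y'"
  unfolding eqv_def using add_mem[OF mult_right_mem[of "x - y" x'] mult_left_mem[of "x' - y'" y]]
  by (simp add: algebra_simps)

lemma eqv_mult_left: "x' \<doteq> y' \<Longrightarrow> x * x' \<doteq> x * y'"
  and eqv_mult_right: "x \<doteq> y \<Longrightarrow> x * x' \<doteq> y * x'"
  by (simp_all add: eqv_mult)

lemma eqv_smul: "x \<doteq> y \<Longrightarrow> c \<cdot> x \<doteq> c \<cdot> y"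
  unfolding eqv_def using smul_mem[of "x - y"] by (simp add: smul_diff_right)

lemma eqv_sum: "(\<And>i. i \<in> A \<Longrightarrow> f i \<doteq> g i) \<Longrightarrow> (\<Sum>i\<in>A. f i) \<doteq> (\<Sum>i\<in>A. g i)"
  by (induction A rule: infinite_finite_induct) (auto intro: eqv_add)

lemma eqv_power: "x \<doteq> y \<Longrightarrow> x ^ n \<doteq> y ^ n"
  by (induction n) (auto intro: eqv_mult)

lemma eqv_0_iff: "x \<doteq> 0 \<longleftrightarrow> x \<in> N"
  by (simp add: eqv_def)

lemma eqv_iff_diff: "x \<doteq> y \<longleftrightarrow> x - y \<doteq> 0"
  by (simp add: eqv_def)

lemmas eqv_intros = eqv_add eqv_minus eqv_diff eqv_mult eqv_smul eqv_sum eqv_power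

lemma lin_eqv: "lin f \<Longrightarrow> (\<And>x. x \<in> N \<Longrightarrow> f x = 0) \<Longrightarrow> x \<doteq> y \<Longrightarrow> f x = f y"
  unfolding eqv_def using lin_diff[of f x y] by simp

end

section \<open>Arithmetic in the small quantum group\<close>

text \<open>Horner evaluation at an element of a noncommutative algebra. It is still multiplicative
  in the polynomial, since scalars are central and powers of one element commute.\<close>

definition peval :: "complex poly \<Rightarrow> ('m::monoid_add \<Rightarrow>\<^sub>0 complex) \<Rightarrow> ('m \<Rightarrow>\<^sub>0 complex)" where
  "peval f x = fold_coeffs (\<lambda>a s. a \<cdot> 1 + x * s) f 0"

lemma peval_0 [simp]: "peval 0 x = 0"
  by (simp add: peval_def)

lemma peval_pCons [simp]: "peval (pCons a f) x = a \<cdot> 1 + x * peval f x"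
  by (cases "f = 0"; cases "a = 0") (simp_all add: peval_def fold_coeffs_pCons_not_0_0_eq)

lemma peval_1 [simp]: "peval 1 x = 1"
  by (simp add: one_pCons)

lemma peval_add: "peval (f + g) x = peval f x + peval g x"
proof (induction f arbitrary: g)
  case (pCons a f)
  show ?case
    by (cases g) (simp add: pCons.IH smul_add_left distrib_left)
qed simp

lemma peval_smult: "peval (Polynomial.smult c f) x = c \<cdot> peval f x"
  by (induction f) (simp_all add: smul_add_right)

lemma peval_mult: "peval (f * g) x = peval f x * peval g x"
  by (induction f) (simp_all add: peval_add peval_smult distrib_right mult.assoc)

lemma peval_diff: "peval (f - g) x = peval f x - peval g x"
  using peval_add[of f "- g" x] peval_smult[of "-1" g x] by simp

lemma peval_sum: "peval (\<Sum>i\<in>A. f i) x = (\<Sum>i\<in>A. peval (f i) x)"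
  by (induction A rule: infinite_finite_induct) (simp_all add: peval_add)

section \<open>The quotient algebra and its functionals\<close>

lemma rel_ideal_ideal: "ideal (rel_ideal l q) class_ring"
  unfolding rel_ideal_def by (rule ring.genideal_ideal[OF class_ring.ring_axioms]) simp

lemma two_sided_rel_ideal: "two_sided_ideal (rel_ideal l q)"
proof
  interpret I: ideal "rel_ideal l q" class_ring
    by (rule rel_ideal_ideal)
  fix x y a :: free_alg
  show "0 \<in> rel_ideal l q" using I.zero_closed by simp
  show "x \<in> rel_ideal l q \<Longrightarrow> y \<in> rel_ideal l q \<Longrightarrow> x + y \<in> rel_ideal l q"
    using I.a_closed by simp
  show "x \<in> rel_ideal l q \<Longrightarrow> a * x \<in> rel_ideal l q" using I.I_l_closed by simp
  show "x \<in> rel_ideal l q \<Longrightarrow> x * a \<in> rel_ideal l q" using I.I_r_closed by simp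
qed

text \<open>The universal property in the form used for the module action, \<open>Delta\<close> and
  the antipode: what a map annihilates is a two-sided ideal, so that only the eight relators have to
  be checked.\<close>

lemma rel_ideal_subset:
  assumes "two_sided_ideal J" and "relators l q \<subseteq> J"
  shows "rel_ideal l q \<subseteq> J"
proof -
  interpret J: two_sided_ideal J by fact
  have "ideal J class_ring"
  proof (rule idealI)
    show "subgroup J (add_monoid class_ring)"
    proof (rule subgroup.intro)
      fix x assume "x \<in> J"
      then have "\<ominus>\<^bsub>class_ring\<^esub> x \<in> J" by (simp add: class_ring_simps J.minus_mem)
      then show "inv\<^bsub>add_monoid class_ring\<^esub> x \<in> J" by (simp add: a_inv_def)
    qed (auto intro: J.add_mem J.zero_mem)
  qed (auto intro: J.mult_left_mem J.mult_right_mem class_ring.ring_axioms)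
  then show ?thesis
    unfolding rel_ideal_def using assms(2) by (rule ring.genideal_minimal[OF class_ring.ring_axioms])
qed

locale quantum_sl2 =
  fixes l :: nat and q :: complex
begin

sublocale two_sided_ideal "rel_ideal l q"
  by (rule two_sided_rel_ideal)

notation eqv (infix \<open>\<doteq>\<close> 50)

abbreviation cl :: "free_alg \<Rightarrow> free_alg set" where "cl \<equiv> cls l q"

lemma U_carrier: "carrier (U l q) = range (cls l q)"
  by (auto simp: U_def FactRing_def A_RCOSETS_def' cls_def)

lemma cls_eq: "cls l q x = {y. y \<doteq> x}"
proof -
  have "{y. y - x \<in> rel_ideal l q} = {h + x | h. h \<in> rel_ideal l q}"
  proof (intro Collect_cong iffI)
    fix y assume "y - x \<in> rel_ideal l q"
    then show "\<exists>h. y = h + x \<and> h \<in> rel_ideal l q"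
      by (intro exI[of _ "y - x"]) simp
  qed auto
  then show ?thesis
    by (auto simp: cls_def a_r_coset_def r_coset_def eqv_def)
qed

lemma cls_eq_iff: "cls l q x = cls l q y \<longleftrightarrow> x \<doteq> y"
  unfolding cls_eq by (auto intro: eqv_trans eqv_sym)

lemma cls_mem [simp]: "cls l q x \<in> carrier (U l q)"
  by (simp add: U_carrier)

lemma cls_add: "cls l q x \<oplus>\<^bsub>U l q\<^esub> cls l q y = cls l q (x + y)"
  using ideal.axioms(1)[OF rel_ideal_ideal]
  by (simp add: U_def FactRing_def cls_def abelian_subgroup.a_rcos_sum[OF abelian_subgroupI3]
      class_ring.abelian_group_axioms)

lemma cls_mult: "cls l q x \<otimes>\<^bsub>U l q\<^esub> cls l q y = cls l q (x * y)"
  by (simp add: U_def FactRing_def cls_def ideal.rcoset_mult_add[OF rel_ideal_ideal])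

lemma cls_one: "\<one>\<^bsub>U l q\<^esub> = cls l q 1"
  by (simp add: U_def FactRing_def cls_def)

lemma U_scale_cls: "U_scale l q c (cls l q x) = cls l q (c \<cdot> x)"
  by (simp add: U_scale_def cls_mult smul_def)

text \<open>Functionals on \<open>U\<close>, pulled back to representatives; \<open>lift\<close>
  goes the other way. This avoids arguing with functions on cosets.\<close>

definition dual :: "(free_alg \<Rightarrow> complex) \<Rightarrow> bool" where
  "dual f \<longleftrightarrow> lin f \<and> (\<forall>x\<in>rel_ideal l q. f x = 0)"

lemma dual_lin: "dual f \<Longrightarrow> lin f"
  by (simp add: dual_def)

lemma dual_eqv: "dual f \<Longrightarrow> x \<doteq> y \<Longrightarrow> f x = f y"
  by (rule lin_eqv) (auto simp: dual_def)

lemma dual_mult: "dual f \<Longrightarrow> dual (\<lambda>x. f (u * x * v))"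
  unfolding dual_def by (auto intro: lin_mult_both mult_left_mem mult_right_mem)

lemma dual_mult_left: "dual f \<Longrightarrow> dual (\<lambda>x. f (u * x))"
  using dual_mult[of f u 1] by simp

lemma dual_mult_right: "dual f \<Longrightarrow> dual (\<lambda>x. f (x * u))"
  using dual_mult[of f 1 u] by simp

lemma U_dual_dual: 
  assumes p: "p \<in> U_dual l q"
  shows "dual (\<lambda>x. p (cls l q x))"
proof -
  have "lin (\<lambda>x. p (cls l q x))"
  proof (rule linI)
    fix c and x y :: free_alg
    show "p (cls l q (x + y)) = p (cls l q x) + p (cls l q y)"
      using p unfolding U_dual_def by (simp flip: cls_add)
    show "p (cls l q (c \<cdot> x)) = c * p (cls l q x)"
      using p unfolding U_dual_def by (simp flip: U_scale_cls)
  qed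
  moreover have "p (cls l q x) = 0" if "x \<in> rel_ideal l q" for x
  proof -
    have "cls l q x = cls l q 0"
      using that by (simp add: cls_eq_iff eqv_0_iff)
    then show ?thesis using lin_0[OF calculation] by simp
  qed
  ultimately show ?thesis by (simp add: dual_def)
qed

definition lift :: "(free_alg \<Rightarrow> complex) \<Rightarrow> (free_alg set \<Rightarrow> complex)" where
  "lift f = (\<lambda>X\<in>carrier (U l q). f (SOME x. cls l q x = X))"

lemma lift_cls:
  assumes "dual f"
  shows "lift f (cls l q x) = f x"
proof -
  have "cls l q (SOME y. cls l q y = cls l q x) = cls l q x"
    by (rule someI) (rule refl)
  then show ?thesis
    using dual_eqv[OF assms] by (simp add: lift_def cls_eq_iff)
qed

lemma lift_dual:
  assumes "dual f"
  shows "lift f \<in> U_dual l q"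
proof -
  have "lift f \<in> extensional (carrier (U l q))"
    by (simp add: lift_def)
  then show ?thesis
    unfolding U_dual_def U_carrier
    using assms by (simp add: U_scale_cls cls_add lift_cls lin_simps[OF dual_lin])
qed

end

section \<open>Powers of q, residues modulo l and the Fourier transform\<close>

locale small_quantum_group = quantum_sl2 l q for l q +
  assumes l_ge: "3 \<le> l" and l_odd: "odd l" and q_l: "q ^ l = 1"
    and q_prim: "\<And>k. 0 < k \<Longrightarrow> k < l \<Longrightarrow> q ^ k \<noteq> 1"
begin

lemma q_nz [simp]: "q \<noteq> 0"
  using q_l l_ge by (auto simp: power_0_left)

text \<open>\<open>w k\<close> is \<open>q\<^sup>k\<close>; it depends only on \<open>k\<close> modulo \<open>l\<close>, and \<open>e k\<close> below is the idempotent of the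
  eigenvalue \<open>w k\<close> of \<open>K\<close>.\<close>

definition w :: "int \<Rightarrow> complex" where "w k = q powi k"

lemma w_add: "w (a + b) = w a * w b"
  by (simp add: w_def power_int_add)

lemma w_0 [simp]: "w 0 = 1" and w_nz [simp]: "w k \<noteq> 0" and w_1: "w 1 = q"
  by (simp_all add: w_def)

lemma w_minus: "w (- k) = inverse (w k)"
  by (simp add: w_def power_int_minus)

lemma w_diff: "w (a - b) = w a / w b"
  using w_add[of a "- b"] by (simp add: w_minus divide_inverse)

lemma w_mult_minus [simp]: "w k * w (- k) = 1" "w (- k) * w k = 1"
  by (simp_all add: w_minus)

lemma w_mult: "w (a * int n) = w a ^ n" "w (int n * a) = w a ^ n"
  by (simp_all add: w_def power_int_mult mult.commute)

lemma w_of_nat: "w (int n) = q ^ n"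
  by (simp add: w_def)

lemma w_eq_1_iff: "w k = 1 \<longleftrightarrow> int l dvd k"
proof -
  have "w k = w (int l * (k div int l)) * w (k mod int l)"
    by (simp flip: w_add)
  also have "w (int l * (k div int l)) = 1"
    by (simp add: w_def power_int_mult q_l)
  finally have 1: "w k = q ^ nat (k mod int l)"
    using l_ge by (simp flip: w_of_nat)
  have "k mod int l < int l" "0 \<le> k mod int l" using l_ge by simp_all
  then show ?thesis
    unfolding 1 dvd_eq_mod_eq_0
    by (metis nat_0_iff nat_less_iff order_antisym power_0 q_prim gr0I)
qed

lemma w_eq_iff: "w a = w b \<longleftrightarrow> int l dvd a - b"
  using w_eq_1_iff[of "a - b"] by (simp add: w_diff)

text \<open>Here the oddness of \<open>l\<close> enters: \<open>E\<close> and \<open>F\<close>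
  change weights by 2, and doubling is injective modulo \<open>l\<close>.\<close>

lemma l_dvd_double: "int l dvd 2 * k \<longleftrightarrow> int l dvd k"
  using l_odd by (simp add: coprime_dvd_mult_right_iff)

abbreviation Res :: "int set" where "Res \<equiv> {0..<int l}"

lemma l_pos [simp]: "0 < l" and l_nz [simp]: "l \<noteq> 0" using l_ge by simp_all

lemma l_dvd_Res: "j \<in> Res \<Longrightarrow> k \<in> Res \<Longrightarrow> int l dvd j - k \<longleftrightarrow> j = k"
  by (metis atLeastLessThan_iff mod_eq_dvd_iff mod_pos_pos_trivial)

text \<open>Orthogonality of the characters of the cyclic group of order \<open>l\<close>: a
  geometric sum whose ratio is an \<open>l\<close>-th root of unity.\<close>

lemma sum_w: "(\<Sum>j<l. w (a * int j)) = (if int l dvd a then of_nat l else 0)"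
proof (cases "int l dvd a")
  case True
  then have "w a = 1" by (simp add: w_eq_1_iff)
  then show ?thesis using True by (simp add: w_mult)
next
  case False
  then have "w a \<noteq> 1" by (simp add: w_eq_1_iff)
  moreover have "w a ^ l = 1" unfolding w_mult(1)[symmetric] by (simp add: w_eq_1_iff)
  ultimately show ?thesis using False by (simp add: w_mult geometric_sum)
qed

lemma sum_Res_nat: "(\<Sum>k\<in>Res. h k) = (\<Sum>j<l. h (int j))"
  by (rule sum.reindex_bij_witness[of _ int nat]) auto

lemma sum_Res_w: "(\<Sum>k\<in>Res. w (k * a)) = (if int l dvd a then of_nat l else 0)"
  using sum_w[of a] by (simp add: sum_Res_nat mult.commute)

lemma sum_Res_shift:
  assumes "\<And>k k'. int l dvd k - k' \<Longrightarrow> h k = h k'"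
  shows "(\<Sum>k\<in>Res. h (k + a)) = (\<Sum>k\<in>Res. h k)"
proof (rule sum.reindex_bij_witness[of _ "\<lambda>k. (k - a) mod int l" "\<lambda>k. (k + a) mod int l"])
  fix k assume "k \<in> Res"
  then show "((k + a) mod int l - a) mod int l = k" "((k - a) mod int l + a) mod int l = k"
    by (simp_all add: mod_simps)
  show "h ((k + a) mod int l) = h (k + a)"
    by (rule assms) (simp add: mod_eq_dvd_iff[symmetric])
qed simp_all

definition dq :: complex where "dq = q - inverse q"

lemma dq_nz [simp]: "dq \<noteq> 0"
proof
  assume "dq = 0"
  then have "q * q = q * inverse q" unfolding dq_def by simp
  then have "q ^ 2 = 1" by (simp add: power2_eq_square)
  then show False using q_prim[of 2] l_ge by simp
qed

definition e :: "int \<Rightarrow> free_alg" where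
  "e k = (\<Sum>j<l. (w (- k * int j) / of_nat l) \<cdot> gK ^ j)"

text \<open>The Casimir element acts by \<open>gam k\<close> on a highest weight vector of weight \<open>k\<close>.\<close>

definition gam :: "int \<Rightarrow> complex" where
  "gam k = (w (k + 1) + w (- k - 1)) / dq\<^sup>2"

definition casimir :: free_alg where
  "casimir = gF * gE + (1 / dq\<^sup>2) \<cdot> (q \<cdot> gK + inverse q \<cdot> gKinv)"

section \<open>The defining relations and the weight idempotents\<close>

lemma relator_eqv:
  assumes "a - b \<in> relators l q"
  shows "a \<doteq> b"
proof -
  have "a - b \<in> rel_ideal l q"
    unfolding rel_ideal_def
    using ring.genideal_self[OF class_ring.ring_axioms, of "relators l q"] assms by auto
  then show ?thesis by (simp add: eqv_def)
qed

lemma rel_KKi: "gK * gKinv \<doteq> 1" and rel_KiK: "gKinv * gK \<doteq> 1"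
  by (rule relator_eqv; simp add: relators_def)+

lemma rel_Kl: "gK ^ l \<doteq> 1"
  by (rule relator_eqv; simp add: relators_def)

lemma rel_El: "gE ^ l \<doteq> 0" and rel_Fl: "gF ^ l \<doteq> 0"
  by (rule relator_eqv; simp add: relators_def)+

lemma rel_KEKi: "gK * gE * gKinv \<doteq> w 2 \<cdot> gE" and rel_KFKi: "gK * gF * gKinv \<doteq> w (- 2) \<cdot> gF"
  by (rule relator_eqv; simp add: relators_def w_def smul_def)+

lemma rel_EF: "gE * gF - gF * gE \<doteq> (1 / dq) \<cdot> (gK - gKinv)"
  by (rule relator_eqv; simp add: relators_def dq_def smul_def)

lemma rel_KE: "gK * gE \<doteq> w 2 \<cdot> (gE * gK)"
proof -
  have "gK * gE \<doteq> gK * gE * (gKinv * gK)"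
    using eqv_mult_left[OF eqv_sym[OF rel_KiK], of "gK * gE"] by simp
  also have "\<dots> = gK * gE * gKinv * gK" by (simp add: mult.assoc)
  also have "\<dots> \<doteq> w 2 \<cdot> gE * gK" by (intro eqv_mult_right rel_KEKi)
  finally show ?thesis by simp
qed

lemma rel_KF: "gK * gF \<doteq> w (- 2) \<cdot> (gF * gK)"
proof -
  have "gK * gF \<doteq> gK * gF * (gKinv * gK)"
    using eqv_mult_left[OF eqv_sym[OF rel_KiK], of "gK * gF"] by simp
  also have "\<dots> = gK * gF * gKinv * gK" by (simp add: mult.assoc)
  also have "\<dots> \<doteq> w (- 2) \<cdot> gF * gK" by (intro eqv_mult_right rel_KFKi)
  finally show ?thesis by simp
qed

text \<open>Since the inverse of \<open>K\<close> is a power of \<open>K\<close>, facts about the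
  letter \<open>gKinv\<close> reduce to facts about \<open>gK\<close>.\<close>

lemma rel_Ki: "gKinv \<doteq> gK ^ (l - 1)"
proof -
  have "gKinv \<doteq> gKinv * gK ^ l"
    using eqv_mult_left[OF eqv_sym[OF rel_Kl], of gKinv] by simp
  also have "\<dots> = gKinv * gK * gK ^ (l - 1)"
    by (simp add: mult.assoc flip: power_Suc)
  also have "\<dots> \<doteq> 1 * gK ^ (l - 1)" by (intro eqv_mult_right rel_KiK)
  finally show ?thesis by simp
qed

lemma Kpow_twist:
  assumes "gK * x \<doteq> c \<cdot> (x * gK)"
  shows "gK ^ n * x \<doteq> c ^ n \<cdot> (x * gK ^ n)"
proof (induction n)
  case (Suc n)
  have "gK ^ Suc n * x = gK * (gK ^ n * x)" by (simp add: mult.assoc)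
  also have "\<dots> \<doteq> gK * (c ^ n \<cdot> (x * gK ^ n))" by (intro eqv_mult_left Suc)
  also have "\<dots> = c ^ n \<cdot> (gK * x * gK ^ n)" by (simp add: mult.assoc)
  also have "\<dots> \<doteq> c ^ n \<cdot> (c \<cdot> (x * gK) * gK ^ n)" by (intro eqv_smul eqv_mult_right assms)
  finally show ?case by (simp add: mult.assoc mult.commute)
qed simp

lemma e_cong: "int l dvd k - k' \<Longrightarrow> e k = e k'"
proof -
  assume "int l dvd k - k'"
  then have "w k = w k'" by (simp add: w_eq_iff)
  then have "w (- k) = w (- k')" by (simp add: w_minus)
  then show ?thesis unfolding e_def w_mult(1) by simp
qed

lemma sum_e: "(\<Sum>k\<in>Res. e k) = 1"
proof -
  have "(\<Sum>k\<in>Res. e k) = (\<Sum>j<l. (\<Sum>k\<in>Res. w (k * (- int j)) / of_nat l) \<cdot> gK ^ j)"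
    unfolding e_def by (subst sum.swap) (simp add: smul_sum_left)
  also have "\<dots> = (\<Sum>j<l. (if int l dvd int j then 1 else 0) \<cdot> gK ^ j)"
  proof (rule sum.cong)
    fix j
    show "(\<Sum>k\<in>Res. w (k * (- int j)) / of_nat l) \<cdot> gK ^ j = (if int l dvd int j then 1 else 0) \<cdot> gK ^ j"
      unfolding sum_divide_distrib[symmetric] sum_Res_w by simp
  qed simp
  also have "\<dots> = (\<Sum>j<l. if j = 0 then 1 else 0)"
    by (rule sum.cong) (auto dest: dvd_imp_le)
  finally show ?thesis by simp
qed

lemma K_e: "gK * e k \<doteq> w k \<cdot> e k"
proof -
  define h where "h j = (w (- k * (int j - 1)) / of_nat l) \<cdot> gK ^ j" for j
  have "gK * e k = (\<Sum>j<l. h (Suc j))"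
    by (simp add: e_def h_def sum_distrib_left)
  also have "\<dots> = (\<Sum>j<l. h j) - h 0 + h l"
    using sum.lessThan_Suc[of h l] sum.lessThan_Suc_shift[of h l] by (simp add: algebra_simps)
  \<comment> \<open>Multiplication by \<open>K\<close> shifts the Fourier sum by one index. The term
    that leaves at \<open>l\<close> agrees with the missing one at 0, because \<open>K^l = 1\<close>
    and the coefficients are \<open>l\<close>-periodic.\<close>
  also have "\<dots> \<doteq> (\<Sum>j<l. h j) - h 0 + h 0"
  proof (intro eqv_intros eqv_refl)
    have "w (- k * (int l - 1)) = w (- k * (int 0 - 1))"
      by (simp add: w_eq_iff algebra_simps)
    then show "h l \<doteq> h 0" unfolding h_def using rel_Kl by (simp add: eqv_smul)
  qed
  also have "\<dots> = w k \<cdot> e k"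
    by (simp add: e_def h_def smul_sum_right algebra_simps w_diff w_minus w_add divide_inverse)
  finally show ?thesis .
qed

lemma Kpow_e: "gK ^ n * e k \<doteq> w (int n * k) \<cdot> e k"
proof (induction n)
  case (Suc n)
  have "gK ^ Suc n * e k = gK * (gK ^ n * e k)" by (simp add: mult.assoc)
  also have "\<dots> \<doteq> gK * (w (int n * k) \<cdot> e k)" by (intro eqv_mult_left Suc)
  also have "\<dots> = w (int n * k) \<cdot> (gK * e k)" by simp
  also have "\<dots> \<doteq> w (int n * k) \<cdot> w k \<cdot> e k" by (intro eqv_smul K_e)
  also have "\<dots> = w (int (Suc n) * k) \<cdot> e k" by (simp add: algebra_simps w_add)
  finally show ?case .
qed simp

lemma Ki_e: "gKinv * e k \<doteq> w (- k) \<cdot> e k"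
proof -
  have "gKinv * e k \<doteq> gK ^ (l - 1) * e k" by (intro eqv_mult_right rel_Ki)
  also have "\<dots> \<doteq> w (int (l - 1) * k) \<cdot> e k" by (rule Kpow_e)
  also have "w (int (l - 1) * k) = w (- k)"
    using l_ge by (simp add: w_eq_iff algebra_simps of_nat_diff)
  finally show ?thesis .
qed

lemma e_mult_e: "e j * e k \<doteq> (if int l dvd j - k then e k else 0)"
proof -
  have "e j * e k = (\<Sum>i<l. (w (- j * int i) / of_nat l) \<cdot> (gK ^ i * e k))"
    by (simp add: e_def[of j] sum_distrib_right)
  also have "\<dots> \<doteq> (\<Sum>i<l. (w (- j * int i) / of_nat l) \<cdot> w (int i * k) \<cdot> e k)"
    by (intro eqv_intros Kpow_e)
  also have "\<dots> = (\<Sum>i<l. w ((k - j) * int i) / of_nat l) \<cdot> e k"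
    by (simp add: smul_sum_left algebra_simps flip: w_add)
  also have "\<dots> = (if int l dvd j - k then e k else 0)"
    using dvd_minus_iff[of "int l" "j - k"] by (simp add: sum_w flip: sum_divide_distrib)
  finally show ?thesis .
qed

lemma e_idem: "e k * e k \<doteq> e k"
  using e_mult_e[of k k] by simp

text \<open>Moving \<open>x\<close> through \<open>K^j\<close> costs the factor
  \<open>w a ^ j\<close>, and a character in \<open>j\<close> shifts the argument of a Fourier
  transform.\<close>

lemma e_twist:
  assumes "gK * x \<doteq> w a \<cdot> (x * gK)"
  shows "e k * x \<doteq> x * e (k - a)"
proof -
  have "e k * x = (\<Sum>j<l. (w (- k * int j) / of_nat l) \<cdot> (gK ^ j * x))"
    by (simp add: e_def sum_distrib_right)
  also have "\<dots> \<doteq> (\<Sum>j<l. (w (- k * int j) / of_nat l) \<cdot> w a ^ j \<cdot> (x * gK ^ j))"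
    by (intro eqv_intros Kpow_twist assms)
  also have "\<dots> = x * e (k - a)"
    by (simp add: e_def sum_distrib_left algebra_simps flip: w_mult w_add)
  finally show ?thesis .
qed

lemma e_E: "e k * gE \<doteq> gE * e (k - 2)" and e_F: "e k * gF \<doteq> gF * e (k + 2)"
  using e_twist[OF rel_KE, of k] e_twist[OF rel_KF, of k] by simp_all

lemma e_K: "e k * gK \<doteq> w k \<cdot> e k"
proof -
  have "e k * gK \<doteq> gK * e k" using e_twist[of gK 0 k] by simp
  also have "\<dots> \<doteq> w k \<cdot> e k" by (rule K_e)
  finally show ?thesis .
qed

lemma E_e: "gE * e k \<doteq> e (k + 2) * gE" and F_e: "gF * e k \<doteq> e (k - 2) * gF"
  using e_E[of "k + 2"] e_F[of "k - 2"] by (simp_all add: eqv_sym)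

lemma Epow_e: "gE ^ n * e k \<doteq> e (k + 2 * int n) * gE ^ n"
proof (induction n arbitrary: k)
  case (Suc n)
  have "gE ^ Suc n * e k = gE ^ n * (gE * e k)" by (simp only: power_Suc2 mult.assoc)
  also have "\<dots> \<doteq> gE ^ n * (e (k + 2) * gE)" by (intro eqv_mult_left E_e)
  also have "\<dots> = gE ^ n * e (k + 2) * gE" by (simp add: mult.assoc)
  also have "\<dots> \<doteq> e (k + 2 + 2 * int n) * gE ^ n * gE" by (intro eqv_mult_right Suc)
  finally show ?case by (simp add: power_Suc2 algebra_simps del: power_Suc)
qed simp

lemma Fpow_e: "gF ^ n * e k \<doteq> e (k - 2 * int n) * gF ^ n"
proof (induction n arbitrary: k)
  case (Suc n)
  have "gF ^ Suc n * e k = gF ^ n * (gF * e k)" by (simp only: power_Suc2 mult.assoc)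
  also have "\<dots> \<doteq> gF ^ n * (e (k - 2) * gF)" by (intro eqv_mult_left F_e)
  also have "\<dots> = gF ^ n * e (k - 2) * gF" by (simp add: mult.assoc)
  also have "\<dots> \<doteq> e (k - 2 - 2 * int n) * gF ^ n * gF" by (intro eqv_mult_right Suc)
  finally show ?case by (simp add: power_Suc2 algebra_simps del: power_Suc)
qed simp

section \<open>The Casimir element and monomials\<close>

text \<open>The right-hand side is the scalar of the commutator of \<open>E\<close> and
  \<open>F\<close> on weight \<open>k\<close>; so \<open>F E\<close> and \<open>E F\<close> are both
  \<open>C\<close> minus a value of \<open>gam\<close>, at weights that differ by 2.\<close>

lemma gam_step: "gam k - gam (k - 2) = (w k - w (- k)) / dq"
proof -
  have "w (k + 1) + w (- k - 1) - (w (k - 1) + w (1 - k)) = (w k - w (- k)) * dq"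
    unfolding dq_def by (simp add: w_add w_diff w_minus w_1 field_simps)
  moreover have "gam k - gam (k - 2) = (w (k + 1) + w (- k - 1) - (w (k - 1) + w (1 - k))) / dq\<^sup>2"
    unfolding gam_def by (simp add: diff_divide_distrib)
  ultimately show ?thesis
    by (simp add: power2_eq_square)
qed

lemma gam_cong: "int l dvd k - k' \<Longrightarrow> gam k = gam k'"
proof -
  assume *: "int l dvd k - k'"
  have "w (k + 1) = w (k' + 1)" using * by (simp add: w_eq_iff)
  moreover have "w (- k - 1) = w (- k' - 1)" using * by (simp add: w_eq_iff dvd_diff_commute)
  ultimately show ?thesis by (simp add: gam_def)
qed

text \<open>\<open>- k - 2\<close> is the image of \<open>k\<close> under the dot action of the Weyl
  group reflection.\<close>

lemma gam_reflect: "gam (- k - 2) = gam k"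
proof -
  have "- k - 2 + 1 = - k - 1" "- (- k - 2) - 1 = k + 1" by simp_all
  then show ?thesis unfolding gam_def by (simp only: add.commute)
qed

text \<open>With \<open>x = w (j + 1)\<close> and \<open>y = w (k + 1)\<close>, the equation
  \<open>x + 1/x = y + 1/y\<close> is \<open>(x - y) (x y - 1) = 0\<close>.\<close>

lemma gam_eq_iff: "gam j = gam k \<longleftrightarrow> int l dvd j - k \<or> int l dvd j + k + 2"
proof -
  have "gam j = gam k \<longleftrightarrow> w (j + 1) + w (- (j + 1)) = w (k + 1) + w (- (k + 1))"
    by (simp add: gam_def)
  also have "\<dots> \<longleftrightarrow> (w (j + 1) - w (k + 1)) * (w (j + 1) * w (k + 1) - 1) = 0"
    unfolding w_minus by (simp add: field_simps)
  also have "\<dots> \<longleftrightarrow> w (j + 1) = w (k + 1) \<or> w (j + k + 2) = 1"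
    by (simp add: ac_simps flip: w_add)
  finally show ?thesis by (simp add: w_eq_iff w_eq_1_iff)
qed

lemma FE_e: "gF * gE * e k \<doteq> (casimir - gam k \<cdot> 1) * e k"
proof -
  have "gF * gE * e k = casimir * e k - (1 / dq\<^sup>2) \<cdot> (q \<cdot> (gK * e k) + inverse q \<cdot> (gKinv * e k))"
    by (simp add: casimir_def distrib_right)
  also have "\<dots> \<doteq> casimir * e k - (1 / dq\<^sup>2) \<cdot> (q \<cdot> w k \<cdot> e k + inverse q \<cdot> w (- k) \<cdot> e k)"
    by (intro eqv_intros eqv_refl K_e Ki_e)
  also have "\<dots> = (casimir - gam k \<cdot> 1) * e k"
    by (simp add: gam_def left_diff_distrib w_add w_diff w_1 w_minus smul_add_right smul_add_left
      add_divide_distrib divide_inverse algebra_simps)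
  finally show ?thesis .
qed

lemma EF_FE: "gE * gF \<doteq> gF * gE + (1 / dq) \<cdot> (gK - gKinv)"
  using eqv_add[OF rel_EF eqv_refl[of "gF * gE"]] by (simp add: add.commute)

lemma EF_e: "gE * gF * e k \<doteq> (casimir - gam (k - 2) \<cdot> 1) * e k"
proof -
  have "gE * gF * e k \<doteq> (gF * gE + (1 / dq) \<cdot> (gK - gKinv)) * e k"
    by (intro eqv_mult_right EF_FE)
  also have "\<dots> = gF * gE * e k + (1 / dq) \<cdot> (gK * e k - gKinv * e k)"
    by (simp add: algebra_simps)
  also have "\<dots> \<doteq> (casimir - gam k \<cdot> 1) * e k + (1 / dq) \<cdot> (w k \<cdot> e k - w (- k) \<cdot> e k)"
    by (intro eqv_intros FE_e K_e Ki_e)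
  also have "\<dots> = (casimir - gam k \<cdot> 1) * e k + ((w k - w (- k)) / dq) \<cdot> e k"
    by (simp add: smul_diff_left smul_diff_right diff_divide_distrib)
  also have "\<dots> = (casimir - gam (k - 2) \<cdot> 1) * e k"
    by (simp add: left_diff_distrib smul_diff_left flip: gam_step)
  finally show ?thesis .
qed

text \<open>The idempotents sum to 1, so a congruence may be tested weight by weight.\<close>

lemma eqv_by_e:
  assumes "\<And>k. x * e k \<doteq> y * e k"
  shows "x \<doteq> y"
proof -
  have "x = (\<Sum>k\<in>Res. x * e k)" by (simp add: sum_e flip: sum_distrib_left)
  also have "\<dots> \<doteq> (\<Sum>k\<in>Res. y * e k)" by (intro eqv_sum assms)
  also have "\<dots> = y" by (simp add: sum_e flip: sum_distrib_left)
  finally show ?thesis .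
qed

lemma commute_all:
  assumes "x * gE \<doteq> gE * x" and "x * gF \<doteq> gF * x" and "x * gK \<doteq> gK * x"
  shows "x * y \<doteq> y * x"
proof (induction y rule: free_alg_induct)
  case (gen g y)
  have Kn: "x * gK ^ n \<doteq> gK ^ n * x" for n
  proof (induction n)
    case (Suc n)
    have "x * gK ^ Suc n = x * gK * gK ^ n" by (simp add: mult.assoc)
    also have "\<dots> \<doteq> gK * x * gK ^ n" by (intro eqv_mult_right assms)
    also have "\<dots> = gK * (x * gK ^ n)" by (simp add: mult.assoc)
    also have "\<dots> \<doteq> gK * (gK ^ n * x)" by (intro eqv_mult_left Suc)
    finally show ?case by (simp add: mult.assoc)
  qed simp
  have "x * gKinv \<doteq> x * gK ^ (l - 1)" by (intro eqv_mult_left rel_Ki)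
  also have "\<dots> \<doteq> gK ^ (l - 1) * x" by (rule Kn)
  also have "\<dots> \<doteq> gKinv * x" by (intro eqv_mult_right eqv_sym[OF rel_Ki])
  finally have "x * gen g \<doteq> gen g * x" using assms by (cases g) auto
  then have "x * gen g * y \<doteq> gen g * x * y" by (rule eqv_mult_right)
  also have "\<dots> = gen g * (x * y)" by (simp add: mult.assoc)
  also have "\<dots> \<doteq> gen g * (y * x)" by (intro eqv_mult_left gen)
  finally show ?case by (simp add: mult.assoc)
next
  case (add y z)
  then show ?case by (simp add: distrib_left distrib_right eqv_add)
next
  case (smul c y)
  then show ?case by (simp add: eqv_smul)
qed simp

lemma casimir_K: "casimir * gK \<doteq> gK * casimir"
proof (rule eqv_by_e)
  fix k
  have FEe: "gF * gE * e k \<doteq> e k * (gF * gE)"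
  proof -
    have "gF * gE * e k = gF * (gE * e k)" by (simp add: mult.assoc)
    also have "\<dots> \<doteq> gF * (e (k + 2) * gE)" by (intro eqv_mult_left E_e)
    also have "\<dots> = gF * e (k + 2) * gE" by (simp add: mult.assoc)
    also have "\<dots> \<doteq> e (k + 2 - 2) * gF * gE" by (intro eqv_mult_right F_e)
    finally show ?thesis by (simp add: mult.assoc)
  qed
  have "casimir * e k \<doteq> e k * (gF * gE) + gam k \<cdot> e k"
  proof -
    have "casimir * e k = (casimir - gam k \<cdot> 1) * e k + gam k \<cdot> e k" by (simp add: algebra_simps)
    also have "\<dots> \<doteq> gF * gE * e k + gam k \<cdot> e k" by (intro eqv_add eqv_sym[OF FE_e] eqv_refl)
    also have "\<dots> \<doteq> e k * (gF * gE) + gam k \<cdot> e k" by (intro eqv_add FEe eqv_refl)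
    finally show ?thesis .
  qed
  note * = this
  have "gK * casimir * e k \<doteq> gK * (e k * (gF * gE) + gam k \<cdot> e k)"
    unfolding mult.assoc by (intro eqv_mult_left *)
  also have "\<dots> = (gK * e k) * (gF * gE) + gam k \<cdot> (gK * e k)" by (simp add: algebra_simps)
  also have "\<dots> \<doteq> w k \<cdot> e k * (gF * gE) + gam k \<cdot> w k \<cdot> e k"
    by (intro eqv_intros K_e eqv_refl)
  also have "\<dots> = w k \<cdot> (e k * (gF * gE) + gam k \<cdot> e k)" by (simp add: smul_add_right mult.commute)
  also have "\<dots> \<doteq> w k \<cdot> (casimir * e k)" by (intro eqv_smul eqv_sym[OF *])
  also have "\<dots> = casimir * (w k \<cdot> e k)" by simp
  also have "\<dots> \<doteq> casimir * (gK * e k)" by (intro eqv_mult_left eqv_sym[OF K_e])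
  finally show "casimir * gK * e k \<doteq> gK * casimir * e k" by (simp add: mult.assoc eqv_sym)
qed

text \<open>\<open>E F E e_k\<close> is read in two ways: \<open>F E\<close> on weight
  \<open>k\<close> and \<open>E F\<close> on weight \<open>k + 2\<close> are both
  \<open>C - gam k\<close>.\<close>

lemma casimir_E: "casimir * gE \<doteq> gE * casimir"
proof (rule eqv_by_e)
  fix k
  have "casimir * gE * e k = casimir * (gE * e k)" by (simp add: mult.assoc)
  also have "\<dots> \<doteq> casimir * (e (k + 2) * gE)" by (intro eqv_mult_left E_e)
  also have "\<dots> = (casimir - gam (k + 2 - 2) \<cdot> 1) * e (k + 2) * gE + gam k \<cdot> (e (k + 2) * gE)"
    by (simp add: algebra_simps)
  also have "\<dots> \<doteq> gE * gF * e (k + 2) * gE + gam k \<cdot> (e (k + 2) * gE)"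
    by (intro eqv_add eqv_refl eqv_mult_right eqv_sym[OF EF_e])
  also have "\<dots> = gE * gF * (e (k + 2) * gE) + gam k \<cdot> (e (k + 2) * gE)" by (simp add: mult.assoc)
  also have "\<dots> \<doteq> gE * gF * (gE * e k) + gam k \<cdot> (gE * e k)"
    by (intro eqv_intros eqv_refl eqv_sym[OF E_e])
  also have "\<dots> = gE * (gF * gE * e k + gam k \<cdot> e k)" by (simp add: algebra_simps)
  also have "\<dots> \<doteq> gE * ((casimir - gam k \<cdot> 1) * e k + gam k \<cdot> e k)" by (intro eqv_intros eqv_refl FE_e)
  also have "\<dots> = gE * casimir * e k" by (simp add: algebra_simps)
  finally show "casimir * gE * e k \<doteq> gE * casimir * e k" .
qed

lemma casimir_F: "casimir * gF \<doteq> gF * casimir"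
proof (rule eqv_by_e)
  fix k
  have "casimir * gF * e k = casimir * (gF * e k)" by (simp add: mult.assoc)
  also have "\<dots> \<doteq> casimir * (e (k - 2) * gF)" by (intro eqv_mult_left F_e)
  also have "\<dots> = (casimir - gam (k - 2) \<cdot> 1) * e (k - 2) * gF + gam (k - 2) \<cdot> (e (k - 2) * gF)"
    by (simp add: algebra_simps)
  also have "\<dots> \<doteq> gF * gE * e (k - 2) * gF + gam (k - 2) \<cdot> (e (k - 2) * gF)"
    by (intro eqv_add eqv_refl eqv_mult_right eqv_sym[OF FE_e])
  also have "\<dots> = gF * gE * (e (k - 2) * gF) + gam (k - 2) \<cdot> (e (k - 2) * gF)" by (simp add: mult.assoc)
  also have "\<dots> \<doteq> gF * gE * (gF * e k) + gam (k - 2) \<cdot> (gF * e k)"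
    by (intro eqv_intros eqv_refl eqv_sym[OF F_e])
  also have "\<dots> = gF * (gE * gF * e k + gam (k - 2) \<cdot> e k)" by (simp add: algebra_simps)
  also have "\<dots> \<doteq> gF * ((casimir - gam (k - 2) \<cdot> 1) * e k + gam (k - 2) \<cdot> e k)"
    by (intro eqv_intros eqv_refl EF_e)
  also have "\<dots> = gF * casimir * e k" by (simp add: algebra_simps)
  finally show "casimir * gF * e k \<doteq> gF * casimir * e k" .
qed

lemma casimir_comm: "casimir * x \<doteq> x * casimir"
  by (rule commute_all[OF casimir_E casimir_F casimir_K])

section \<open>Polynomials in the Casimir element\<close>

abbreviation pc :: "complex poly \<Rightarrow> free_alg" where "pc f \<equiv> peval f casimir"

lemma pc_comm: "pc f * x \<doteq> x * pc f"
proof (induction f)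
  case (pCons a f)
  have "pc (pCons a f) * x = a \<cdot> x + casimir * (pc f * x)" by (simp add: algebra_simps)
  also have "\<dots> \<doteq> a \<cdot> x + casimir * (x * pc f)" by (intro eqv_intros eqv_refl pCons)
  also have "\<dots> = a \<cdot> x + (casimir * x) * pc f" by (simp add: mult.assoc)
  also have "\<dots> \<doteq> a \<cdot> x + (x * casimir) * pc f" by (intro eqv_intros eqv_refl casimir_comm)
  finally show ?case by (simp add: algebra_simps)
qed simp

lemma pc_lin: "pc [:- a, 1:] = casimir - a \<cdot> 1"
  by simp

text \<open>The polynomial with \<open>F^m E^m e_k = P k m (C) e_k\<close>: one factor for each
  weight \<open>k, k + 2, ...\<close> that the powers of \<open>E\<close> pass through.\<close>

definition P :: "int \<Rightarrow> nat \<Rightarrow> complex poly" where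
  "P k m = (\<Prod>i<m. [:- gam (k + 2 * int i), 1:])"

lemma P_0 [simp]: "P k 0 = 1"
  by (simp add: P_def)

lemma P_Suc: "P k (Suc m) = P k m * [:- gam (k + 2 * int m), 1:]"
  unfolding P_def by simp

lemma P_Suc_shift: "P k (Suc m) = [:- gam k, 1:] * P (k + 2) m"
  unfolding P_def by (subst prod.lessThan_Suc_shift) (simp add: algebra_simps)

lemma P_cong: "int l dvd k - k' \<Longrightarrow> P k m = P k' m"
  unfolding P_def by (intro prod.cong refl arg_cong[where f = "\<lambda>a. [:- a, 1:]"] gam_cong) simp

lemma P_nz [simp]: "P k m \<noteq> 0"
  by (simp add: P_def)

lemma P_monic: "degree (P k m) = m" "lead_coeff (P k m) = 1"
proof -
  show "degree (P k m) = m"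
    by (induction m) (simp_all add: P_Suc degree_mult_eq del: mult_pCons_right)
  show "lead_coeff (P k m) = 1"
    by (induction m) (simp, simp only: P_Suc lead_coeff_mult, simp)
qed

text \<open>The inner product \<open>F^m E^m\<close> meets weight \<open>k + 2\<close> and becomes a
  polynomial in \<open>C\<close>, which commutes out and leaves \<open>F E e_k\<close>.\<close>

lemma FE_pow_e: "gF ^ m * gE ^ m * e k \<doteq> pc (P k m) * e k"
proof (induction m arbitrary: k)
  case (Suc m)
  have "gF ^ Suc m * gE ^ Suc m * e k = gF * gF ^ m * gE ^ m * (gE * e k)"
    unfolding power_Suc[of gF] power_Suc2[of gE] by (simp only: mult.assoc)
  also have "\<dots> \<doteq> gF * gF ^ m * gE ^ m * (e (k + 2) * gE)" by (intro eqv_mult_left E_e)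
  also have "\<dots> = gF * (gF ^ m * gE ^ m * e (k + 2)) * gE" by (simp add: mult.assoc)
  also have "\<dots> \<doteq> gF * (pc (P (k + 2) m) * e (k + 2)) * gE" by (intro eqv_mult_left eqv_mult_right Suc)
  also have "\<dots> = gF * pc (P (k + 2) m) * (e (k + 2) * gE)" by (simp add: mult.assoc)
  also have "\<dots> \<doteq> pc (P (k + 2) m) * gF * (gE * e k)"
    by (intro eqv_mult eqv_sym[OF E_e] eqv_sym[OF pc_comm])
  also have "\<dots> = pc (P (k + 2) m) * (gF * gE * e k)" by (simp add: mult.assoc)
  also have "\<dots> \<doteq> pc (P (k + 2) m) * (pc [:- gam k, 1:] * e k)"
    unfolding pc_lin by (intro eqv_mult_left FE_e)
  also have "\<dots> = pc (P k (Suc m)) * e k"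
    unfolding P_Suc_shift by (subst mult.commute) (simp only: peval_mult mult.assoc)
  finally show ?case .
qed simp

lemma EF_pow_e: "gE ^ m * gF ^ m * e k \<doteq> pc (P (k - 2 * int m) m) * e k"
proof (induction m arbitrary: k)
  case (Suc m)
  let ?p = "P (k - 2 - 2 * int m) m"
  have "gE ^ Suc m * gF ^ Suc m * e k = gE * gE ^ m * gF ^ m * (gF * e k)"
    unfolding power_Suc[of gE] power_Suc2[of gF] by (simp only: mult.assoc)
  also have "\<dots> \<doteq> gE * gE ^ m * gF ^ m * (e (k - 2) * gF)" by (intro eqv_mult_left F_e)
  also have "\<dots> = gE * (gE ^ m * gF ^ m * e (k - 2)) * gF" by (simp add: mult.assoc)
  also have "\<dots> \<doteq> gE * (pc ?p * e (k - 2)) * gF" by (intro eqv_mult_left eqv_mult_right Suc)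
  also have "\<dots> = gE * pc ?p * (e (k - 2) * gF)" by (simp add: mult.assoc)
  also have "\<dots> \<doteq> pc ?p * gE * (gF * e k)"
    by (intro eqv_mult eqv_sym[OF F_e] eqv_sym[OF pc_comm])
  also have "\<dots> = pc ?p * (gE * gF * e k)" by (simp add: mult.assoc)
  also have "\<dots> \<doteq> pc ?p * (pc [:- gam (k - 2), 1:] * e k)"
    unfolding pc_lin by (intro eqv_mult_left EF_e)
  also have "\<dots> = pc (P (k - 2 * int (Suc m)) (Suc m)) * e k"
  proof -
    have "k - 2 * int (Suc m) = k - 2 - 2 * int m" by simp
    then show ?thesis by (simp only: P_Suc peval_mult mult.assoc diff_add_cancel)
  qed
  finally show ?case .
qed simp

lemma E_pow_ge: "l \<le> n \<Longrightarrow> gE ^ n \<doteq> 0" and F_pow_ge: "l \<le> n \<Longrightarrow> gF ^ n \<doteq> 0"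
  using eqv_mult_right[OF rel_El, of "gE ^ (n - l)"] eqv_mult_right[OF rel_Fl, of "gF ^ (n - l)"]
  by (simp_all flip: power_add)

section \<open>Ordered monomials span the algebra\<close>

definition bas :: "nat \<Rightarrow> nat \<Rightarrow> int \<Rightarrow> free_alg" where
  "bas a c k = gF ^ a * gE ^ c * e k"

lemma bas_ge: "l \<le> a \<or> l \<le> c \<Longrightarrow> bas a c k \<doteq> 0"
  unfolding bas_def
  using eqv_mult_right[OF eqv_mult_left[OF E_pow_ge, of c "gF ^ a"], of "e k"]
    eqv_mult_right[OF eqv_mult_right[OF F_pow_ge, of a "gE ^ c"], of "e k"] by auto

lemma bas_weight: "bas a c k \<doteq> e (k + 2 * int c - 2 * int a) * (gF ^ a * gE ^ c)"
proof -
  have "bas a c k = gF ^ a * (gE ^ c * e k)" by (simp add: bas_def mult.assoc)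
  also have "\<dots> \<doteq> gF ^ a * (e (k + 2 * int c) * gE ^ c)" by (intro eqv_mult_left Epow_e)
  also have "\<dots> = gF ^ a * e (k + 2 * int c) * gE ^ c" by (simp add: mult.assoc)
  also have "\<dots> \<doteq> e (k + 2 * int c - 2 * int a) * gF ^ a * gE ^ c" by (intro eqv_mult_right Fpow_e)
  finally show ?thesis by (simp add: mult.assoc)
qed

lemma e_bas: "e j * bas a c k \<doteq> (if int l dvd j - (k + 2 * int c - 2 * int a) then bas a c k else 0)"
proof -
  let ?k = "k + 2 * int c - 2 * int a"
  have "e j * bas a c k \<doteq> e j * (e ?k * (gF ^ a * gE ^ c))" by (intro eqv_mult_left bas_weight)
  also have "\<dots> = e j * e ?k * (gF ^ a * gE ^ c)" by (simp add: mult.assoc)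
  also have "\<dots> \<doteq> (if int l dvd j - ?k then e ?k else 0) * (gF ^ a * gE ^ c)"
    by (intro eqv_mult_right e_mult_e)
  also have "\<dots> \<doteq> (if int l dvd j - ?k then bas a c k else 0)"
    using eqv_sym[OF bas_weight] by simp
  finally show ?thesis .
qed

lemma K_bas: "gK * bas a c k \<doteq> w (k + 2 * int c - 2 * int a) \<cdot> bas a c k"
proof -
  let ?k = "k + 2 * int c - 2 * int a"
  have "gK * bas a c k \<doteq> gK * (e ?k * (gF ^ a * gE ^ c))" by (intro eqv_mult_left bas_weight)
  also have "\<dots> = gK * e ?k * (gF ^ a * gE ^ c)" by (simp add: mult.assoc)
  also have "\<dots> \<doteq> w ?k \<cdot> e ?k * (gF ^ a * gE ^ c)" by (intro eqv_mult_right K_e)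
  also have "\<dots> = w ?k \<cdot> (e ?k * (gF ^ a * gE ^ c))" by simp
  also have "\<dots> \<doteq> w ?k \<cdot> bas a c k" by (intro eqv_smul eqv_sym[OF bas_weight])
  finally show ?thesis .
qed

lemma bas_K: "bas a c k * gK \<doteq> w k \<cdot> bas a c k"
proof -
  have "bas a c k * gK = gF ^ a * gE ^ c * (e k * gK)" by (simp add: bas_def mult.assoc)
  also have "\<dots> \<doteq> gF ^ a * gE ^ c * (w k \<cdot> e k)" by (intro eqv_mult_left e_K)
  finally show ?thesis by (simp add: bas_def)
qed

lemma EF_weight: "gE * gF * (e j * x) \<doteq> gF * gE * (e j * x) + (gam j - gam (j - 2)) \<cdot> (e j * x)"
proof -
  have "gE * gF * (e j * x) = gE * gF * e j * x" by (simp add: mult.assoc)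
  also have "\<dots> \<doteq> (casimir - gam (j - 2) \<cdot> 1) * e j * x" by (intro eqv_mult_right EF_e)
  also have "\<dots> = (casimir - gam j \<cdot> 1) * e j * x + (gam j - gam (j - 2)) \<cdot> (e j * x)"
    by (simp add: algebra_simps smul_diff_left)
  also have "\<dots> \<doteq> gF * gE * e j * x + (gam j - gam (j - 2)) \<cdot> (e j * x)"
    by (intro eqv_add eqv_mult_right eqv_sym[OF FE_e] eqv_refl)
  finally show ?thesis by (simp add: mult.assoc)
qed

text \<open>Each exchange of \<open>E\<close> with an \<open>F\<close> produces a scalar, because
  the rest of the monomial is a weight vector. The scalars add up to \<open>\<eta>\<close>; the
  later arguments use only that the correction has one \<open>F\<close> less.\<close>

lemma E_bas_Suc: "\<exists>\<eta>. gE * bas (Suc a) c k \<doteq> bas (Suc a) (Suc c) k + \<eta> \<cdot> bas a c k"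
proof (induction a)
  let ?\<kappa> = "\<lambda>a. gam (k + 2 * int c - 2 * int a) - gam (k + 2 * int c - 2 * int a - 2)"
  have step: "gE * bas (Suc a) c k \<doteq> gF * (gE * bas a c k) + ?\<kappa> a \<cdot> bas a c k" for a
  proof -
    let ?j = "k + 2 * int c - 2 * int a" and ?x = "gF ^ a * gE ^ c"
    have "gE * bas (Suc a) c k = gE * gF * bas a c k" by (simp add: bas_def mult.assoc)
    also have "\<dots> \<doteq> gE * gF * (e ?j * ?x)" by (intro eqv_mult_left bas_weight)
    also have "\<dots> \<doteq> gF * gE * (e ?j * ?x) + ?\<kappa> a \<cdot> (e ?j * ?x)" by (rule EF_weight)
    also have "\<dots> \<doteq> gF * gE * bas a c k + ?\<kappa> a \<cdot> bas a c k"
      by (intro eqv_intros eqv_refl eqv_sym[OF bas_weight])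
    finally show ?thesis by (simp add: mult.assoc)
  qed
  case 0
  show ?case using step[of 0] by (intro exI[of _ "?\<kappa> 0"]) (simp add: bas_def mult.assoc)
  case (Suc a)
  then obtain \<eta> where \<eta>: "gE * bas (Suc a) c k \<doteq> bas (Suc a) (Suc c) k + \<eta> \<cdot> bas a c k" by blast
  have "gE * bas (Suc (Suc a)) c k \<doteq> gF * (gE * bas (Suc a) c k) + ?\<kappa> (Suc a) \<cdot> bas (Suc a) c k"
    by (rule step)
  also have "\<dots> \<doteq> gF * (bas (Suc a) (Suc c) k + \<eta> \<cdot> bas a c k) + ?\<kappa> (Suc a) \<cdot> bas (Suc a) c k"
    by (intro eqv_add eqv_mult_left eqv_refl \<eta>)
  also have "\<dots> = bas (Suc (Suc a)) (Suc c) k + (\<eta> + ?\<kappa> (Suc a)) \<cdot> bas (Suc a) c k"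
    by (simp add: bas_def distrib_left smul_add_left mult.assoc add.assoc)
  finally show ?case by blast
qed

lemma E_bas: "\<exists>\<eta>. gE * bas a c k \<doteq> bas a (Suc c) k + \<eta> \<cdot> bas (a - 1) c k"
proof (cases a)
  case 0
  \<comment> \<open>For \<open>a = 0\<close> the truncated index \<open>a - 1\<close> is again 0,
    and the correction gets the coefficient 0.\<close>
  then show ?thesis by (intro exI[of _ 0]) (simp add: bas_def mult.assoc)
next
  case (Suc a')
  then show ?thesis using E_bas_Suc[of a' c k] by simp
qed

text \<open>The span of the monomials modulo the relations. Closure under congruence is built in, so
  that rule induction works on arbitrary representatives.\<close>

inductive_set pbw :: "free_alg set" where
  pbw_0: "0 \<in> pbw"
| pbw_bas: "a < l \<Longrightarrow> c < l \<Longrightarrow> bas a c k \<in> pbw"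
| pbw_add: "x \<in> pbw \<Longrightarrow> y \<in> pbw \<Longrightarrow> x + y \<in> pbw"
| pbw_smul: "x \<in> pbw \<Longrightarrow> r \<cdot> x \<in> pbw"
| pbw_eqv: "x \<in> pbw \<Longrightarrow> y \<doteq> x \<Longrightarrow> y \<in> pbw"

lemma bas_pbw: "bas a c k \<in> pbw"
  using bas_ge[of a c k] pbw_bas[of a c k] pbw_eqv[OF pbw_0] by (cases "a < l \<and> c < l") auto

lemma pbw_closed:
  assumes "\<And>a c k. x * bas a c k \<in> pbw" and "y \<in> pbw"
  shows "x * y \<in> pbw"
  using assms(2)
  by induction (auto intro: assms(1) pbw.intros eqv_mult_left simp: distrib_left)

lemma pbw_gen: "y \<in> pbw \<Longrightarrow> gen g * y \<in> pbw"
proof -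
  assume y: "y \<in> pbw"
  have K: "gK * x \<in> pbw" if "x \<in> pbw" for x
    by (rule pbw_closed[OF _ that]) (rule pbw_eqv[OF pbw_smul[OF bas_pbw] K_bas])
  have "gK ^ n * x \<in> pbw" if "x \<in> pbw" for n x
    by (induction n) (simp_all add: that K mult.assoc)
  then have Ki: "gKinv * x \<in> pbw" if "x \<in> pbw" for x
    using that eqv_mult_right[OF rel_Ki, of x] pbw_eqv by blast
  have F: "gF * x \<in> pbw" if "x \<in> pbw" for x
  proof (rule pbw_closed[OF _ that])
    fix a c k
    show "gF * bas a c k \<in> pbw"
      using bas_pbw[of "Suc a" c k] by (simp add: bas_def mult.assoc)
  qed
  have E: "gE * x \<in> pbw" if "x \<in> pbw" for x
  proof (rule pbw_closed[OF _ that])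
    fix a c k
    show "gE * bas a c k \<in> pbw"
    proof -
      obtain \<eta> where "gE * bas a c k \<doteq> bas a (Suc c) k + \<eta> \<cdot> bas (a - 1) c k"
        using E_bas by blast
      then show ?thesis by (rule pbw_eqv[rotated]) (intro pbw_add pbw_smul bas_pbw)
    qed
  qed
  show ?thesis by (cases g) (auto intro: K Ki E F y)
qed

text \<open>The span is stable under left multiplication by letters and contains 1, the sum of all
  \<open>bas 0 0 k\<close>.\<close>

lemma pbw_all: "x \<in> pbw"
proof (induction x rule: free_alg_induct)
  case one
  have "(\<Sum>k\<in>A. bas 0 0 k) \<in> pbw" for A
    by (induction A rule: infinite_finite_induct) (auto intro: pbw_0 pbw_add bas_pbw)
  from this[of Res] show ?case by (simp add: bas_def sum_e)
qed (auto intro: pbw_gen pbw_add pbw_smul)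

lemma pbw_induct [case_names zero bas add smul eqv]:
  assumes "Q 0" and "\<And>a c k. a < l \<Longrightarrow> c < l \<Longrightarrow> Q (bas a c k)"
    and "\<And>x y. Q x \<Longrightarrow> Q y \<Longrightarrow> Q (x + y)" and "\<And>r x. Q x \<Longrightarrow> Q (r \<cdot> x)"
    and "\<And>x y. Q x \<Longrightarrow> y \<doteq> x \<Longrightarrow> Q y"
  shows "Q x"
  using pbw_all[of x] by induction (use assms in auto)

lemma dual_eq_bas:
  assumes f: "dual f" and g: "dual g"
    and "\<And>a c k. a < l \<Longrightarrow> c < l \<Longrightarrow> f (bas a c k) = g (bas a c k)"
  shows "f x = g x"
proof (induction x rule: pbw_induct)
  case (eqv x y)
  then show ?case using dual_eqv[OF f, of y x] dual_eqv[OF g, of y x] by simp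
qed (use assms in \<open>simp_all add: lin_simps[OF dual_lin[OF f]] lin_simps[OF dual_lin[OF g]]\<close>)

section \<open>The simple modules\<close>

text \<open>The module with highest weight \<open>n\<close>, acting on sequences supported in \<open>{0..n}\<close>; the \<open>j\<close>-th unit
  vector is \<open>F\<^sup>j\<close> applied to the highest weight vector.\<close>

fun act_gen :: "nat \<Rightarrow> gen \<Rightarrow> (nat \<Rightarrow> complex) \<Rightarrow> nat \<Rightarrow> complex" where
  "act_gen n Gen_K v i = (if i \<le> n then w (int n - 2 * int i) * v i else 0)"
| "act_gen n Gen_Kinv v i = (if i \<le> n then w (- (int n - 2 * int i)) * v i else 0)"
| "act_gen n Gen_F v i = (if 0 < i \<and> i \<le> n then v (i - 1) else 0)"
| "act_gen n Gen_E v i = (if i < n then (gam (int n) - gam (int n - 2 * int (Suc i))) * v (Suc i) else 0)"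

definition act :: "nat \<Rightarrow> free_alg \<Rightarrow> (nat \<Rightarrow> complex) \<Rightarrow> nat \<Rightarrow> complex" where
  "act n x v i = (\<Sum>ws\<in>Poly_Mapping.keys x.
     Poly_Mapping.lookup x ws * foldr (act_gen n) (letters ws) v i)"

text \<open>The module is the space of sequences with this property. Outside of it the relations
  fail: every letter produces 0 at positions beyond \<open>n\<close>, so \<open>K K^-1\<close> does
  not act as the identity there.\<close>

definition supp :: "nat \<Rightarrow> (nat \<Rightarrow> complex) \<Rightarrow> bool" where
  "supp n v \<longleftrightarrow> (\<forall>i>n. v i = 0)"

definition unit :: "nat \<Rightarrow> nat \<Rightarrow> complex" where
  "unit j i = (if i = j then 1 else 0)"

lemma act_add: "act n (x + y) v i = act n x v i + act n y v i"
  unfolding act_def by (rule sum_keys_add) (simp_all add: distrib_right)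

lemma act_smul: "act n (c \<cdot> x) v i = c * act n x v i"
  unfolding act_def by (rule sum_keys_smul) (simp_all add: algebra_simps)

lemma lin_act: "lin (\<lambda>x. act n x v i)"
  by (rule linI) (simp_all add: act_add act_smul)

lemmas act_simps = lin_simps[OF lin_act]

lemma act_single: "act n (Poly_Mapping.single ws 1) v = foldr (act_gen n) (letters ws) v"
  by (rule ext) (simp add: act_def)

lemma act_1 [simp]: "act n 1 v = v"
  using act_single[of n 0 v] by (simp, simp add: zero_word_def)

lemma act_gen_lin: "act_gen n g (\<lambda>i. c * v i + d * u i) = (\<lambda>i. c * act_gen n g v i + d * act_gen n g u i)"
  by (rule ext, cases g) (simp_all add: algebra_simps)

lemma foldr_act_lin:
  "foldr (act_gen n) gs (\<lambda>i. c * v i + d * u i) = (\<lambda>i. c * foldr (act_gen n) gs v i + d * foldr (act_gen n) gs u i)"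
  by (induction gs) (simp_all add: act_gen_lin)

lemma act_lin: "act n x (\<lambda>i. c * v i + d * u i) i = c * act n x v i + d * act n x u i"
  by (simp add: act_def foldr_act_lin algebra_simps sum_distrib_left sum.distrib)

lemma act_scale: "act n x (\<lambda>i. c * v i) i = c * act n x v i"
  using act_lin[of n x c v 0 v] by simp

lemma act_vsum: "act n x (\<lambda>i. \<Sum>k\<in>A. c k * v k i) i = (\<Sum>k\<in>A. c k * act n x (v k) i)"
proof (induction A arbitrary: i rule: infinite_finite_induct)
  case (insert k A)
  have "act n x (\<lambda>i. \<Sum>k\<in>insert k A. c k * v k i) i = act n x (\<lambda>i. c k * v k i + 1 * (\<Sum>k\<in>A. c k * v k i)) i"
    using insert by simp
  also have "\<dots> = c k * act n x (v k) i + (\<Sum>k\<in>A. c k * act n x (v k) i)"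
    unfolding act_lin insert.IH by simp
  finally show ?case using insert by simp
qed (use act_scale[of n x 0 "\<lambda>i. 0"] in simp_all)

lemma act_gen_mult: "act n (gen g * x) v = act_gen n g (act n x v)"
proof (induction x rule: poly_mapping_span_induct)
  case zero
  show ?case using act_gen_lin[of n g 0 "\<lambda>i. 0" 0 "\<lambda>i. 0"] by (simp add: act_simps fun_eq_iff)
next
  case (single ws)
  have "gen g * Poly_Mapping.single ws 1 = Poly_Mapping.single (Word (g # letters ws)) 1"
    by (simp add: gen_def mult_single plus_word_def)
  then show ?case by (simp add: act_single)
next
  case (add x y)
  have "act n (x + y) v = (\<lambda>i. 1 * act n x v i + 1 * act n y v i)"
    by (simp add: fun_eq_iff act_simps)
  then show ?case
    using act_gen_lin[of n g 1 "act n x v" 1 "act n y v"]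
    by (simp add: fun_eq_iff distrib_left act_simps add)
next
  case (smul c x)
  have "act n (c \<cdot> x) v = (\<lambda>i. c * act n x v i + 0 * act n x v i)"
    by (simp add: fun_eq_iff act_simps)
  then show ?case
    using act_gen_lin[of n g c "act n x v" 0 "act n x v"]
    by (simp add: fun_eq_iff act_simps smul)
qed

lemma act_gen [simp]: "act n (gen g) v = act_gen n g v"
  using act_gen_mult[of n g 1 v] by simp

lemma act_mult: "act n (x * y) v = act n x (act n y v)"
proof (induction x rule: free_alg_induct)
  case (gen g x)
  then show ?case by (simp add: mult.assoc act_gen_mult)
qed (simp_all add: fun_eq_iff distrib_right act_simps)

lemma act_pow: "act n (x ^ m) v = (act n x ^^ m) v"
  by (induction m) (simp_all add: act_mult)

lemma act_gen_supp: "supp n v \<Longrightarrow> supp n (act_gen n g v)"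
  by (cases g) (auto simp: supp_def)

lemma act_supp: "supp n v \<Longrightarrow> supp n (act n x v)"
proof (induction x rule: free_alg_induct)
  case (gen g x)
  then show ?case by (simp add: act_gen_mult act_gen_supp)
qed (simp_all add: supp_def act_simps)

lemma unit_supp: "j \<le> n \<Longrightarrow> supp n (unit j)"
  by (auto simp: supp_def unit_def)

lemma act_expand: "supp n v \<Longrightarrow> act n x v i = (\<Sum>m\<le>n. v m * act n x (unit m) i)"
proof -
  assume "supp n v"
  then have "v = (\<lambda>i. \<Sum>m\<le>n. v m * unit m i)"
    by (auto simp: fun_eq_iff unit_def supp_def if_distrib cong: if_cong)
  then show ?thesis using act_vsum[of n x v unit "{..n}" i] by simp
qed

text \<open>The annihilator of the module is a two-sided ideal, as the module is stable, and it
  contains the relators. The bound on \<open>n\<close> is what makes \<open>E^l\<close> and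
  \<open>F^l\<close> act by 0.\<close>

lemma act_rel_ideal:
  assumes n: "n < l" and x: "x \<in> rel_ideal l q" and v: "supp n v"
  shows "act n x v i = 0"
proof -
  define J where "J = {x. \<forall>v. supp n v \<longrightarrow> act n x v = (\<lambda>i. 0)}"
  have "two_sided_ideal J"
  proof
    fix x y assume x: "x \<in> J"
    show "y * x \<in> J"
    proof -
      have "act n y (\<lambda>i. 0) = (\<lambda>i. 0)" using act_scale[of n y 0 "\<lambda>i. 0"] by (simp add: fun_eq_iff)
      then show ?thesis using x by (simp add: J_def act_mult)
    qed
    show "x * y \<in> J" using x act_supp by (simp add: J_def act_mult)
  qed (simp_all add: J_def fun_eq_iff act_simps)
  moreover have "relators l q \<subseteq> J"
  proof -
    have 1: "gK * gKinv - 1 \<in> J" "gKinv * gK - 1 \<in> J"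
    proof -
      have "w (int n - 2 * int i) * w (2 * int i - int n) = 1"
        "w (2 * int i - int n) * w (int n - 2 * int i) = 1" for i
        by (simp_all flip: w_add)
      then show "gK * gKinv - 1 \<in> J" "gKinv * gK - 1 \<in> J"
        by (auto simp: J_def act_simps act_mult fun_eq_iff supp_def simp flip: mult.assoc)
    qed
    have 2: "gK * gE * gKinv - scal (q powi 2) * gE \<in> J"
    proof -
      have "w (int n - 2 * int i) * w (- (int n - 2 * int (Suc i))) = w 2" for i
        by (simp flip: w_add)
      then show ?thesis
        unfolding smul_def[symmetric] w_def[symmetric]
        by (auto simp: J_def act_simps act_mult fun_eq_iff supp_def)
    qed
    have 3: "gK * gF * gKinv - scal (q powi (- 2)) * gF \<in> J"
    proof -
      have "w (int n - 2 * int i) * w (- (int n - 2 * int (i - 1))) = w (- 2)" if "0 < i" for i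
        using that by (simp add: of_nat_diff flip: w_add)
      then show ?thesis
        unfolding smul_def[symmetric] w_def[symmetric]
        by (auto simp: J_def act_simps act_mult fun_eq_iff supp_def)
    qed
    have 4: "gE * gF - gF * gE - scal (1 / (q - inverse q)) * (gK - gKinv) \<in> J"
      unfolding smul_def[symmetric] dq_def[symmetric]
    proof -
      have "act n (gE * gF - gF * gE - (1 / dq) \<cdot> (gK - gKinv)) v i = 0" if v: "supp n v" for v i
      proof (cases "i \<le> n")
        case True
        let ?k = "int n - 2 * int i"
        have F: "act_gen n Gen_F (act_gen n Gen_E v) i = (gam (int n) - gam ?k) * v i"
          using True by (cases i) auto
        \<comment> \<open>At the lowest weight vector \<open>E F\<close> is 0, and so must be
          \<open>gam n - gam (- n - 2)\<close>; the reflection symmetry makes one formula cover this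
          boundary case.\<close>
        have "gam (- int n - 2) = gam (int n)" by (rule gam_reflect)
        then have E: "act_gen n Gen_E (act_gen n Gen_F v) i = (gam (int n) - gam (?k - 2)) * v i"
          using True by (cases "i = n") (auto simp: algebra_simps)
        have "act n (gE * gF - gF * gE - (1 / dq) \<cdot> (gK - gKinv)) v i =
            (gam ?k - gam (?k - 2)) * v i - (w ?k - w (- ?k)) / dq * v i"
          using True by (simp add: act_simps act_mult F E del: act_gen.simps(3,4)) (simp add: algebra_simps diff_divide_distrib)
        then show ?thesis by (simp add: gam_step)
      qed (use v in \<open>simp add: act_simps act_mult\<close>)
      then show "gE * gF - gF * gE - (1 / dq) \<cdot> (gK - gKinv) \<in> J"
        by (simp add: J_def fun_eq_iff)
    qed
    have E: "(act_gen n Gen_E ^^ m) v i = 0" if "supp n v" "n < i + m" for m v i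
      using that by (induction m arbitrary: i) (auto simp: supp_def)
    have F: "(act_gen n Gen_F ^^ m) v i = 0" if "i < m" for m v i
      using that by (induction m arbitrary: i) auto
    have F': "supp n ((act_gen n Gen_F ^^ m) v)" if "supp n v" for m v
      using that by (induction m) (simp_all add: act_gen_supp)
    have 5: "gE ^ l \<in> J"
      using n by (auto simp: J_def act_pow fun_eq_iff act_gen[abs_def] E)
    have 6: "gF ^ l \<in> J"
    proof -
      have "(act_gen n Gen_F ^^ l) v i = 0" if "supp n v" for v i
        using F[of i l v] F'[OF that, of l] n by (cases "i < l") (auto simp: supp_def)
      then show ?thesis by (auto simp: J_def act_pow fun_eq_iff act_gen[abs_def])
    qed
    have K: "(act_gen n Gen_K ^^ m) v i = w (int n - 2 * int i) ^ m * v i" if "supp n v" for m v i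
      using that by (induction m) (auto simp: supp_def)
    have "w (int n - 2 * int i) ^ l = 1" for i
      unfolding w_mult(1)[symmetric] w_eq_1_iff by simp
    then have 7: "gK ^ l - 1 \<in> J"
      by (auto simp: J_def act_pow fun_eq_iff act_gen[abs_def] act_simps K)
    show ?thesis
      unfolding relators_def using 1 2 3 4 5 6 7 by simp
  qed
  ultimately have "x \<in> J" using rel_ideal_subset x by blast
  then show ?thesis using v by (simp add: J_def)
qed

lemma dual_act: "n < l \<Longrightarrow> supp n v \<Longrightarrow> dual (\<lambda>x. act n x v i)"
  by (simp add: dual_def lin_act act_rel_ideal)

section \<open>Traces, weights and the action of the Casimir element\<close>

definition tr :: "nat \<Rightarrow> free_alg \<Rightarrow> complex" where
  "tr n x = (\<Sum>j\<le>n. act n x (unit j) j)"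

lemma dual_tr: "n < l \<Longrightarrow> dual (tr n)"
  unfolding dual_def tr_def
  by (auto intro!: linI sum.neutral simp: act_simps sum.distrib sum_distrib_left act_rel_ideal unit_supp)

lemma tr_comm: "tr n (x * y) = tr n (y * x)"
proof -
  have *: "tr n (x * y) = (\<Sum>j\<le>n. \<Sum>m\<le>n. act n y (unit j) m * act n x (unit m) j)" for x y
    unfolding tr_def act_mult by (intro sum.cong refl act_expand act_supp unit_supp) simp
  show ?thesis
    unfolding * by (subst sum.swap) (simp add: mult.commute)
qed

lemma act_K_pow: "supp n v \<Longrightarrow> act n (gK ^ m) v i = w (int n - 2 * int i) ^ m * v i"
  by (induction m arbitrary: i) (auto simp: act_mult supp_def)

lemma act_e:
  assumes "supp n v"
  shows "act n (e k) v i = (if int l dvd k - (int n - 2 * int i) then v i else 0)"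
proof -
  have "act n (e k) v i = (\<Sum>j<l. w ((int n - 2 * int i - k) * int j)) / of_nat l * v i"
    by (simp add: e_def act_simps act_K_pow[OF assms] sum_distrib_left sum_distrib_right sum_divide_distrib algebra_simps
        flip: w_mult w_add)
  also have "\<dots> = (if int l dvd int n - 2 * int i - k then v i else 0)"
    by (simp add: sum_w)
  finally show ?thesis by (simp add: dvd_diff_commute)
qed

lemma act_cas:
  assumes v: "supp n v"
  shows "act n casimir v i = gam (int n) * v i"
proof (cases "i \<le> n")
  case True
  let ?k = "int n - 2 * int i"
  have F: "act_gen n Gen_F (act_gen n Gen_E v) i = (gam (int n) - gam ?k) * v i"
    using True by (cases i) auto
  have "gam ?k = (q * w ?k + inverse q * w (- ?k)) / dq\<^sup>2"
    unfolding gam_def w_add w_diff[of "- ?k"] w_1 by (simp add: divide_inverse mult.commute)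
  then have "act n casimir v i = (gam (int n) - gam ?k) * v i + gam ?k * v i"
    using True unfolding casimir_def
    by (simp add: act_simps act_mult F del: act_gen.simps(3,4)) (simp add: field_simps)
  then show ?thesis by (simp add: algebra_simps)
qed (use v in \<open>simp add: casimir_def act_simps act_mult supp_def\<close>)

lemma act_pc: "supp n v \<Longrightarrow> act n (pc f) v i = poly f (gam (int n)) * v i"
proof (induction f arbitrary: i)
  case (pCons a f)
  have "act n (pc (pCons a f)) v i = a * v i + gam (int n) * act n (pc f) v i"
    using pCons.prems by (simp add: act_simps act_mult act_cas act_supp)
  then show ?case using pCons by (simp add: algebra_simps)
qed (simp add: act_simps)

definition wt :: "nat \<Rightarrow> int \<Rightarrow> bool" where
  "wt n k \<longleftrightarrow> (\<exists>j\<le>n. int l dvd k - (int n - 2 * int j))"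

text \<open>Modulo \<open>l\<close> the weights of the module are still distinct, since 2 is
  invertible and there are at most \<open>l\<close> of them. So weight spaces have dimension at most
  1.\<close>

lemma wt_inj:
  assumes "n < l" and "i \<le> n" "j \<le> n"
    and "int l dvd k - (int n - 2 * int i)" and "int l dvd k - (int n - 2 * int j)"
  shows "i = j"
proof -
  have "int l dvd 2 * (int i - int j)"
    using dvd_diff[OF assms(4,5)] by (simp add: algebra_simps)
  then have "int l dvd int i - int j" unfolding l_dvd_double .
  then show ?thesis using l_dvd_Res[of "int i" "int j"] assms(1-3) by simp
qed

lemma wt_sum: "n < l \<Longrightarrow> (\<Sum>j\<le>n. if int l dvd k - (int n - 2 * int j) then c else 0) = (if wt n k then c else (0 :: 'a::comm_monoid_add))"
proof -
  assume n: "n < l"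
  show ?thesis
  proof (cases "wt n k")
    case True
    then obtain i where i: "i \<le> n" "int l dvd k - (int n - 2 * int i)" by (auto simp: wt_def)
    have "(\<Sum>j\<le>n. if int l dvd k - (int n - 2 * int j) then c else 0) = (\<Sum>j\<le>n. if j = i then c else 0)"
    proof (rule sum.cong)
      fix j assume "j \<in> {..n}"
      then have eq: "int l dvd k - (int n - 2 * int j) \<longleftrightarrow> j = i"
        using wt_inj[OF n _ i(1) _ i(2)] i(2) by blast
      show "(if int l dvd k - (int n - 2 * int j) then c else 0) = (if j = i then c else 0)"
        unfolding eq ..
    qed simp
    then show ?thesis using True i(1) by simp
  next
    case False
    then have "(\<Sum>j\<le>n. if int l dvd k - (int n - 2 * int j) then c else 0) = 0"
      by (intro sum.neutral) (auto simp: wt_def)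
    then show ?thesis using False by simp
  qed
qed

lemma tr_pc_e: "n < l \<Longrightarrow> tr n (pc f * e k) = (if wt n k then poly f (gam (int n)) else 0)"
proof -
  assume n: "n < l"
  have "tr n (pc f * e k) = (\<Sum>j\<le>n. poly f (gam (int n)) * (if int l dvd k - (int n - 2 * int j) then 1 else 0))"
    unfolding tr_def
  proof (rule sum.cong)
    fix j assume "j \<in> {..n}"
    then have s: "supp n (unit j)" by (simp add: unit_supp)
    show "act n (pc f * e k) (unit j) j =
        poly f (gam (int n)) * (if int l dvd k - (int n - 2 * int j) then 1 else 0)"
      unfolding act_mult act_pc[OF act_supp[OF s]] act_e[OF s] by (simp only: unit_def simp_thms if_True)
  qed simp
  also have "\<dots> = poly f (gam (int n)) * (if wt n k then 1 else 0)"
    by (simp only: sum_distrib_left[symmetric] wt_sum[OF n])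
  finally show ?thesis by simp
qed

section \<open>Matrix form and simplicity\<close>

definition rho :: "nat \<Rightarrow> free_alg set \<Rightarrow> complex mat" where
  "rho n X = mat (Suc n) (Suc n) (\<lambda>(i, j). lift (\<lambda>x. act n x (unit j) i) X)"

lemma rho_cls:
  assumes n: "n < l"
  shows "rho n (cl x) = mat (Suc n) (Suc n) (\<lambda>(i, j). act n x (unit j) i)"
proof (rule eq_matI)
  fix i j assume "i < dim_row (mat (Suc n) (Suc n) (\<lambda>(i, j). act n x (unit j) i))"
    and "j < dim_col (mat (Suc n) (Suc n) (\<lambda>(i, j). act n x (unit j) i))"
  then have ij: "i < Suc n" "j < Suc n" by simp_all
  then have "supp n (unit j)" by (intro unit_supp) simp
  then show "rho n (cl x) $$ (i, j) = mat (Suc n) (Suc n) (\<lambda>(i, j). act n x (unit j) i) $$ (i, j)"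
    using ij by (simp add: rho_def lift_cls[OF dual_act[OF n]])
qed (simp_all add: rho_def)

lemma act_gen_F_pow: "(act_gen n Gen_F ^^ m) (unit 0) = (if m \<le> n then unit m else (\<lambda>i. 0))"
proof (induction m)
  case (Suc m)
  have "act_gen n Gen_F (if m \<le> n then unit m else (\<lambda>i. 0)) i = (if Suc m \<le> n then unit (Suc m) else (\<lambda>i. 0)) i" for i
    by (cases i; cases "m \<le> n"; cases "Suc m \<le> n") (simp_all add: unit_def)
  then show ?case unfolding funpow.simps o_def Suc by (rule ext)
qed simp

text \<open>A coincidence would force \<open>l\<close> to divide \<open>j\<close> or
  \<open>n + 1 - j\<close>, both strictly between 0 and \<open>l\<close>. Consequently
  \<open>E\<close> kills no unit vector except the highest one.\<close>

lemma gam_ne: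
  assumes "n < l" and "0 < j" and "j \<le> n"
  shows "gam (int n) \<noteq> gam (int n - 2 * int j)"
proof
  assume "gam (int n) = gam (int n - 2 * int j)"
  then consider "int l dvd int n - (int n - 2 * int j)" | "int l dvd int n + (int n - 2 * int j) + 2"
    unfolding gam_eq_iff by blast
  then show False
  proof cases
    case 1
    then have "int l dvd int j"
      using l_dvd_double[of "int j"] by simp
    then show False using assms dvd_imp_le[of l j] by simp
  next
    case 2
    moreover have "int n + (int n - 2 * int j) + 2 = 2 * int (Suc n - j)"
      using assms by (simp add: of_nat_diff)
    ultimately have "int l dvd int (Suc n - j)"
      using l_dvd_double[of "int (Suc n - j)"] by simp
    then have "l dvd Suc n - j" by (simp only: of_nat_dvd_iff)
    then show False using assms dvd_imp_le[of l "Suc n - j"] by simp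
  qed
qed

text \<open>\<open>E^m\<close> carries the \<open>m\<close>-th coordinate to the highest weight
  position, with a product of nonzero differences of \<open>gam\<close> as factor.\<close>

lemma act_gen_E_pow:
  assumes "n < l"
  shows "\<exists>c\<noteq>0. \<forall>v. supp n v \<longrightarrow> (act_gen n Gen_E ^^ m) v 0 = (if m \<le> n then c * v m else 0)"
proof (induction m)
  case (Suc m)
  then obtain c where c: "c \<noteq> 0" "\<And>v. supp n v \<Longrightarrow> (act_gen n Gen_E ^^ m) v 0 = (if m \<le> n then c * v m else 0)"
    by blast
  let ?g = "gam (int n) - gam (int n - 2 * int (Suc m))"
  have "?g \<noteq> 0" if "Suc m \<le> n"
    using gam_ne[OF assms, of "Suc m"] that by (simp del: of_nat_Suc)
  \<comment> \<open>Once \<open>Suc m\<close> exceeds \<open>n\<close>, the result is 0 whatever the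
    factor; the value 1 only keeps it nonzero.\<close>
  define d where "d = (if Suc m \<le> n then c * ?g else 1)"
  have "d \<noteq> 0" using c(1) \<open>Suc m \<le> n \<Longrightarrow> ?g \<noteq> 0\<close> by (simp add: d_def)
  moreover have "(act_gen n Gen_E ^^ Suc m) v 0 = (if Suc m \<le> n then d * v (Suc m) else 0)"
    if v: "supp n v" for v
  proof -
    have "(act_gen n Gen_E ^^ Suc m) v 0 = (act_gen n Gen_E ^^ m) (act_gen n Gen_E v) 0"
      by (simp only: funpow_Suc_right o_def)
    also have "\<dots> = (if m \<le> n then c * act_gen n Gen_E v m else 0)"
      by (rule c(2)[OF act_gen_supp[OF v]])
    finally show ?thesis by (simp add: d_def)
  qed
  ultimately show ?case by blast
qed (rule exI[of _ 1], simp)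

lemma rho_mult_vec:
  "n < l \<Longrightarrow> rho n (cl x) *\<^sub>v vec (Suc n) v = vec (Suc n) (act n x (\<lambda>i. if i \<le> n then v i else 0))"
proof -
  assume n: "n < l"
  have s: "supp n (\<lambda>i. if i \<le> n then v i else 0)" by (simp add: supp_def)
  show ?thesis
  proof (rule eq_vecI)
    fix i assume "i < dim_vec (vec (Suc n) (act n x (\<lambda>i. if i \<le> n then v i else 0)))"
    then have i: "i < Suc n" by simp
    then have "(rho n (cl x) *\<^sub>v vec (Suc n) v) $ i = (\<Sum>m\<in>{0..<Suc n}. act n x (unit m) i * v m)"
      by (simp add: rho_cls n scalar_prod_def del: upt_Suc sum.op_ivl_Suc)
    also have "\<dots> = (\<Sum>m\<le>n. (if m \<le> n then v m else 0) * act n x (unit m) i)"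
      by (rule sum.cong) auto
    also have "\<dots> = act n x (\<lambda>i. if i \<le> n then v i else 0) i"
      by (rule act_expand[OF s, symmetric])
    finally show "(rho n (cl x) *\<^sub>v vec (Suc n) v) $ i = vec (Suc n) (act n x (\<lambda>i. if i \<le> n then v i else 0)) $ i"
      using i by simp
  qed (simp add: rho_cls n)
qed

lemma rho_ring_hom: "n < l \<Longrightarrow> rho n \<in> Ring.ring_hom (U l q) (ring_mat TYPE(complex) (Suc n) ())"
proof (rule ring_hom_memI)
  assume n: "n < l"
  fix X Y assume "X \<in> carrier (U l q)" "Y \<in> carrier (U l q)"
  then obtain x y where [simp]: "X = cl x" "Y = cl y" by (auto simp: U_carrier)
  show "rho n X \<in> carrier (ring_mat TYPE(complex) (Suc n) ())"
    by (simp add: rho_def ring_mat_simps)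
  show "rho n (X \<otimes>\<^bsub>U l q\<^esub> Y) = rho n X \<otimes>\<^bsub>ring_mat TYPE(complex) (Suc n) ()\<^esub> rho n Y"
  proof (rule eq_matI)
    fix i j assume "i < dim_row (rho n X \<otimes>\<^bsub>ring_mat TYPE(complex) (Suc n) ()\<^esub> rho n Y)"
      and "j < dim_col (rho n X \<otimes>\<^bsub>ring_mat TYPE(complex) (Suc n) ()\<^esub> rho n Y)"
    then have ij: "i < Suc n" "j < Suc n" by (simp_all add: ring_mat_simps rho_cls n)
    have "act n (x * y) (unit j) i = (\<Sum>m\<le>n. act n y (unit j) m * act n x (unit m) i)"
      unfolding act_mult using ij by (intro act_expand act_supp unit_supp) simp
    also have "\<dots> = (\<Sum>m\<in>{0..<Suc n}. act n x (unit m) i * act n y (unit j) m)"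
      by (rule sum.cong) auto
    finally show "rho n (X \<otimes>\<^bsub>U l q\<^esub> Y) $$ (i, j) =
        (rho n X \<otimes>\<^bsub>ring_mat TYPE(complex) (Suc n) ()\<^esub> rho n Y) $$ (i, j)"
      using ij by (simp add: ring_mat_simps cls_mult rho_cls n scalar_prod_def del: sum.op_ivl_Suc)
  qed (simp_all add: ring_mat_simps cls_mult rho_cls n)
  show "rho n (X \<oplus>\<^bsub>U l q\<^esub> Y) = rho n X \<oplus>\<^bsub>ring_mat TYPE(complex) (Suc n) ()\<^esub> rho n Y"
    by (rule eq_matI) (simp_all add: ring_mat_simps cls_add rho_cls n act_simps)
next
  assume n: "n < l"
  show "rho n \<one>\<^bsub>U l q\<^esub> = \<one>\<^bsub>ring_mat TYPE(complex) (Suc n) ()\<^esub>"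
    by (rule eq_matI) (auto simp: ring_mat_simps cls_one rho_cls n unit_def)
qed

text \<open>If \<open>m\<close> is the last nonzero coordinate of a vector in a nonzero submodule,
  then \<open>E^m\<close> maps this vector to a nonzero multiple of the highest weight vector, whose
  images under the powers of \<open>F\<close> are all the unit vectors.\<close>

lemma simple_rho:
  assumes n: "n < l"
  shows "simple_module l q (Suc n) (rho n)"
  unfolding simple_module_def
proof (intro conjI allI ballI impI)
  show "rho n \<in> Ring.ring_hom (U l q) (ring_mat TYPE(complex) (Suc n) ())"
    by (rule rho_ring_hom[OF n])
  fix c X assume "X \<in> carrier (U l q)"
  then obtain x where "X = cl x" by (auto simp: U_carrier)
  then show "rho n (U_scale l q c X) = c \<cdot>\<^sub>m rho n X"
    by (auto simp: U_scale_cls rho_cls n act_simps)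
next
  fix W
  assume W: "VectorSpace.subspace class_ring W (module_vec TYPE(complex) (Suc n)) \<and>
     (\<forall>a\<in>carrier (U l q). \<forall>w\<in>W. rho n a *\<^sub>v w \<in> W)"
  then have "submodule class_ring W (module_vec TYPE(complex) (Suc n))"
    by (simp add: VectorSpace.subspace_def)
  then interpret W: submodule class_ring W "module_vec TYPE(complex) (Suc n)" .
  have W_sub: "W \<subseteq> carrier_vec (Suc n)" using W.subset by (simp add: module_vec_simps)
  have W_0: "0\<^sub>v (Suc n) \<in> W" using W.zero_closed by (simp add: module_vec_simps)
  have W_add: "a + b \<in> W" if "a \<in> W" "b \<in> W" for a b
    using W.m_closed[OF that] by (simp add: module_vec_simps)
  have W_smult: "c \<cdot>\<^sub>v a \<in> W" if "a \<in> W" for c a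
    using W.smult_closed[of c a] that by (simp add: module_vec_simps)
  have W_act: "vec (Suc n) (act n x v) \<in> W" if "supp n v" "vec (Suc n) v \<in> W" for x v
  proof -
    have "(\<lambda>i. if i \<le> n then v i else 0) = v" using that(1) by (auto simp: supp_def fun_eq_iff)
    moreover have "rho n (cl x) *\<^sub>v vec (Suc n) v \<in> W" using W that(2) cls_mem by blast
    ultimately show ?thesis using rho_mult_vec[OF n, of x v] by simp
  qed
  show "W = {0\<^sub>v (Suc n)} \<or> W = carrier_vec (Suc n)"
  proof (cases "W \<subseteq> {0\<^sub>v (Suc n)}")
    case False
    then obtain a where a: "a \<in> W" "a \<noteq> 0\<^sub>v (Suc n)" by auto
    define v where "v i = (if i \<le> n then a $ i else 0)" for i
    have v: "supp n v" "vec (Suc n) v = a" using a W_sub by (auto simp: v_def supp_def intro!: eq_vecI)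
    have "\<exists>m. v m \<noteq> 0" using a(2) v(2) by (auto simp: zero_vec_def)
    moreover have "m \<le> n" if "v m \<noteq> 0" for m using that by (auto simp: v_def split: if_splits)
    ultimately have m: "v (Greatest (\<lambda>m. v m \<noteq> 0)) \<noteq> 0" "\<And>i. v i \<noteq> 0 \<Longrightarrow> i \<le> Greatest (\<lambda>m. v m \<noteq> 0)"
      using GreatestI_ex_nat[of "\<lambda>m. v m \<noteq> 0" n] Greatest_le_nat[of "\<lambda>m. v m \<noteq> 0" _ n] by blast+
    define m where "m = Greatest (\<lambda>m. v m \<noteq> 0)"
    have mn: "m \<le> n" using m(1) v(1) unfolding supp_def m_def by (meson not_le)
    obtain c where c: "c \<noteq> 0" "\<And>v. supp n v \<Longrightarrow> (act_gen n Gen_E ^^ m) v 0 = c * v m"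
      using act_gen_E_pow[OF n, of m] unfolding if_P[OF mn] by blast
    have z: "(act_gen n Gen_E ^^ k) v i = 0" if "m < i + k" for k i
      using that
    proof (induction k arbitrary: i)
      case 0
      then show ?case using m(2)[of i] unfolding m_def by auto
    qed auto
    have "act n (gE ^ m) v = (\<lambda>i. c * v m * unit 0 i)"
    proof
      fix i
      show "act n (gE ^ m) v i = c * v m * unit 0 i"
        using c(2)[OF v(1)] z[of i m] by (cases i) (simp_all add: act_pow act_gen[abs_def] unit_def)
    qed
    then have "vec (Suc n) (\<lambda>i. c * v m * unit 0 i) \<in> W"
      using W_act[OF v(1), of "gE ^ m"] a(1) v(2) by simp
    then have "(1 / (c * v m)) \<cdot>\<^sub>v vec (Suc n) (\<lambda>i. c * v m * unit 0 i) \<in> W" by (rule W_smult)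
    also have "(1 / (c * v m)) \<cdot>\<^sub>v vec (Suc n) (\<lambda>i. c * v m * unit 0 i) = vec (Suc n) (unit 0)"
      using c(1) m(1) by (auto simp: m_def)
    finally have u0: "vec (Suc n) (unit 0) \<in> W" .
    have u: "vec (Suc n) (unit j) \<in> W" if "j \<le> n" for j
      using W_act[OF unit_supp u0, of "gF ^ j"] that
      by (simp add: act_pow act_gen[abs_def] act_gen_F_pow)
    have "b \<in> W" if b: "b \<in> carrier_vec (Suc n)" for b
    proof -
      have "vec (Suc n) (\<lambda>i. \<Sum>j<k. b $ j * unit j i) \<in> W" if "k \<le> Suc n" for k
        using that
      proof (induction k)
        case 0
        then show ?case using W_0 by (simp add: zero_vec_def)
      next
        case (Suc k)
        have "vec (Suc n) (\<lambda>i. \<Sum>j<Suc k. b $ j * unit j i) =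
            vec (Suc n) (\<lambda>i. \<Sum>j<k. b $ j * unit j i) + b $ k \<cdot>\<^sub>v vec (Suc n) (unit k)"
          by auto
        then show ?case using Suc by (auto intro: W_add W_smult u)
      qed
      from this[of "Suc n"] show ?thesis
      proof -
        have "vec (Suc n) (\<lambda>i. \<Sum>j<Suc n. b $ j * unit j i) = b"
          using b by (intro eq_vecI) (auto simp: unit_def if_distrib simp del: sum.lessThan_Suc cong: if_cong)
        then show ?thesis using \<open>\<And>k. k \<le> Suc n \<Longrightarrow> vec (Suc n) (\<lambda>i. \<Sum>j<k. b $ j * unit j i) \<in> W\<close>[of "Suc n"]
          by simp
      qed
    qed
    then show ?thesis using W_sub by auto
  qed (use W_0 in auto)
qed simp

lemma mat_tr_sum: "A \<in> carrier_mat n n \<Longrightarrow> mat_tr A = (\<Sum>i<n. A $$ (i, i))"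
  by (simp add: mat_tr_def diag_mat_def interv_sum_list_conv_sum_set_nat atLeast0LessThan)

lemma K_trace_rho: "n < l \<Longrightarrow> K_trace l q (rho n) (cl x) = tr n (gK * x)"
  by (simp add: K_trace_def cls_mult rho_cls mat_tr_sum[of _ "Suc n"] tr_def lessThan_Suc_atMost)

text \<open>An arbitrary simple module enters the rest of the proof only through its trace, a cyclic
  functional on \<open>U\<close>.\<close>

lemma simple_module_trace:
  assumes "simple_module l q n \<rho>"
  obtains t where "dual t" and "\<And>x y. t (x * y) = t (y * x)" and "\<And>x. K_trace l q \<rho> (cl x) = t (gK * x)"
proof
  let ?t = "\<lambda>x. mat_tr (\<rho> (cl x))"
  let ?R = "ring_mat TYPE(complex) n ()"
  have hom: "\<rho> \<in> Ring.ring_hom (U l q) ?R"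
    and sc: "\<And>c x. \<rho> (cl (c \<cdot> x)) = c \<cdot>\<^sub>m \<rho> (cl x)"
    using assms by (auto simp: simple_module_def simp flip: U_scale_cls)
  have car: "\<rho> (cl x) \<in> carrier_mat n n" for x
    using ring_hom_closed[OF hom cls_mem] by (simp add: ring_mat_simps)
  have add: "\<rho> (cl (x + y)) = \<rho> (cl x) + \<rho> (cl y)" for x y
    using ring_hom_add[OF hom cls_mem cls_mem, of x y] by (simp add: ring_mat_simps cls_add)
  have mult: "\<rho> (cl (x * y)) = \<rho> (cl x) * \<rho> (cl y)" for x y
    using ring_hom_mult[OF hom cls_mem cls_mem, of x y] by (simp add: ring_mat_simps cls_mult)
  have tr: "?t x = (\<Sum>i<n. \<rho> (cl x) $$ (i, i))" for x
    by (rule mat_tr_sum[OF car])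
  have dims: "dim_row (\<rho> (cl x)) = n" "dim_col (\<rho> (cl x)) = n" for x using car[of x] by auto
  have lin: "lin ?t"
    unfolding tr by (rule linI) (simp_all add: add sc dims sum.distrib sum_distrib_left)
  moreover have "?t x = 0" if "x \<in> rel_ideal l q" for x
  proof -
    have "cl x = cl 0" using that by (simp add: cls_eq_iff eqv_0_iff)
    then show ?thesis using lin_0[OF lin] by simp
  qed
  ultimately show "dual ?t" by (simp add: dual_def)
  show "?t (x * y) = ?t (y * x)" for x y
    unfolding tr unfolding mult
    by (simp add: dims scalar_prod_def) (subst sum.swap, simp add: mult.commute atLeast0LessThan)
  show "K_trace l q \<rho> (cl x) = ?t (gK * x)" for x
    by (simp add: K_trace_def cls_mult)
qed

end

section \<open>Comultiplication and antipode\<close>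

lemma image_eq_singleton: "(\<And>t. t \<in> A \<Longrightarrow> f t = c) \<Longrightarrow> x \<in> A \<Longrightarrow> f ` A = {c}"
  by auto

text \<open>Gaussian binomial coefficients, by Pascal's rule. As a quotient of factorials the
  coefficient at \<open>n = i = l\<close> would be 0/0, because \<open>Q\<close> will be a root of
  unity.\<close>

fun qbin :: "complex \<Rightarrow> nat \<Rightarrow> nat \<Rightarrow> complex" where
  "qbin Q n 0 = 1"
| "qbin Q 0 (Suc i) = 0"
| "qbin Q (Suc n) (Suc i) = qbin Q n i + Q ^ Suc i * qbin Q n (Suc i)"

lemma qbin_gt: "n < i \<Longrightarrow> qbin Q n i = 0"
  by (induction Q n i rule: qbin.induct) auto

lemma qbin_diag: "qbin Q n n = 1"
  by (induction n) (simp_all add: qbin_gt)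

text \<open>The absorption identity, free of division. It yields both the vanishing of the inner
  coefficients at \<open>n = l\<close> and the nonvanishing of all coefficients below
  \<open>l\<close>.\<close>

lemma qbin_absorb: "qbin Q (Suc n) (Suc i) * (1 - Q ^ Suc i) = (1 - Q ^ Suc n) * qbin Q n i"
proof (induction n arbitrary: i)
  case 0
  show ?case by (cases i) simp_all
next
  case (Suc n)
  show ?case
  proof (cases i)
    case 0
    have "qbin Q (Suc (Suc n)) (Suc 0) * (1 - Q) = (1 - Q) + Q * (qbin Q (Suc n) (Suc 0) * (1 - Q))"
      by (subst qbin.simps(3)) (simp add: distrib_right mult.assoc del: qbin.simps(3))
    also have "qbin Q (Suc n) (Suc 0) * (1 - Q) = 1 - Q ^ Suc n"
      using Suc[of 0] by (simp del: qbin.simps(3))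
    also have "(1 - Q) + Q * (1 - Q ^ Suc n) = 1 - Q ^ Suc (Suc n)"
      by (simp add: algebra_simps)
    finally show ?thesis using 0 by simp
  next
    case (Suc j)
    let ?G = "qbin Q (Suc n) (Suc j)"
    have rec: "Q ^ Suc j * qbin Q n (Suc j) = ?G - qbin Q n j" by simp
    have IH: "(1 - Q ^ Suc n) * qbin Q n j = ?G * (1 - Q ^ Suc j)"
      and IH': "qbin Q (Suc n) (Suc (Suc j)) * (1 - Q ^ Suc (Suc j)) = (1 - Q ^ Suc n) * qbin Q n (Suc j)"
      by (simp_all only: Suc.IH)
    have "qbin Q (Suc (Suc n)) (Suc (Suc j)) * (1 - Q ^ Suc (Suc j)) =
        ?G * (1 - Q ^ Suc (Suc j)) + Q ^ Suc (Suc j) * (qbin Q (Suc n) (Suc (Suc j)) * (1 - Q ^ Suc (Suc j)))"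
      by (subst qbin.simps(3)) (simp only: distrib_right mult.assoc)
    also have "\<dots> = ?G * (1 - Q ^ Suc (Suc j)) + Q * (1 - Q ^ Suc n) * (Q ^ Suc j * qbin Q n (Suc j))"
      unfolding IH' by (simp del: qbin.simps)
    also have "\<dots> = ?G * (1 - Q ^ Suc (Suc j)) + Q * (1 - Q ^ Suc n) * ?G - Q * ((1 - Q ^ Suc n) * qbin Q n j)"
      unfolding rec by (simp add: right_diff_distrib del: qbin.simps)
    also have "\<dots> = (1 - Q ^ Suc (Suc n)) * ?G"
      unfolding IH by (simp add: algebra_simps del: qbin.simps)
    finally show ?thesis using Suc by simp
  qed
qed

context two_sided_ideal
begin

lemma twist_pow:
  assumes "y * x \<doteq> c \<cdot> (x * y)"
  shows "y * x ^ n \<doteq> c ^ n \<cdot> (x ^ n * y)"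
proof (induction n)
  case (Suc n)
  have "y * x ^ Suc n = (y * x) * x ^ n" by (simp add: mult.assoc)
  also have "\<dots> \<doteq> c \<cdot> (x * y) * x ^ n" by (intro eqv_mult_right assms)
  also have "\<dots> = c \<cdot> (x * (y * x ^ n))" by (simp add: mult.assoc)
  also have "\<dots> \<doteq> c \<cdot> (x * (c ^ n \<cdot> (x ^ n * y)))" by (intro eqv_smul eqv_mult_left Suc)
  finally show ?case by (simp add: mult.assoc)
qed simp

text \<open>The scalar \<open>r\<close> is left open: the lemma is applied to powers in which
  \<open>x^n\<close> or \<open>y^n\<close> is 0.\<close>

lemma twist_prod_pow:
  assumes "y * x \<doteq> c \<cdot> (x * y)"
  shows "\<exists>r. (x * y) ^ n \<doteq> r \<cdot> (x ^ n * y ^ n)"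
proof (induction n)
  case 0
  show ?case by (rule exI[of _ 1]) simp
next
  case (Suc n)
  then obtain r where r: "(x * y) ^ n \<doteq> r \<cdot> (x ^ n * y ^ n)" by blast
  have "(x * y) ^ Suc n \<doteq> x * y * (r \<cdot> (x ^ n * y ^ n))"
    unfolding power_Suc by (intro eqv_mult_left r)
  also have "\<dots> = r \<cdot> (x * (y * x ^ n) * y ^ n)" by (simp add: mult.assoc)
  also have "\<dots> \<doteq> r \<cdot> (x * (c ^ n \<cdot> (x ^ n * y)) * y ^ n)"
    by (intro eqv_smul eqv_mult_left eqv_mult_right twist_pow assms)
  finally show ?case by (intro exI[of _ "r * c ^ n"]) (simp add: mult.assoc)
qed

lemma q_binomial:
  assumes "y * x \<doteq> Q \<cdot> (x * y)"
  shows "(x + y) ^ n \<doteq> (\<Sum>i\<le>n. qbin Q n i \<cdot> (x ^ i * y ^ (n - i)))"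
proof (induction n)
  case (Suc n)
  let ?t = "\<lambda>i. x ^ i * y ^ (Suc n - i)"
  have "(x + y) ^ Suc n \<doteq> (x + y) * (\<Sum>i\<le>n. qbin Q n i \<cdot> (x ^ i * y ^ (n - i)))"
    unfolding power_Suc by (intro eqv_mult_left Suc)
  also have "\<dots> = (\<Sum>i\<le>n. qbin Q n i \<cdot> (x * x ^ i * y ^ (n - i))) +
      (\<Sum>i\<le>n. qbin Q n i \<cdot> (y * x ^ i * y ^ (n - i)))"
    by (simp add: distrib_right sum_distrib_left mult.assoc smul_add_right sum.distrib)
  also have "\<dots> \<doteq> (\<Sum>i\<le>n. qbin Q n i \<cdot> (x * x ^ i * y ^ (n - i))) +
      (\<Sum>i\<le>n. qbin Q n i \<cdot> (Q ^ i \<cdot> (x ^ i * y) * y ^ (n - i)))"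
    by (intro eqv_intros eqv_refl twist_pow assms)
  also have "\<dots> = (\<Sum>i\<le>n. qbin Q n i \<cdot> ?t (Suc i)) + (\<Sum>i\<le>n. (qbin Q n i * Q ^ i) \<cdot> ?t i)"
    by (intro arg_cong2[where f = "(+)"] sum.cong)
      (simp_all add: mult.assoc Suc_diff_le)
  also have "(\<Sum>i\<le>n. (qbin Q n i * Q ^ i) \<cdot> ?t i) = (\<Sum>i\<le>Suc n. (qbin Q n i * Q ^ i) \<cdot> ?t i)"
    by (simp add: qbin_gt)
  also have "\<dots> = ?t 0 + (\<Sum>i\<le>n. (qbin Q n (Suc i) * Q ^ Suc i) \<cdot> ?t (Suc i))"
    unfolding sum.atMost_Suc_shift by simp
  also have "(\<Sum>i\<le>n. qbin Q n i \<cdot> ?t (Suc i)) + \<dots> =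
      ?t 0 + (\<Sum>i\<le>n. qbin Q (Suc n) (Suc i) \<cdot> ?t (Suc i))"
    by (simp add: smul_add_left sum.distrib ac_simps)
  also have "\<dots> = (\<Sum>i\<le>Suc n. qbin Q (Suc n) i \<cdot> ?t i)"
    unfolding sum.atMost_Suc_shift by simp
  finally show ?case .
qed simp

end

section \<open>Functionals and congruence on the tensor square\<close>

definition tens_fun :: "(free_alg \<Rightarrow> complex) \<Rightarrow> (free_alg \<Rightarrow> complex) \<Rightarrow> free_alg2 \<Rightarrow> complex" where
  "tens_fun f g x = (\<Sum>vw\<in>Poly_Mapping.keys x. Poly_Mapping.lookup x vw *
     f (Poly_Mapping.single (fst vw) 1) * g (Poly_Mapping.single (snd vw) 1))"

lemma lin_tap: "lin (tens_fun f g)"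
proof (rule linI)
  show "tens_fun f g (x + y) = tens_fun f g x + tens_fun f g y" for x y
    unfolding tens_fun_def by (rule sum_keys_add) (simp_all add: distrib_right)
  show "tens_fun f g (c \<cdot> x) = c * tens_fun f g x" for c x
    unfolding tens_fun_def by (rule sum_keys_smul) (simp_all add: algebra_simps)
qed

lemmas tens_fun_simps = lin_simps[OF lin_tap]

lemma tens_fun_tens:
  assumes "lin f" "lin g"
  shows "tens_fun f g (tens a b) = f a * g b"
proof (induction a rule: poly_mapping_span_induct)
  case (single v)
  show ?case
  proof (induction b rule: poly_mapping_span_induct)
    case (single w)
    show ?case by (simp add: tens_single) (simp add: tens_fun_def)
  qed (simp_all add: tens_add_right tens_smul_right tens_fun_simps lin_simps[OF assms(2)] algebra_simps)
qed (simp_all add: tens_add_left tens_smul_left tens_fun_simps lin_simps[OF assms(1)] algebra_simps)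

lemma tens_apply_tap: "tens_apply l q p r = tens_fun (\<lambda>x. p (cls l q x)) (\<lambda>x. r (cls l q x))"
  by (rule ext) (simp add: tens_apply_def tens_fun_def case_prod_beta)

context quantum_sl2
begin

text \<open>The kernel of the map onto \<open>U \<otimes> U\<close>, described through the
  functionals \<open>f \<otimes> g\<close>, which separate the points of
  \<open>U \<otimes> U\<close>. This makes evaluating \<open>f \<otimes> g\<close> on a congruence
  immediate.\<close>

definition null2 :: "free_alg2 set" where
  "null2 = {x. \<forall>f g. dual f \<longrightarrow> dual g \<longrightarrow> tens_fun f g x = 0}"

lemma tens_fun_mult:
  assumes "dual f" "dual g"
  shows "tens_fun f g (tens a b * x * tens c d) = tens_fun (\<lambda>y. f (a * y * c)) (\<lambda>y. g (b * y * d)) x"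
proof (induction x rule: tens_span_induct)
  case (tens u v)
  show ?case
    using assms by (simp add: tens_mult tens_fun_tens dual_lin lin_mult_both)
qed (simp_all add: distrib_left distrib_right tens_fun_simps)

sublocale T: two_sided_ideal null2
proof
  fix x y assume x: "x \<in> null2"
  have *: "tens a b * x * tens c d \<in> null2" for a b c d
    using x by (simp add: null2_def tens_fun_mult dual_mult)
  show "y * x \<in> null2"
  proof (induction y rule: tens_span_induct)
    case (tens a b)
    show ?case using *[of a b 1 1] by (simp add: tens_1)
  qed (simp_all add: null2_def tens_fun_simps distrib_right)
  show "x * y \<in> null2"
  proof (induction y rule: tens_span_induct)
    case (tens a b)
    show ?case using *[of 1 1 a b] by (simp add: tens_1)
  qed (simp_all add: null2_def tens_fun_simps distrib_left)
qed (simp_all add: null2_def tens_fun_simps)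

notation T.eqv (infix \<open>\<simeq>\<close> 50)

lemma tens_eqv:
  assumes "a \<doteq> a'" "b \<doteq> b'"
  shows "tens a b \<simeq> tens a' b'"
proof -
  have "tens_fun f g (tens a b) = tens_fun f g (tens a' b')" if f: "dual f" and g: "dual g" for f g
    using dual_eqv[OF f assms(1)] dual_eqv[OF g assms(2)] f g by (simp add: tens_fun_tens dual_lin)
  then show ?thesis unfolding T.eqv_def by (simp add: null2_def tens_fun_simps)
qed

lemma tens_fun_eqv: "x \<simeq> y \<Longrightarrow> dual f \<Longrightarrow> dual g \<Longrightarrow> tens_fun f g x = tens_fun f g y"
  using T.eqv_def[of x y] by (simp add: null2_def tens_fun_simps)

end

section \<open>The comultiplication and the antipode respect the relations\<close>

lemma Delta_gen:
  "Delta gE = tens gE 1 + tens gK gE" "Delta gF = tens gF gKinv + tens 1 gF"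
  "Delta gK = tens gK gK" "Delta gKinv = tens gKinv gKinv"
  by (simp_all add: Delta_def alg_ext_gen)

lemmas Delta_simps = alg_ext_simps(1-5)[of "\<lambda>g. case g of
       Gen_E \<Rightarrow> tens gE 1 + tens gK gE
     | Gen_F \<Rightarrow> tens gF gKinv + tens 1 gF
     | Gen_K \<Rightarrow> tens gK gK
     | Gen_Kinv \<Rightarrow> tens gKinv gKinv", folded Delta_def]
  alg_ext_simps(7-10)[of "\<lambda>g. case g of
       Gen_E \<Rightarrow> tens gE 1 + tens gK gE
     | Gen_F \<Rightarrow> tens gF gKinv + tens 1 gF
     | Gen_K \<Rightarrow> tens gK gK
     | Gen_Kinv \<Rightarrow> tens gKinv gKinv", folded Delta_def] Delta_gen

definition antip :: "free_alg \<Rightarrow> free_alg" where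
  "antip = antialg_ext (\<lambda>g. case g of
       Gen_E \<Rightarrow> - (gKinv * gE)
     | Gen_F \<Rightarrow> - (gF * gK)
     | Gen_K \<Rightarrow> gKinv
     | Gen_Kinv \<Rightarrow> gK)"

lemma antip_gen: "antip gE = - (gKinv * gE)" "antip gF = - (gF * gK)" "antip gK = gKinv" "antip gKinv = gK"
  by (simp_all add: antip_def antialg_ext_gen)

lemmas antip_simps = antialg_ext_simps(1-5)[of "\<lambda>g. case g of
       Gen_E \<Rightarrow> - (gKinv * gE)
     | Gen_F \<Rightarrow> - (gF * gK)
     | Gen_K \<Rightarrow> gKinv
     | Gen_Kinv \<Rightarrow> gK", folded antip_def]
  antialg_ext_simps(7-10)[of "\<lambda>g. case g of
       Gen_E \<Rightarrow> - (gKinv * gE)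
     | Gen_F \<Rightarrow> - (gF * gK)
     | Gen_K \<Rightarrow> gKinv
     | Gen_Kinv \<Rightarrow> gK", folded antip_def] antip_gen

context small_quantum_group
begin

lemma Ki_twist:
  assumes "gK * x \<doteq> c \<cdot> (x * gK)"
  shows "x * gKinv \<doteq> c \<cdot> (gKinv * x)"
proof -
  have "x * gKinv \<doteq> gKinv * gK * (x * gKinv)"
    using eqv_mult_right[OF eqv_sym[OF rel_KiK], of "x * gKinv"] by simp
  also have "\<dots> = gKinv * (gK * x) * gKinv" by (simp add: mult.assoc)
  also have "\<dots> \<doteq> gKinv * (c \<cdot> (x * gK)) * gKinv" by (intro eqv_mult_left eqv_mult_right assms)
  also have "\<dots> = c \<cdot> (gKinv * x * (gK * gKinv))" by (simp add: mult.assoc)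
  also have "\<dots> \<doteq> c \<cdot> (gKinv * x * 1)" by (intro eqv_smul eqv_mult_left rel_KKi)
  finally show ?thesis by simp
qed

lemma E_Ki: "gE * gKinv \<doteq> w 2 \<cdot> (gKinv * gE)" and F_Ki: "gF * gKinv \<doteq> w (- 2) \<cdot> (gKinv * gF)"
  by (rule Ki_twist[OF rel_KE], rule Ki_twist[OF rel_KF])

lemma Ki_F: "gKinv * gF \<doteq> w 2 \<cdot> (gF * gKinv)"
  using eqv_smul[OF eqv_sym[OF F_Ki], of "w 2"] by (simp flip: w_add)

lemma Ki_EF_K: "gKinv * gE * (gF * gK) \<doteq> gE * gF"
proof -
  have "gKinv * gE * (gF * gK) \<doteq> gKinv * gE * (w 2 \<cdot> (gK * gF))"
    using eqv_smul[OF eqv_sym[OF rel_KF], of "w 2"] by (intro eqv_mult_left) (simp flip: w_add)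
  also have "\<dots> = w 2 \<cdot> (gKinv * (gE * gK) * gF)" by (simp add: mult.assoc)
  also have "\<dots> \<doteq> w 2 \<cdot> (gKinv * (w (- 2) \<cdot> (gK * gE)) * gF)"
    using eqv_smul[OF eqv_sym[OF rel_KE], of "w (- 2)"]
    by (intro eqv_smul eqv_mult_left eqv_mult_right) (simp flip: w_add)
  also have "\<dots> = gKinv * gK * (gE * gF)" by (simp add: mult.assoc)
  also have "\<dots> \<doteq> 1 * (gE * gF)" by (intro eqv_mult_right rel_KiK)
  finally show ?thesis by simp
qed

lemma w_2_pow_ne: "0 < i \<Longrightarrow> i < l \<Longrightarrow> w 2 ^ i \<noteq> 1"
proof -
  assume i: "0 < i" "i < l"
  have "w 2 ^ i = w (2 * int i)" by (simp add: w_mult mult.commute)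
  moreover have "\<not> int l dvd int i" using i dvd_imp_le[of l i] by auto
  ultimately show ?thesis by (simp only: w_eq_1_iff l_dvd_double not_False_eq_True)
qed

lemma w_2_pow_l: "w 2 ^ l = 1"
  unfolding w_mult(1)[symmetric] w_eq_1_iff by simp

text \<open>In the absorption identity \<open>1 - Q^l\<close> is 0, while \<open>1 - Q^i\<close> is
  not. Hence only the two outer terms remain in \<open>Delta (E^l)\<close> and
  \<open>Delta (F^l)\<close>.\<close>

lemma qbin_l:
  assumes "0 < i" "i < l"
  shows "qbin (w 2) l i = 0"
proof -
  obtain i' l' where [simp]: "i = Suc i'" "l = Suc l'" using assms by (cases i; cases l) auto
  have "qbin (w 2) l i * (1 - w 2 ^ i) = 0"
    using qbin_absorb[of "w 2" l' i'] w_2_pow_l by simp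
  then show ?thesis using w_2_pow_ne[OF assms] by simp
qed

lemma qbin_nz: "i \<le> n \<Longrightarrow> n < l \<Longrightarrow> qbin (w 2) n i \<noteq> 0"
proof (induction i arbitrary: n)
  case (Suc i)
  then obtain n' where [simp]: "n = Suc n'" by (cases n) auto
  have "(1 - w 2 ^ Suc n') * qbin (w 2) n' i \<noteq> 0"
    using Suc.IH[of n'] Suc.prems w_2_pow_ne[of "Suc n'"] by simp
  then show ?case using qbin_absorb[of "w 2" n' i] by auto
qed simp

lemma Delta_E_pow: "Delta (gE ^ c) \<simeq> (\<Sum>j\<le>c. qbin (w 2) c j \<cdot> tens (gE ^ j * gK ^ (c - j)) (gE ^ (c - j)))"
proof -
  have "tens gK gE * tens gE 1 = tens (gK * gE) gE" by (simp add: tens_mult)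
  also have "\<dots> \<simeq> tens (w 2 \<cdot> (gE * gK)) gE" by (intro tens_eqv rel_KE eqv_refl)
  also have "\<dots> = w 2 \<cdot> (tens gE 1 * tens gK gE)" by (simp add: tens_mult tens_smul_left)
  finally show ?thesis
    using T.q_binomial[of "tens gK gE" "tens gE 1" "w 2" c]
    by (simp add: Delta_simps tens_power tens_mult)
qed

lemma Delta_F_pow: "Delta (gF ^ a) \<simeq> (\<Sum>i\<le>a. qbin (w 2) a i \<cdot> tens (gF ^ (a - i)) (gF ^ i * gKinv ^ (a - i)))"
proof -
  have "tens gF gKinv * tens 1 gF = tens gF (gKinv * gF)" by (simp add: tens_mult)
  also have "\<dots> \<simeq> tens gF (w 2 \<cdot> (gF * gKinv))" by (intro tens_eqv Ki_F eqv_refl)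
  also have "\<dots> = w 2 \<cdot> (tens 1 gF * tens gF gKinv)" by (simp add: tens_mult tens_smul_right)
  finally show ?thesis
    using T.q_binomial[of "tens gF gKinv" "tens 1 gF" "w 2" a]
    by (simp add: Delta_simps tens_power tens_mult add.commute)
qed

lemma sum_ends:
  fixes n :: nat
  assumes "0 < n" and "\<And>i. 0 < i \<Longrightarrow> i < n \<Longrightarrow> f i = 0"
  shows "(\<Sum>i\<le>n. f i) = f 0 + (f n :: 'b::comm_monoid_add)"
proof -
  have "(\<Sum>i\<le>n. f i) = (\<Sum>i\<in>{0, n}. f i)"
    by (rule sum.mono_neutral_right) (use assms in auto)
  then show ?thesis using assms(1) by simp
qed

lemma antip_diff_0: "antip x \<doteq> antip y \<Longrightarrow> antip (x - y) \<doteq> 0"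
  unfolding eqv_iff_diff[of "antip x"] by (simp add: antip_simps)

lemma Delta_diff_0: "Delta x \<simeq> Delta y \<Longrightarrow> Delta (x - y) \<simeq> 0"
  unfolding T.eqv_iff_diff[of "Delta x"] by (simp add: Delta_simps)

lemma Delta_rel_ideal: "x \<in> rel_ideal l q \<Longrightarrow> Delta x \<in> null2"
proof -
  have "two_sided_ideal {x. Delta x \<in> null2}"
    by standard (auto simp: Delta_simps T.zero_mem T.add_mem T.mult_left_mem T.mult_right_mem)
  moreover have "relators l q \<subseteq> {x. Delta x \<in> null2}"
  proof -
    have 1: "Delta (gK * gKinv - 1) \<simeq> 0" "Delta (gKinv * gK - 1) \<simeq> 0"
      using tens_eqv[OF rel_KKi rel_KKi] tens_eqv[OF rel_KiK rel_KiK]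
      by (simp_all add: Delta_simps tens_mult tens_1 T.eqv_def T.zero_mem)
    have 2: "Delta (gK * gE * gKinv - w 2 \<cdot> gE) \<simeq> 0"
    proof -
      have "Delta (gK * gE * gKinv) = tens (gK * gE * gKinv) (gK * gKinv) + tens (gK * (gK * gKinv)) (gK * gE * gKinv)"
        by (simp add: Delta_simps tens_mult distrib_left distrib_right mult.assoc)
      also have "\<dots> \<simeq> tens (w 2 \<cdot> gE) 1 + tens (gK * 1) (w 2 \<cdot> gE)"
        by (intro T.eqv_add tens_eqv rel_KEKi rel_KKi eqv_mult_left)
      also have "\<dots> = Delta (w 2 \<cdot> gE)"
        by (simp add: Delta_simps tens_smul_left tens_smul_right smul_add_right)
      finally show ?thesis by (rule Delta_diff_0)
    qed
    have 3: "Delta (gK * gF * gKinv - w (- 2) \<cdot> gF) \<simeq> 0"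
    proof -
      have "Delta (gK * gF * gKinv) = tens (gK * gF * gKinv) (gK * gKinv * gKinv) + tens (gK * gKinv) (gK * gF * gKinv)"
        by (simp add: Delta_simps tens_mult distrib_left distrib_right mult.assoc)
      also have "\<dots> \<simeq> tens (w (- 2) \<cdot> gF) (1 * gKinv) + tens 1 (w (- 2) \<cdot> gF)"
        by (intro T.eqv_add tens_eqv rel_KFKi rel_KKi eqv_mult_right)
      also have "\<dots> = Delta (w (- 2) \<cdot> gF)"
        by (simp add: Delta_simps tens_smul_left tens_smul_right smul_add_right)
      finally show ?thesis by (rule Delta_diff_0)
    qed
    have 4: "Delta (gE * gF - gF * gE - (1 / dq) \<cdot> (gK - gKinv)) \<simeq> 0"
    proof -
      \<comment> \<open>The mixed terms of the commutator of \<open>Delta E\<close> and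
        \<open>Delta F\<close> cancel, since the factors \<open>w (- 2)\<close> and
        \<open>w 2\<close> from the two tensor legs compensate.\<close>
      have "tens (gK * gF) (gE * gKinv) \<simeq> tens (w (- 2) \<cdot> (gF * gK)) (w 2 \<cdot> (gKinv * gE))"
        by (intro tens_eqv rel_KF E_Ki)
      also have "\<dots> = tens (gF * gK) (gKinv * gE)"
        by (simp add: tens_smul_left tens_smul_right)
      finally have KF: "tens (gK * gF) (gE * gKinv) \<simeq> tens (gF * gK) (gKinv * gE)" .
      have "Delta (gE * gF - gF * gE) = tens (gE * gF - gF * gE) gKinv + tens gK (gE * gF - gF * gE)
          + (tens (gK * gF) (gE * gKinv) - tens (gF * gK) (gKinv * gE))"
        by (simp add: Delta_simps tens_mult distrib_left distrib_right tens_diff_left tens_diff_right)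
      also have "\<dots> \<simeq> tens ((1 / dq) \<cdot> (gK - gKinv)) gKinv + tens gK ((1 / dq) \<cdot> (gK - gKinv))
          + (tens (gF * gK) (gKinv * gE) - tens (gF * gK) (gKinv * gE))"
        by (intro T.eqv_add T.eqv_diff KF T.eqv_refl tens_eqv rel_EF eqv_refl)
      also have "\<dots> = Delta ((1 / dq) \<cdot> (gK - gKinv))"
        by (simp add: Delta_simps tens_smul_left tens_smul_right tens_diff_left tens_diff_right smul_diff_right)
      finally show ?thesis by (rule Delta_diff_0)
    qed
    have 5: "Delta (gE ^ l) \<simeq> 0"
    proof -
      have "Delta (gE ^ l) \<simeq> (\<Sum>j\<le>l. qbin (w 2) l j \<cdot> tens (gE ^ j * gK ^ (l - j)) (gE ^ (l - j)))"
        by (rule Delta_E_pow)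
      also have "\<dots> = tens (gK ^ l) (gE ^ l) + tens (gE ^ l) 1"
        by (subst sum_ends) (simp_all add: qbin_l qbin_diag)
      also have "\<dots> \<simeq> tens (gK ^ l) 0 + tens 0 1"
        by (intro T.eqv_add tens_eqv rel_El eqv_refl)
      finally show ?thesis by simp
    qed
    have 6: "Delta (gF ^ l) \<simeq> 0"
    proof -
      have "Delta (gF ^ l) \<simeq> (\<Sum>j\<le>l. qbin (w 2) l j \<cdot> tens (gF ^ (l - j)) (gF ^ j * gKinv ^ (l - j)))"
        by (rule Delta_F_pow)
      also have "\<dots> = tens (gF ^ l) (gKinv ^ l) + tens 1 (gF ^ l)"
        by (subst sum_ends) (simp_all add: qbin_l qbin_diag)
      also have "\<dots> \<simeq> tens 0 (gKinv ^ l) + tens 1 0"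
        by (intro T.eqv_add tens_eqv rel_Fl eqv_refl)
      finally show ?thesis by simp
    qed
    have 7: "Delta (gK ^ l - 1) \<simeq> 0"
      using tens_eqv[OF rel_Kl rel_Kl]
      by (simp add: Delta_simps tens_power tens_1 T.eqv_def)
    show ?thesis
      unfolding relators_def smul_def[symmetric] w_def[symmetric] dq_def[symmetric]
      using 1 2 3 4 5 6 7 by (simp add: T.eqv_0_iff)
  qed
  moreover assume "x \<in> rel_ideal l q"
  ultimately show ?thesis using rel_ideal_subset by blast
qed

lemma Delta_eqv: "x \<doteq> y \<Longrightarrow> Delta x \<simeq> Delta y"
  using Delta_rel_ideal[of "x - y"] by (simp add: eqv_def T.eqv_def Delta_simps)

lemma conv_cls:
  assumes p: "p \<in> U_dual l q" and r: "r \<in> U_dual l q"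
  shows "conv l q p r (cl x) = tens_fun (\<lambda>x. p (cl x)) (\<lambda>x. r (cl x)) (Delta x)"
proof -
  have "tens_apply l q p r (Delta t) = tens_fun (\<lambda>x. p (cl x)) (\<lambda>x. r (cl x)) (Delta x)" if "t \<in> cl x" for t
    unfolding tens_apply_tap
    using that by (intro tens_fun_eqv Delta_eqv U_dual_dual p r) (simp add: cls_eq)
  moreover have "x \<in> cl x" by (simp add: cls_eq)
  ultimately have "(\<lambda>t. tens_apply l q p r (Delta t)) ` cl x = {tens_fun (\<lambda>x. p (cl x)) (\<lambda>x. r (cl x)) (Delta x)}"
    by (rule image_eq_singleton)
  then show ?thesis by (simp add: conv_def)
qed

lemma antip_rel_ideal: "x \<in> rel_ideal l q \<Longrightarrow> antip x \<doteq> 0"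
proof -
  have "two_sided_ideal {x. antip x \<doteq> 0}"
    unfolding eqv_0_iff
    by standard (auto simp: antip_simps zero_mem add_mem mult_left_mem mult_right_mem)
  moreover have "relators l q \<subseteq> {x. antip x \<doteq> 0}"
  proof -
    have 1: "antip (gK * gKinv - 1) \<doteq> 0" "antip (gKinv * gK - 1) \<doteq> 0"
      using rel_KKi rel_KiK by (simp_all add: antip_simps eqv_iff_diff[symmetric])
    have 2: "antip (gK * gE * gKinv - w 2 \<cdot> gE) \<doteq> 0"
    proof -
      have "antip (gK * gE * gKinv) = - (gK * gKinv * (gE * gKinv))"
        by (simp only: antip_simps mult.assoc mult_minus_left mult_minus_right)
      also have "\<dots> \<doteq> - (1 * (w 2 \<cdot> (gKinv * gE)))" by (intro eqv_minus eqv_mult rel_KKi E_Ki)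
      also have "\<dots> = antip (w 2 \<cdot> gE)" by (simp add: antip_simps)
      finally show ?thesis by (rule antip_diff_0)
    qed
    have 3: "antip (gK * gF * gKinv - w (- 2) \<cdot> gF) \<doteq> 0"
    proof -
      have "antip (gK * gF * gKinv) = - (gK * gF * (gK * gKinv))"
        by (simp only: antip_simps mult.assoc mult_minus_left mult_minus_right)
      also have "\<dots> \<doteq> - (w (- 2) \<cdot> (gF * gK) * 1)" by (intro eqv_minus eqv_mult rel_KKi rel_KF)
      also have "\<dots> = antip (w (- 2) \<cdot> gF)" by (simp add: antip_simps)
      finally show ?thesis by (rule antip_diff_0)
    qed
    have 4: "antip (gE * gF - gF * gE - (1 / dq) \<cdot> (gK - gKinv)) \<doteq> 0"
    proof -
      have "antip (gE * gF - gF * gE) = gF * (gK * gKinv) * gE - gKinv * gE * gF * gK"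
        by (simp add: antip_simps mult.assoc)
      also have "\<dots> \<doteq> gF * 1 * gE - gE * gF"
      proof (intro eqv_diff eqv_mult_left eqv_mult_right rel_KKi)
        show "gKinv * gE * gF * gK \<doteq> gE * gF" using Ki_EF_K by (simp add: mult.assoc)
      qed
      also have "\<dots> = - (gE * gF - gF * gE)" by simp
      also have "\<dots> \<doteq> - ((1 / dq) \<cdot> (gK - gKinv))" by (intro eqv_minus rel_EF)
      also have "\<dots> = antip ((1 / dq) \<cdot> (gK - gKinv))"
        by (simp add: antip_simps smul_diff_right)
      finally show ?thesis by (rule antip_diff_0)
    qed
    have 5: "antip (gE ^ l) \<doteq> 0"
    proof -
      obtain r where r: "(gKinv * gE) ^ l \<doteq> r \<cdot> (gKinv ^ l * gE ^ l)"
        using twist_prod_pow[OF E_Ki] by blast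
      have "antip (gE ^ l) = (- 1) ^ l \<cdot> (gKinv * gE) ^ l"
        using smul_power[of "- 1" "gKinv * gE" l] by (simp add: antip_simps)
      also have "\<dots> \<doteq> (- 1) ^ l \<cdot> r \<cdot> (gKinv ^ l * gE ^ l)" by (intro eqv_smul r)
      also have "\<dots> \<doteq> (- 1) ^ l \<cdot> r \<cdot> (gKinv ^ l * 0)" by (intro eqv_smul eqv_mult_left rel_El)
      finally show ?thesis by simp
    qed
    have 6: "antip (gF ^ l) \<doteq> 0"
    proof -
      obtain r where r: "(gF * gK) ^ l \<doteq> r \<cdot> (gF ^ l * gK ^ l)"
        using twist_prod_pow[OF rel_KF] by blast
      have "antip (gF ^ l) = (- 1) ^ l \<cdot> (gF * gK) ^ l"
        using smul_power[of "- 1" "gF * gK" l] by (simp add: antip_simps)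
      also have "\<dots> \<doteq> (- 1) ^ l \<cdot> r \<cdot> (gF ^ l * gK ^ l)" by (intro eqv_smul r)
      also have "\<dots> \<doteq> (- 1) ^ l \<cdot> r \<cdot> (0 * gK ^ l)" by (intro eqv_smul eqv_mult_right rel_Fl)
      finally show ?thesis by simp
    qed
    have 7: "antip (gK ^ l - 1) \<doteq> 0"
    proof -
      have "gKinv ^ l \<doteq> 1"
      proof -
        have "gKinv ^ l \<doteq> (gK ^ (l - 1)) ^ l" by (intro eqv_power rel_Ki)
        also have "\<dots> = (gK ^ l) ^ (l - 1)" by (simp add: mult.commute flip: power_mult)
        also have "\<dots> \<doteq> 1 ^ (l - 1)" by (intro eqv_power rel_Kl)
        finally show ?thesis by simp
      qed
      then show ?thesis by (simp add: antip_simps eqv_iff_diff[symmetric])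
    qed
    show ?thesis
      unfolding relators_def smul_def[symmetric] w_def[symmetric] dq_def[symmetric]
      using 1 2 3 4 5 6 7 by simp
  qed
  moreover assume "x \<in> rel_ideal l q"
  ultimately show ?thesis using rel_ideal_subset by blast
qed

lemma antip_eqv: "x \<doteq> y \<Longrightarrow> antip x \<doteq> antip y"
  using antip_rel_ideal[of "x - y"] by (simp add: eqv_def[of x y] antip_simps eqv_iff_diff[symmetric])

lemma U_antipode_cls: "U_antipode l q (cl x) = cl (antip x)"
proof -
  have "cl (antip t) = cl (antip x)" if "t \<in> cl x" for t
    unfolding cls_eq_iff using that by (intro antip_eqv) (simp add: cls_eq)
  moreover have "x \<in> cl x" by (simp add: cls_eq)
  ultimately have "(\<lambda>t. cl (antip t)) ` cl x = {cl (antip x)}"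
    by (rule image_eq_singleton)
  then show ?thesis by (simp add: U_antipode_def antip_def)
qed

text \<open>Both sides are multiplicative, so letters suffice. Since the square of the antipode is
  inner, centrality of \<open>antip a\<close> can be carried over to \<open>a\<close>.\<close>

lemma antip_anti: "antip (antip x) \<doteq> gKinv * x * gK"
proof (induction x rule: free_alg_induct)
  case one
  show ?case using eqv_sym[OF rel_KiK] by (simp add: antip_simps)
next
  case (gen g x)
  have g: "antip (antip (gen g)) \<doteq> gKinv * gen g * gK"
  proof (cases g)
    case Gen_K
    have "gK = 1 * gK" by simp
    also have "\<dots> \<doteq> gKinv * gK * gK" by (intro eqv_mult_right eqv_sym[OF rel_KiK])
    finally show ?thesis using Gen_K by (simp add: antip_simps)
  next
    case Gen_Kinv
    have "gKinv = gKinv * 1" by simp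
    also have "\<dots> \<doteq> gKinv * (gKinv * gK)" by (intro eqv_mult_left eqv_sym[OF rel_KiK])
    finally show ?thesis using Gen_Kinv by (simp add: antip_simps mult.assoc)
  qed (simp_all add: antip_simps mult.assoc)
  have "antip (antip (gen g * x)) = antip (antip (gen g)) * antip (antip x)" by (simp add: antip_simps)
  also have "\<dots> \<doteq> gKinv * gen g * gK * (gKinv * x * gK)" by (intro eqv_mult g gen)
  also have "\<dots> = gKinv * gen g * (gK * gKinv) * (x * gK)" by (simp add: mult.assoc)
  also have "\<dots> \<doteq> gKinv * gen g * 1 * (x * gK)" by (intro eqv_mult_left eqv_mult_right rel_KKi)
  finally show ?case by (simp add: mult.assoc)
qed (simp_all add: antip_simps distrib_left distrib_right eqv_add eqv_smul)

lemma antip_e: "antip (e k) \<doteq> e (- k)"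
proof (rule eqv_by_e)
  fix j
  have Kin: "gKinv ^ i * e j \<doteq> w (- j * int i) \<cdot> e j" for i
  proof (induction i)
    case (Suc i)
    have "gKinv ^ Suc i * e j = gKinv * (gKinv ^ i * e j)" by (simp add: mult.assoc)
    also have "\<dots> \<doteq> gKinv * (w (- j * int i) \<cdot> e j)" by (intro eqv_mult_left Suc)
    also have "\<dots> = w (- j * int i) \<cdot> (gKinv * e j)" by simp
    also have "\<dots> \<doteq> w (- j * int i) \<cdot> w (- j) \<cdot> e j" by (intro eqv_smul Ki_e)
    also have "\<dots> = w (- j * int (Suc i)) \<cdot> e j" by (simp add: algebra_simps flip: w_add)
    finally show ?case .
  qed simp
  have "antip (e k) * e j = (\<Sum>i<l. (w (- k * int i) / of_nat l) \<cdot> (gKinv ^ i * e j))"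
    by (simp add: e_def[of k] antip_simps sum_distrib_right)
  also have "\<dots> \<doteq> (\<Sum>i<l. (w (- k * int i) / of_nat l) \<cdot> w (- j * int i) \<cdot> e j)"
    by (intro eqv_sum eqv_smul Kin)
  also have "\<dots> = ((\<Sum>i<l. w ((- k - j) * int i)) / of_nat l) \<cdot> e j"
  proof -
    have "(- k - j) * int i = - k * int i + - j * int i" for i by (simp add: algebra_simps)
    then show ?thesis by (simp only: w_add smul_sum_left sum_divide_distrib smul_smul times_divide_eq_left)
  qed
  also have "\<dots> = (if int l dvd - k - j then e j else 0)" unfolding sum_w by simp
  also have "\<dots> \<doteq> e (- k) * e j" by (rule eqv_sym[OF e_mult_e])
  finally show "antip (e k) * e j \<doteq> e (- k) * e j" .
qed

text \<open>The antipode turns \<open>F E\<close> into \<open>E F\<close> and exchanges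
  \<open>K\<close> with its inverse; the commutator of \<open>E\<close> and \<open>F\<close> exactly
  makes up for the exchange of the coefficients \<open>q\<close> and \<open>1/q\<close>.\<close>

lemma antip_cas: "antip casimir \<doteq> casimir"
proof -
  have "antip casimir = gKinv * gE * (gF * gK) + (1 / dq\<^sup>2) \<cdot> (q \<cdot> gKinv + inverse q \<cdot> gK)"
    by (simp add: casimir_def antip_simps)
  also have "\<dots> \<doteq> gF * gE + (1 / dq) \<cdot> (gK - gKinv) + (1 / dq\<^sup>2) \<cdot> (q \<cdot> gKinv + inverse q \<cdot> gK)"
    by (intro eqv_add eqv_refl eqv_trans[OF Ki_EF_K EF_FE])
  also have "\<dots> = gF * gE + ((1 / dq + 1 / dq\<^sup>2 * inverse q) \<cdot> gK + (1 / dq\<^sup>2 * q - 1 / dq) \<cdot> gKinv)"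
    by (simp add: smul_add_left smul_add_right smul_diff_left smul_diff_right)
  also have "1 / dq + 1 / dq\<^sup>2 * inverse q = 1 / dq\<^sup>2 * q"
    using dq_nz by (simp add: power2_eq_square field_simps) (simp add: dq_def field_simps)
  also have "1 / dq\<^sup>2 * q - 1 / dq = 1 / dq\<^sup>2 * inverse q"
    using dq_nz by (simp add: power2_eq_square field_simps) (simp add: dq_def field_simps)
  also have "gF * gE + ((1 / dq\<^sup>2 * q) \<cdot> gK + (1 / dq\<^sup>2 * inverse q) \<cdot> gKinv) = casimir"
    by (simp add: casimir_def smul_add_right)
  finally show ?thesis .
qed

lemma antip_pc: "antip (pc f) \<doteq> pc f"
proof (induction f)
  case (pCons a f)
  have "antip (pc (pCons a f)) = a \<cdot> 1 + antip (pc f) * antip casimir" by (simp add: antip_simps)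
  also have "\<dots> \<doteq> a \<cdot> 1 + pc f * casimir" by (intro eqv_intros eqv_refl pCons antip_cas)
  also have "\<dots> \<doteq> a \<cdot> 1 + casimir * pc f" by (intro eqv_intros eqv_refl pc_comm)
  finally show ?case by simp
qed (simp add: antip_simps)

end

section \<open>The right integral\<close>

locale quantum_integral = small_quantum_group l q for l q +
  fixes lam :: "free_alg set \<Rightarrow> complex"
  assumes integral: "right_integral l q lam" and lam_nz: "\<exists>x\<in>carrier (U l q). lam x \<noteq> 0"
begin

definition L :: "free_alg \<Rightarrow> complex" where "L x = lam (cl x)"

lemma dual_L: "dual L"
  using integral unfolding L_def[abs_def] right_integral_def by (auto intro: U_dual_dual)

lemmas L_simps = lin_simps[OF dual_lin[OF dual_L]]

lemma L_eqv: "x \<doteq> y \<Longrightarrow> L x = L y"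
  by (rule dual_eqv[OF dual_L])

lemma L_integral:
  assumes g: "dual g"
  shows "tens_fun L g (Delta x) = g 1 * L x"
proof -
  have "conv l q lam (lift g) = (\<lambda>x\<in>carrier (U l q). lift g \<one>\<^bsub>U l q\<^esub> * lam x)"
    using integral lift_dual[OF g] by (simp add: right_integral_def)
  then have "conv l q lam (lift g) (cl x) = lift g \<one>\<^bsub>U l q\<^esub> * lam (cl x)"
    by simp
  moreover have "lam \<in> U_dual l q" using integral by (simp add: right_integral_def)
  ultimately have "tens_fun (\<lambda>x. lam (cl x)) (\<lambda>x. lift g (cl x)) (Delta x) = lift g (cl 1) * lam (cl x)"
    using conv_cls[OF _ lift_dual[OF g], of lam x] by (simp add: cls_one)
  then show ?thesis by (simp add: lift_cls[OF g] L_def[abs_def])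
qed

text \<open>The last factor is a power of \<open>K\<close>, not an idempotent, because
  \<open>K^b\<close> is grouplike and so \<open>Delta\<close> stays explicit.\<close>

definition mon :: "nat \<Rightarrow> nat \<Rightarrow> nat \<Rightarrow> free_alg" where
  "mon a c b = gF ^ a * gE ^ c * gK ^ b"

lemma mon_ge: "l \<le> a \<or> l \<le> c \<Longrightarrow> mon a c b \<doteq> 0"
  unfolding mon_def
  using eqv_mult_right[OF eqv_mult_left[OF E_pow_ge, of c "gF ^ a"], of "gK ^ b"]
    eqv_mult_right[OF eqv_mult_right[OF F_pow_ge, of a "gE ^ c"], of "gK ^ b"] by auto

lemma mon_periodic: "mon a c (b + l) \<doteq> mon a c b"
proof -
  have "mon a c (b + l) = mon a c b * gK ^ l" by (simp add: mon_def power_add mult.assoc)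
  also have "\<dots> \<doteq> mon a c b * 1" by (intro eqv_mult_left rel_Kl)
  finally show ?thesis by simp
qed

section \<open>The support of the integral\<close>

lemma Delta_mon: "Delta (mon a c b) \<simeq> (\<Sum>i\<le>a. \<Sum>j\<le>c. (qbin (w 2) a i * qbin (w 2) c j) \<cdot>
    tens (mon (a - i) j (c - j + b)) (gF ^ i * gKinv ^ (a - i) * gE ^ (c - j) * gK ^ b))"
proof -
  have "Delta (mon a c b) = Delta (gF ^ a) * Delta (gE ^ c) * Delta (gK ^ b)"
    by (simp add: mon_def Delta_simps)
  also have "\<dots> \<simeq> (\<Sum>i\<le>a. qbin (w 2) a i \<cdot> tens (gF ^ (a - i)) (gF ^ i * gKinv ^ (a - i))) *
      (\<Sum>j\<le>c. qbin (w 2) c j \<cdot> tens (gE ^ j * gK ^ (c - j)) (gE ^ (c - j))) * tens (gK ^ b) (gK ^ b)"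
    by (intro T.eqv_mult Delta_F_pow Delta_E_pow) (simp add: Delta_simps tens_power)
  also have "\<dots> = (\<Sum>i\<le>a. \<Sum>j\<le>c. (qbin (w 2) a i * qbin (w 2) c j) \<cdot>
    (tens (gF ^ (a - i)) (gF ^ i * gKinv ^ (a - i)) * tens (gE ^ j * gK ^ (c - j)) (gE ^ (c - j)) * tens (gK ^ b) (gK ^ b)))"
    unfolding sum_product unfolding sum_distrib_right
    by (simp only: smul_mult_left smul_mult_right smul_smul mult.commute)
  also have "\<dots> = (\<Sum>i\<le>a. \<Sum>j\<le>c. (qbin (w 2) a i * qbin (w 2) c j) \<cdot>
    tens (mon (a - i) j (c - j + b)) (gF ^ i * gKinv ^ (a - i) * gE ^ (c - j) * gK ^ b))"
    by (simp only: tens_mult mon_def power_add mult.assoc)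
  finally show ?thesis .
qed

lemma L_mon_sum:
  assumes g: "dual g"
  shows "g 1 * L (mon a c b) = (\<Sum>i\<le>a. \<Sum>j\<le>c. qbin (w 2) a i * qbin (w 2) c j *
    (L (mon (a - i) j (c - j + b)) * g (gF ^ i * gKinv ^ (a - i) * gE ^ (c - j) * gK ^ b)))"
  unfolding L_integral[OF g, symmetric] tens_fun_eqv[OF Delta_mon dual_L g]
  by (simp add: tens_fun_simps tens_fun_tens dual_lin dual_L g)

lemma sum_single:
  fixes a c i0 j0 :: nat
  assumes "i0 \<le> a" "j0 \<le> c" and "\<And>i j. i \<le> a \<Longrightarrow> j \<le> c \<Longrightarrow> (i, j) \<noteq> (i0, j0) \<Longrightarrow> f i j = (0 :: complex)"
  shows "(\<Sum>i\<le>a. \<Sum>j\<le>c. f i j) = f i0 j0"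
proof -
  have "(\<Sum>i\<le>a. \<Sum>j\<le>c. f i j) = (\<Sum>ij\<in>{..a} \<times> {..c}. f (fst ij) (snd ij))"
    by (simp add: sum.cartesian_product case_prod_beta)
  also have "\<dots> = (\<Sum>ij\<in>{(i0, j0)}. f (fst ij) (snd ij))"
  proof (rule sum.mono_neutral_right)
    show "\<forall>ij\<in>{..a} \<times> {..c} - {(i0, j0)}. f (fst ij) (snd ij) = 0"
    proof
      fix ij assume "ij \<in> {..a} \<times> {..c} - {(i0, j0)}"
      then have "fst ij \<le> a" "snd ij \<le> c" "(fst ij, snd ij) \<noteq> (i0, j0)" by auto
      then show "f (fst ij) (snd ij) = 0" by (rule assms(3))
    qed
  qed (use assms(1,2) in auto)
  finally show ?thesis by simp
qed

lemma act_Ki_pow: "supp n v \<Longrightarrow> act n (gKinv ^ m) v i = w (- (int n - 2 * int i)) ^ m * v i"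
  by (induction m arbitrary: i) (auto simp: act_mult supp_def)

lemma L_mon_nz: "\<exists>a c b. a < l \<and> c < l \<and> L (mon a c b) \<noteq> 0"
proof (rule ccontr)
  assume *: "\<nexists>a c b. a < l \<and> c < l \<and> L (mon a c b) \<noteq> 0"
  have "L x = 0" for x
  proof (rule dual_eq_bas[OF dual_L, of "\<lambda>x. 0"])
    show "dual (\<lambda>x. 0)" by (simp add: dual_def lin_def)
    fix a c k assume "a < l" "c < l"
    then show "L (bas a c k) = 0"
      using * by (simp add: bas_def e_def sum_distrib_left L_simps flip: mon_def)
  qed
  then show False using lam_nz by (auto simp: L_def U_carrier)
qed

text \<open>Apply the integral property to \<open>F\<^sup>a E\<^bsup>c+1\<^esup> K\<^sup>b\<close> and \<open>F\<^bsup>a+1\<^esup> E\<^sup>c K\<^sup>b\<close> with the matrix coefficient of the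
  two-dimensional module that detects \<open>E\<close> and \<open>F\<close>, respectively: by minimality of \<open>a + c\<close> only one term
  survives, and its \<open>q\<close>-binomial coefficient vanishes only at \<open>c + 1 = l\<close>, \<open>a + 1 = l\<close>.\<close>

lemma L_mon_support:
  assumes nz: "L (mon a c b) \<noteq> 0" and "a < l" "c < l"
    and min: "\<And>a' c' b'. a' + c' < a + c \<Longrightarrow> L (mon a' c' b') = 0"
  shows "a = l - 1" and "c = l - 1" and "int l dvd int b + 1"
proof -
  have n1: "(1::nat) < l" using l_ge by simp
  have u: "supp 1 (unit 0)" "supp 1 (unit 1)" by (simp_all add: unit_supp)
  show c: "c = l - 1"
  proof (rule ccontr)
    assume "c \<noteq> l - 1"
    then have cl: "Suc c < l" using assms(3) by simp
    define g where "g x = act 1 x (unit 1) 0" for x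
    have g: "dual g" unfolding g_def[abs_def] by (rule dual_act[OF n1 u(2)])
    \<comment> \<open>In the surviving term \<open>Delta\<close> contributes one more
      \<open>K\<close> to the first leg. Starting with \<open>b - 1\<close>, written as
      \<open>b + (l - 1)\<close>, this leg becomes \<open>mon a c (b + l)\<close>, which is
      \<open>mon a c b\<close> by periodicity.\<close>
    let ?b = "b + (l - 1)"
    have gF: "g (gF ^ i * gKinv ^ k * gE ^ m * gK ^ d) = 0" if "0 < i" for i k m d
      using that by (cases i) (simp_all add: g_def mult.assoc act_mult)
    have gK: "g (gKinv ^ k * gK ^ d) = 0" for k d
      by (simp add: g_def act_mult act_Ki_pow act_supp u act_K_pow del: One_nat_def) (simp add: unit_def)
    have gE: "g (gKinv ^ k * gE * gK ^ d) \<noteq> 0" for k d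
    proof -
      have "gam 1 \<noteq> gam (- 1)" using gam_ne[OF n1, of 1] by simp
      then show ?thesis
        by (simp add: g_def act_mult act_Ki_pow act_gen_supp act_supp u act_K_pow del: One_nat_def) (simp add: unit_def)
    qed
    have "0 = (\<Sum>i\<le>a. \<Sum>j\<le>Suc c. qbin (w 2) a i * qbin (w 2) (Suc c) j *
      (L (mon (a - i) j (Suc c - j + ?b)) * g (gF ^ i * gKinv ^ (a - i) * gE ^ (Suc c - j) * gK ^ ?b)))"
      using L_mon_sum[OF g, of a "Suc c" ?b] by (simp add: g_def unit_def)
    also have "\<dots> = qbin (w 2) a 0 * qbin (w 2) (Suc c) c *
      (L (mon (a - 0) c (Suc c - c + ?b)) * g (gF ^ 0 * gKinv ^ (a - 0) * gE ^ (Suc c - c) * gK ^ ?b))"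
    proof (rule sum_single)
      fix i j assume ij: "i \<le> a" "j \<le> Suc c" "(i, j) \<noteq> (0, c)"
      consider "0 < i" | "i = 0" "j < c" | "i = 0" "j = Suc c" using ij by fastforce
      then show "qbin (w 2) a i * qbin (w 2) (Suc c) j *
        (L (mon (a - i) j (Suc c - j + ?b)) * g (gF ^ i * gKinv ^ (a - i) * gE ^ (Suc c - j) * gK ^ ?b)) = 0"
      proof cases
        case 2
        then show ?thesis using min[of a j] by simp
      next
        case 3
        then show ?thesis using gK by simp
      qed (use gF in simp)
    qed simp_all
    also have "Suc c - c + ?b = b + l" by simp
    finally show False
      using nz gE[of a ?b] qbin_nz[of c "Suc c"] cl L_eqv[OF mon_periodic[of a c b]] by simp
  qed
  show a: "a = l - 1"
  proof (rule ccontr)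
    assume "a \<noteq> l - 1"
    then have al: "Suc a < l" using assms(2) by simp
    define g where "g x = act 1 x (unit 0) 1" for x
    have g: "dual g" unfolding g_def[abs_def] by (rule dual_act[OF n1 u(1)])
    have gE: "g (gF ^ i * gKinv ^ k * gE ^ m * gK ^ d) = 0" if m0: "0 < m" for i k m d
    proof -
      obtain m' where m: "m = Suc m'" using m0 by (cases m) auto
      have "act 1 (gE ^ m * gK ^ d) (unit 0) = (\<lambda>i. 0)"
      proof -
        have "act 1 (gE * gK ^ d) (unit 0) = (\<lambda>i. 0)"
          by (rule ext) (simp add: act_mult act_K_pow u del: One_nat_def, simp add: unit_def)
        moreover have "act 1 (gE ^ m') (\<lambda>i. 0) = (\<lambda>i. 0)"
          using act_scale[of 1 "gE ^ m'" 0 "\<lambda>i. 0"] by (simp add: fun_eq_iff)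
        ultimately show ?thesis
          unfolding m power_Suc2 by (simp only: mult.assoc act_mult[of _ "gE ^ m'"])
      qed
      moreover have "act 1 (gF ^ i * gKinv ^ k) (\<lambda>i. 0) = (\<lambda>i. 0)"
        using act_scale[of 1 "gF ^ i * gKinv ^ k" 0 "\<lambda>i. 0"] by (simp add: fun_eq_iff)
      ultimately show ?thesis
        unfolding g_def by (simp only: mult.assoc[of "gF ^ i * gKinv ^ k"] act_mult[of _ "gF ^ i * gKinv ^ k"])
    qed
    have gK: "g (gKinv ^ k * gK ^ d) = 0" for k d
      by (simp add: g_def act_mult act_Ki_pow act_supp u act_K_pow del: One_nat_def) (simp add: unit_def)
    have gF: "g (gF * gKinv ^ k * gK ^ d) \<noteq> 0" for k d
      by (simp add: g_def mult.assoc act_mult act_Ki_pow act_supp u act_K_pow del: One_nat_def) (simp add: unit_def)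
    have "0 = (\<Sum>i\<le>Suc a. \<Sum>j\<le>c. qbin (w 2) (Suc a) i * qbin (w 2) c j *
      (L (mon (Suc a - i) j (c - j + b)) * g (gF ^ i * gKinv ^ (Suc a - i) * gE ^ (c - j) * gK ^ b)))"
      using L_mon_sum[OF g, of "Suc a" c b] by (simp add: g_def unit_def)
    also have "\<dots> = qbin (w 2) (Suc a) 1 * qbin (w 2) c c *
      (L (mon (Suc a - 1) c (c - c + b)) * g (gF ^ 1 * gKinv ^ (Suc a - 1) * gE ^ (c - c) * gK ^ b))"
    proof (rule sum_single)
      fix i j assume ij: "i \<le> Suc a" "j \<le> c" "(i, j) \<noteq> (1, c)"
      consider "j < c" | "i = 0" "j = c" | "1 < i" "j = c" using ij by fastforce
      then show "qbin (w 2) (Suc a) i * qbin (w 2) c j *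
        (L (mon (Suc a - i) j (c - j + b)) * g (gF ^ i * gKinv ^ (Suc a - i) * gE ^ (c - j) * gK ^ b)) = 0"
      proof cases
        case 1
        then show ?thesis using gE by simp
      next
        case 2
        then show ?thesis using gK[of "Suc a" b] by simp
      next
        case 3
        then show ?thesis using min[of "Suc a - i" c] ij by simp
      qed
    qed simp_all
    finally show False
      using nz gF[of a b] qbin_nz[of 1 "Suc a"] al by (simp add: qbin_diag del: qbin.simps)
  qed
  \<comment> \<open>The coefficient at the highest weight vector sees \<open>K\<close>. Only the
    term with second leg \<open>K^-a K^b\<close> remains, so \<open>w (b - a) = 1\<close>; with
    \<open>a = l - 1\<close> this says \<open>b = -1\<close> modulo \<open>l\<close>.\<close>
  define g where "g x = act 1 x (unit 0) 0" for x
  have g: "dual g" unfolding g_def[abs_def] by (rule dual_act[OF n1 u(1)])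
  have gK: "g (gKinv ^ k * gK ^ d) = w (- 1) ^ k * w 1 ^ d" for k d
    by (simp add: g_def act_mult act_Ki_pow act_supp u act_K_pow del: One_nat_def) (simp add: unit_def)
  have "L (mon a c b) = (\<Sum>i\<le>a. \<Sum>j\<le>c. qbin (w 2) a i * qbin (w 2) c j *
      (L (mon (a - i) j (c - j + b)) * g (gF ^ i * gKinv ^ (a - i) * gE ^ (c - j) * gK ^ b)))"
    using L_mon_sum[OF g, of a c b] by (simp add: g_def unit_def)
  also have "\<dots> = qbin (w 2) a 0 * qbin (w 2) c c *
      (L (mon (a - 0) c (c - c + b)) * g (gF ^ 0 * gKinv ^ (a - 0) * gE ^ (c - c) * gK ^ b))"
  proof (rule sum_single)
    fix i j assume ij: "i \<le> a" "j \<le> c" "(i, j) \<noteq> (0, c)"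
    then have "a - i + j < a + c" by auto
    then show "qbin (w 2) a i * qbin (w 2) c j *
      (L (mon (a - i) j (c - j + b)) * g (gF ^ i * gKinv ^ (a - i) * gE ^ (c - j) * gK ^ b)) = 0"
      using min by simp
  qed simp_all
  finally have "w (- 1) ^ a * w 1 ^ b = 1" using nz gK[of a b] by (simp add: qbin_diag)
  then have "w (int b - int a) = 1"
    by (simp add: w_diff w_minus w_of_nat w_1 power_inverse divide_inverse mult.commute)
  then have "int l dvd int b - int a" unfolding w_eq_1_iff .
  then have "int l dvd int b - int a + int l" by simp
  also have "int b - int a + int l = int b + 1" using a l_ge by (simp add: of_nat_diff)
  finally show "int l dvd int b + 1" .
qed

text \<open>The value that determines the integral; the exponent \<open>l - 1\<close> of
  \<open>K\<close> stands for \<open>-1\<close>.\<close>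

definition L0 :: complex where "L0 = L (mon (l - 1) (l - 1) (l - 1))"

lemma L_mon_eq_0: "a < l - 1 \<or> c < l - 1 \<Longrightarrow> a < l \<Longrightarrow> c < l \<Longrightarrow> L (mon a c b) = 0"
  and L_mon_top: "b < l - 1 \<Longrightarrow> L (mon (l - 1) (l - 1) b) = 0"
  and L0_nz: "L0 \<noteq> 0"
proof -
  \<comment> \<open>\<open>S\<close> collects the values of \<open>a + c\<close> at which the
    integral does not vanish. Its least element supplies the minimality hypothesis of
    \<open>L_mon_support\<close>, which then forces \<open>a = c = l - 1\<close>, so nothing
    survives below the top.\<close>
  define S where "S = (\<lambda>s. \<exists>a c b. a < l \<and> c < l \<and> L (mon a c b) \<noteq> 0 \<and> s = a + c)"
  have "\<exists>s. S s" using L_mon_nz unfolding S_def by blast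
  then have S: "S (LEAST s. S s)" by (rule LeastI_ex)
  then obtain a c b where *: "a < l" "c < l" "L (mon a c b) \<noteq> 0" "(LEAST s. S s) = a + c"
    unfolding S_def by blast
  have min: "L (mon a' c' b') = 0" if "a' + c' < a + c" for a' c' b'
  proof (cases "a' < l \<and> c' < l")
    case True
    have "\<not> S (a' + c')" using not_less_Least[of "a' + c'" S] that *(4) by simp
    then show ?thesis using True unfolding S_def by blast
  next
    case False
    then show ?thesis using L_eqv[OF mon_ge, of a' c' b'] by (auto simp: L_simps)
  qed
  note supp = L_mon_support[OF *(3,1,2) min]
  have a: "a = l - 1" and c: "c = l - 1" by (rule supp(1), assumption, rule supp(2), assumption)
  show "L (mon a' c' b') = 0" if "a' < l - 1 \<or> c' < l - 1" "a' < l" "c' < l" for a' c' b'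
    using min[of a' c' b'] that unfolding a c by auto
  have top: "l dvd b' + 1" if "L (mon (l - 1) (l - 1) b') \<noteq> 0" for b'
  proof -
    have "int l dvd int b' + 1" by (rule L_mon_support(3)[OF that]) (use min a c in simp_all)
    also have "int b' + 1 = int (b' + 1)" by simp
    finally show ?thesis unfolding of_nat_dvd_iff .
  qed
  show "L (mon (l - 1) (l - 1) b') = 0" if "b' < l - 1" for b'
  proof (rule ccontr)
    assume "L (mon (l - 1) (l - 1) b') \<noteq> 0"
    then have "l dvd b' + 1" by (rule top)
    then show False using that dvd_imp_le[of l "b' + 1"] by simp
  qed
  have "l dvd b + 1" using top[of b] *(3) a c by simp
  then obtain m where m: "b + 1 = l * m" by (auto simp: dvd_def)
  moreover have "m \<noteq> 0" using m by (auto intro: ccontr)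
  ultimately obtain m' where "b + 1 = l * Suc m'" by (cases m) auto
  \<comment> \<open>The exponent found is only known modulo \<open>l\<close>; periodicity reduces it
    to \<open>l - 1\<close>, the one in \<open>L0\<close>.\<close>
  then have b: "b = l - 1 + l * m'" using l_ge by simp
  have "L (mon a c (l - 1 + l * m')) = L (mon a c (l - 1))" for m'
  proof (induction m')
    case (Suc m')
    have "L (mon a c (l - 1 + l * Suc m')) = L (mon a c (l - 1 + l * m' + l))"
      by (simp add: ac_simps)
    also have "\<dots> = L (mon a c (l - 1 + l * m'))" by (rule L_eqv[OF mon_periodic])
    finally show ?case using Suc by simp
  qed simp
  then show "L0 \<noteq> 0" using *(3) a c b by (simp add: L0_def)
qed

text \<open>Expanding \<open>e_k\<close> in powers of \<open>K\<close>, only the term with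
  \<open>K^(l-1)\<close> contributes; its Fourier coefficient is \<open>w k / l\<close>.\<close>

lemma L_bas: "L (bas a c k) = (if a = l - 1 \<and> c = l - 1 then L0 * w k / of_nat l else 0)"
proof (cases "a < l \<and> c < l")
  case True
  have *: "L (bas a c k) = (\<Sum>j<l. w (- k * int j) / of_nat l * L (mon a c j))"
    by (simp add: bas_def e_def sum_distrib_left L_simps mon_def)
  show ?thesis
  proof (cases "a = l - 1 \<and> c = l - 1")
    case True
    have "L (bas a c k) = (\<Sum>j\<in>{l - 1}. w (- k * int j) / of_nat l * L (mon a c j))"
      unfolding *
    proof (rule sum.mono_neutral_right)
      show "\<forall>j\<in>{..<l} - {l - 1}. w (- k * int j) / of_nat l * L (mon a c j) = 0"
      proof
        fix j assume "j \<in> {..<l} - {l - 1}"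
        then have "j < l - 1" by auto
        then show "w (- k * int j) / of_nat l * L (mon a c j) = 0" using True L_mon_top[of j] by simp
      qed
    qed simp_all
    also have "\<dots> = w (- k * int (l - 1)) / of_nat l * L (mon a c (l - 1))" by simp
    also have "w (- k * int (l - 1)) = w k"
    proof -
      have "- k * int (l - 1) - k = int l * (- k)"
        using l_ge by (simp add: of_nat_diff algebra_simps)
      then show ?thesis unfolding w_eq_iff by simp
    qed
    finally show ?thesis using True by (simp add: L0_def)
  next
    case False
    then have "a < l - 1 \<or> c < l - 1" using True by auto
    then have "L (mon a c j) = 0" for j using True by (intro L_mon_eq_0) auto
    then have "L (bas a c k) = 0" by (simp add: *)
    then show ?thesis using False by (simp only: if_False)
  qed
next
  case False
  then have "L (bas a c k) = L 0" by (intro L_eqv bas_ge) auto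
  then show ?thesis using False l_ge by (auto simp: L_simps)
qed

section \<open>The commutation rule and the nondegeneracy of the integral\<close>

lemma EpowF_e: "\<exists>\<eta>. gE ^ Suc c * gF * e j \<doteq> gF * gE ^ Suc c * e j + \<eta> \<cdot> (gE ^ c * e j)"
proof (induction c arbitrary: j)
  case 0
  show ?case using EF_weight[of j 1] by (intro exI[of _ "gam j - gam (j - 2)"]) simp
next
  case (Suc c)
  obtain \<eta> where \<eta>: "gE ^ Suc c * gF * e (j + 2) \<doteq> gF * gE ^ Suc c * e (j + 2) + \<eta> \<cdot> (gE ^ c * e (j + 2))"
    using Suc by blast
  let ?\<kappa> = "gam j - gam (j - 2)"
  have "gE ^ Suc (Suc c) * gF * e j = gE ^ Suc c * (gE * gF * (e j * 1))"
    unfolding power_Suc2[of gE "Suc c"] by (simp only: mult.assoc mult_1_right)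
  also have "\<dots> \<doteq> gE ^ Suc c * (gF * gE * (e j * 1) + ?\<kappa> \<cdot> (e j * 1))"
    by (intro eqv_mult_left EF_weight)
  also have "\<dots> = gE ^ Suc c * gF * (gE * e j) + ?\<kappa> \<cdot> (gE ^ Suc c * e j)"
    by (simp only: mult.assoc distrib_left smul_mult_right mult_1_right)
  also have "\<dots> \<doteq> gE ^ Suc c * gF * (e (j + 2) * gE) + ?\<kappa> \<cdot> (gE ^ Suc c * e j)"
    by (intro eqv_add eqv_mult_left E_e eqv_refl)
  also have "\<dots> = gE ^ Suc c * gF * e (j + 2) * gE + ?\<kappa> \<cdot> (gE ^ Suc c * e j)"
    by (simp only: mult.assoc)
  also have "\<dots> \<doteq> (gF * gE ^ Suc c * e (j + 2) + \<eta> \<cdot> (gE ^ c * e (j + 2))) * gE + ?\<kappa> \<cdot> (gE ^ Suc c * e j)"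
    by (intro eqv_add eqv_mult_right \<eta> eqv_refl)
  also have "\<dots> = gF * gE ^ Suc c * (e (j + 2) * gE) + \<eta> \<cdot> (gE ^ c * (e (j + 2) * gE)) + ?\<kappa> \<cdot> (gE ^ Suc c * e j)"
    by (simp only: mult.assoc distrib_right smul_mult_left)
  also have "\<dots> \<doteq> gF * gE ^ Suc c * (gE * e j) + \<eta> \<cdot> (gE ^ c * (gE * e j)) + ?\<kappa> \<cdot> (gE ^ Suc c * e j)"
    by (intro eqv_add eqv_smul eqv_mult_left eqv_sym[OF E_e] eqv_refl)
  also have "\<dots> = gF * gE ^ Suc (Suc c) * e j + (\<eta> + ?\<kappa>) \<cdot> (gE ^ Suc c * e j)"
    unfolding power_Suc2[of gE "Suc c"] power_Suc2[of gE c]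
    by (simp only: mult.assoc smul_add_left add.assoc)
  finally show ?case by blast
qed

text \<open>The correction term in \<open>E_bas\<close> never reaches the top power of
  \<open>F\<close>, so \<open>L\<close> does not see it. Multiplication by \<open>E\<close> from
  either side then raises \<open>c\<close>, but from the right it also lowers \<open>k\<close> by 2,
  which accounts for \<open>w 2\<close>.\<close>

lemma L_twist_E: "L (gE * y) = w 2 * L (y * gE)"
proof (rule dual_eq_bas[where f = "\<lambda>y. L (gE * y)" and g = "\<lambda>y. w 2 * L (y * gE)"])
  show "dual (\<lambda>y. L (gE * y))" by (rule dual_mult_left[OF dual_L])
  show "dual (\<lambda>y. w 2 * L (y * gE))"
    using dual_mult_right[OF dual_L, of gE] by (auto simp: dual_def lin_def algebra_simps)
  fix a c k assume ac: "a < l" "c < l"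
  obtain \<eta> where "gE * bas a c k \<doteq> bas a (Suc c) k + \<eta> \<cdot> bas (a - 1) c k" using E_bas by blast
  then have 1: "L (gE * bas a c k) = L (bas a (Suc c) k) + \<eta> * L (bas (a - 1) c k)"
    using L_eqv by (simp add: L_simps)
  have "L (bas (a - 1) c k) = 0" using ac l_ge by (auto simp: L_bas)
  moreover have "bas a c k * gE \<doteq> bas a (Suc c) (k - 2)"
  proof -
    have "bas a c k * gE = gF ^ a * gE ^ c * (e k * gE)" by (simp add: bas_def mult.assoc)
    also have "\<dots> \<doteq> gF ^ a * gE ^ c * (gE * e (k - 2))" by (intro eqv_mult_left e_E)
    also have "\<dots> = bas a (Suc c) (k - 2)" unfolding bas_def power_Suc2 by (simp only: mult.assoc)
    finally show ?thesis .
  qed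
  ultimately show "L (gE * bas a c k) = w 2 * L (bas a c k * gE)"
    using L_eqv[of "bas a c k * gE"] 1 by (simp add: L_bas flip: w_add)
qed

lemma L_twist_F: "L (gF * y) = w (- 2) * L (y * gF)"
proof (rule dual_eq_bas[where f = "\<lambda>y. L (gF * y)" and g = "\<lambda>y. w (- 2) * L (y * gF)"])
  show "dual (\<lambda>y. L (gF * y))" by (rule dual_mult_left[OF dual_L])
  show "dual (\<lambda>y. w (- 2) * L (y * gF))"
    using dual_mult_right[OF dual_L, of gF] by (auto simp: dual_def lin_def algebra_simps)
  fix a c k assume ac: "a < l" "c < l"
  have 1: "gF * bas a c k = bas (Suc a) c k" by (simp add: bas_def mult.assoc)
  have "L (bas a c k * gF) = L (bas (Suc a) c (k + 2))"
  proof (cases c)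
    case 0
    have "a \<noteq> l - 1 \<or> c \<noteq> l - 1" "Suc a \<noteq> l - 1 \<or> c \<noteq> l - 1" using 0 l_ge by auto
    have "bas a c k * gF \<doteq> bas (Suc a) c (k + 2)"
    proof -
      have "bas a c k * gF = gF ^ a * (e k * gF)" using 0 by (simp add: bas_def mult.assoc)
      also have "\<dots> \<doteq> gF ^ a * (gF * e (k + 2))" by (intro eqv_mult_left e_F)
      also have "\<dots> = bas (Suc a) c (k + 2)" unfolding bas_def power_Suc2 0 by (simp add: mult.assoc)
      finally show ?thesis .
    qed
    then show ?thesis by (rule L_eqv)
  next
    case (Suc c')
    obtain \<eta> where \<eta>: "gE ^ Suc c' * gF * e (k + 2) \<doteq> gF * gE ^ Suc c' * e (k + 2) + \<eta> \<cdot> (gE ^ c' * e (k + 2))"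
      using EpowF_e by blast
    have "bas a c k * gF = gF ^ a * gE ^ c * (e k * gF)" by (simp add: bas_def mult.assoc)
    also have "\<dots> \<doteq> gF ^ a * gE ^ c * (gF * e (k + 2))" by (intro eqv_mult_left e_F)
    also have "\<dots> = gF ^ a * (gE ^ Suc c' * gF * e (k + 2))" unfolding Suc by (simp only: mult.assoc)
    also have "\<dots> \<doteq> gF ^ a * (gF * gE ^ Suc c' * e (k + 2) + \<eta> \<cdot> (gE ^ c' * e (k + 2)))"
      by (intro eqv_mult_left \<eta>)
    also have "\<dots> = bas (Suc a) c (k + 2) + \<eta> \<cdot> bas a c' (k + 2)"
      unfolding bas_def power_Suc2[of gF] Suc by (simp only: mult.assoc distrib_left smul_mult_right)
    finally have "L (bas a c k * gF) = L (bas (Suc a) c (k + 2)) + \<eta> * L (bas a c' (k + 2))"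
      using L_eqv by (simp add: L_simps)
    moreover have "L (bas a c' (k + 2)) = 0" using ac Suc by (auto simp: L_bas)
    ultimately show ?thesis by simp
  qed
  then show "L (gF * bas a c k) = w (- 2) * L (bas a c k * gF)"
    unfolding 1 by (simp add: L_bas flip: w_add)
qed

lemma L_twist_K: "L (gK * y) = L (y * gK)"
proof (rule dual_eq_bas[where f = "\<lambda>y. L (gK * y)" and g = "\<lambda>y. L (y * gK)"])
  show "dual (\<lambda>y. L (gK * y))" by (rule dual_mult_left[OF dual_L])
  show "dual (\<lambda>y. L (y * gK))" by (rule dual_mult_right[OF dual_L])
  fix a c k assume ac: "a < l" "c < l"
  have "L (gK * bas a c k) = L (w (k + 2 * int c - 2 * int a) \<cdot> bas a c k)" by (rule L_eqv[OF K_bas])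
  also have "\<dots> = L (w k \<cdot> bas a c k)" by (simp add: L_simps L_bas)
  also have "\<dots> = L (bas a c k * gK)" by (rule L_eqv[OF eqv_sym[OF bas_K]])
  finally show "L (gK * bas a c k) = L (bas a c k * gK)" .
qed

lemma L_twist_Kpow: "L (gK ^ n * y) = L (y * gK ^ n)"
  by (induction n arbitrary: y) (simp_all add: mult.assoc L_twist_K power_commutes)

text \<open>The Nakayama automorphism of the integral is conjugation by \<open>K\<close>: this is
  checked on letters and extended along words.\<close>

lemma L_twist: "L (x * y) = L (y * gK * x * gKinv)"
proof (induction x arbitrary: y rule: free_alg_induct)
  case one
  show ?case using eqv_mult_left[OF eqv_sym[OF rel_KKi], of y] by (intro L_eqv) (simp add: mult.assoc)
next
  case (gen g x)
  have g: "L (gen g * y) = L (y * gK * gen g * gKinv)" for y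
  proof (cases g)
    case Gen_E
    have "y * (gK * gE * gKinv) \<doteq> y * (w 2 \<cdot> gE)" by (intro eqv_mult_left rel_KEKi)
    then show ?thesis using L_eqv Gen_E by (simp add: L_twist_E mult.assoc L_simps)
  next
    case Gen_F
    have "y * (gK * gF * gKinv) \<doteq> y * (w (- 2) \<cdot> gF)" by (intro eqv_mult_left rel_KFKi)
    then show ?thesis using L_eqv Gen_F by (simp add: L_twist_F mult.assoc L_simps)
  next
    case Gen_K
    have "y * gK * (gK * gKinv) \<doteq> y * gK * 1" by (intro eqv_mult_left rel_KKi)
    then show ?thesis using L_eqv Gen_K by (simp add: L_twist_K mult.assoc)
  next
    case Gen_Kinv
    have "L (gKinv * y) = L (gK ^ (l - 1) * y)" by (intro L_eqv eqv_mult_right rel_Ki)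
    also have "\<dots> = L (y * gK ^ (l - 1))" by (rule L_twist_Kpow)
    also have "\<dots> = L (y * gKinv)" by (intro L_eqv eqv_mult_left eqv_sym[OF rel_Ki])
    also have "\<dots> = L (y * (gK * gKinv) * gKinv)"
      using eqv_mult_right[OF eqv_mult_left[OF eqv_sym[OF rel_KKi], of y], of gKinv] by (intro L_eqv) simp
    finally show ?thesis using Gen_Kinv by (simp add: mult.assoc)
  qed
  have "L (gen g * x * y) = L (x * (y * gK * gen g * gKinv))"
    using g[of "x * y"] by (simp add: mult.assoc)
  also have "\<dots> = L (y * gK * gen g * (gKinv * gK) * (x * gKinv))"
    unfolding gen by (simp add: mult.assoc)
  also have "\<dots> = L (y * gK * gen g * 1 * (x * gKinv))"
    by (intro L_eqv eqv_mult_left eqv_mult_right rel_KiK)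
  finally show ?case by (simp add: mult.assoc)
next
  case (add x z)
  then show ?case by (simp add: L_simps distrib_left distrib_right)
next
  case (smul c x)
  then show ?case by (simp add: L_simps)
qed

text \<open>The coefficients in the basis \<open>F\<^sup>a E\<^sup>c e\<^sub>k\<close>, recovered from \<open>\<lambda>\<close>.\<close>

lemma L_expand:
  "x \<doteq> (\<Sum>a<l. \<Sum>c<l. \<Sum>k\<in>Res. (of_nat l / (L0 * w (k + 2 * int c + 2)) *
     L (gF ^ (l - 1 - a) * x * (e k * gE ^ (l - 1 - c)))) \<cdot> bas a c k)" (is "x \<doteq> ?R x")
proof (induction x rule: pbw_induct)
  case (bas a' c' k')
  define k0 where "k0 = k' mod int l"
  have k0: "k0 \<in> Res" "int l dvd k' - k0" by (simp_all add: k0_def mod_eq_dvd_iff[symmetric])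
  then have k0': "e k' = e k0" by (intro e_cong)
  have *: "of_nat l / (L0 * w (k + 2 * int c + 2)) * L (gF ^ (l - 1 - a) * bas a' c' k' * (e k * gE ^ (l - 1 - c)))
      = (if k0 = k then if a = a' then if c = c' then 1 else 0 else 0 else 0)"
    if "a < l" "c < l" "k \<in> Res" for a c k
  proof -
    have "gF ^ (l - 1 - a) * bas a' c' k' * (e k * gE ^ (l - 1 - c)) =
        gF ^ (l - 1 - a + a') * gE ^ c' * (e k0 * e k * gE ^ (l - 1 - c))"
      by (simp add: bas_def k0' power_add mult.assoc)
    also have "\<dots> \<doteq> gF ^ (l - 1 - a + a') * gE ^ c' * ((if k0 = k then e k else 0) * gE ^ (l - 1 - c))"
      using e_mult_e[of k0 k] unfolding l_dvd_Res[OF k0(1) that(3)]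
      by (intro eqv_mult_left eqv_mult_right)
    finally have 1: "L (gF ^ (l - 1 - a) * bas a' c' k' * (e k * gE ^ (l - 1 - c))) =
        L (gF ^ (l - 1 - a + a') * gE ^ c' * ((if k0 = k then e k else 0) * gE ^ (l - 1 - c)))"
      by (rule L_eqv)
    show ?thesis
    proof (cases "k0 = k")
      case True
      have "gF ^ (l - 1 - a + a') * gE ^ c' * (e k * gE ^ (l - 1 - c)) \<doteq>
          gF ^ (l - 1 - a + a') * gE ^ c' * (gE ^ (l - 1 - c) * e (k - 2 * int (l - 1 - c)))"
        using eqv_mult_left[OF eqv_sym[OF Epow_e[of "l - 1 - c" "k - 2 * int (l - 1 - c)"]]]
        by simp
      also have "\<dots> = bas (l - 1 - a + a') (c' + (l - 1 - c)) (k - 2 * int (l - 1 - c))"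
        by (simp add: bas_def power_add mult.assoc)
      finally have "L (gF ^ (l - 1 - a + a') * gE ^ c' * (e k * gE ^ (l - 1 - c))) =
          L (bas (l - 1 - a + a') (c' + (l - 1 - c)) (k - 2 * int (l - 1 - c)))"
        by (rule L_eqv)
      also have "\<dots> = (if a = a' \<and> c = c' then L0 * w (k - 2 * int (l - 1 - c)) / of_nat l else 0)"
      proof -
        have "l - 1 - a + a' = l - 1 \<and> c' + (l - 1 - c) = l - 1 \<longleftrightarrow> a = a' \<and> c = c'"
          using that(1,2) by linarith
        then show ?thesis by (simp only: L_bas)
      qed
      \<comment> \<open>This is the origin of the normalizing factor in the statement: completing
        \<open>E^c\<close> to the top power moves the idempotent from \<open>k\<close> to a weight
        congruent to \<open>k + 2 c + 2\<close>.\<close>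
      also have "w (k - 2 * int (l - 1 - c)) = w (k + 2 * int c + 2)"
      proof -
        have "k - 2 * int (l - 1 - c) - (k + 2 * int c + 2) = int l * (- 2)"
          using that by (simp add: of_nat_diff algebra_simps)
        then show ?thesis unfolding w_eq_iff by simp
      qed
      finally show ?thesis using 1 True L0_nz by simp
    qed (use 1 in \<open>simp add: L_simps\<close>)
  qed
  have "?R (bas a' c' k') = (\<Sum>a<l. \<Sum>c<l. \<Sum>k\<in>Res.
      (if k0 = k then if a = a' then if c = c' then 1 else 0 else 0 else 0) \<cdot> bas a c k)"
    by (intro sum.cong refl arg_cong2[where f = "(\<cdot>)"] *) simp_all
  also have "\<dots> = (\<Sum>a<l. \<Sum>c<l. \<Sum>k\<in>Res. if k0 = k then if a = a' then if c = c' then bas a c k else 0 else 0 else 0)"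
    by (intro sum.cong refl) auto
  also have "\<dots> = (\<Sum>a<l. \<Sum>c<l. if a = a' then if c = c' then bas a c k0 else 0 else 0)"
    using k0(1) by (subst sum.delta') simp_all
  also have "\<dots> = (\<Sum>a<l. if a = a' then \<Sum>c<l. if c = c' then bas a c k0 else 0 else 0)"
    by (intro sum.cong refl) auto
  also have "\<dots> = bas a' c' k'"
    using bas by (subst sum.delta | simp add: bas_def k0')+
  finally show ?case by simp
next
  case (add x y)
  have "?R (x + y) = ?R x + ?R y"
    by (simp add: L_simps distrib_left distrib_right smul_add_left sum.distrib)
  then show ?case using eqv_add[OF add] by simp
next
  case (smul r x)
  have "?R (r \<cdot> x) = r \<cdot> ?R x"
    by (simp add: L_simps smul_sum_right mult.assoc mult.left_commute)
  then show ?case using eqv_smul[OF smul] by simp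
next
  case (eqv x y)
  have "?R y = ?R x"
    using L_eqv[OF eqv_mult_right[OF eqv_mult_left[OF eqv(2)]]] by simp
  then show ?case using eqv_trans[OF eqv(2,1)] by simp
qed (simp add: L_simps)

text \<open>By \<open>L_twist\<close> a left factor can be moved to the right, so all the
  coefficients in \<open>L_expand\<close> vanish.\<close>

lemma L_nondegenerate:
  assumes "\<And>y. L (x * y) = 0"
  shows "x \<doteq> 0"
proof -
  have "L (u * x * v) = 0" for u v
    using L_twist[of u "x * v"] assms[of "v * gK * u * gKinv"] by (simp add: mult.assoc)
  then show ?thesis using L_expand[of x] by (simp add: mult.assoc)
qed

end

section \<open>The center\<close>

text \<open>One polynomial of each degree below \<open>N\<close> spans: the leading term is
  subtracted repeatedly.\<close>

lemma poly_basis_induct [consumes 1, case_names deg zero add smult basis]: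
  fixes b :: "nat \<Rightarrow> complex poly"
  assumes deg: "degree f < N" and b: "\<And>m. m < N \<Longrightarrow> b m \<noteq> 0 \<and> degree (b m) = m"
    and zero: "Q 0" and add: "\<And>f g. Q f \<Longrightarrow> Q g \<Longrightarrow> Q (f + g)"
    and smult: "\<And>c f. Q f \<Longrightarrow> Q (Polynomial.smult c f)" and basis: "\<And>m. m < N \<Longrightarrow> Q (b m)"
  shows "Q f"
proof -
  have "Q f" if "n \<le> N" "degree f < n \<or> f = 0" for n f
    using that
  proof (induction n arbitrary: f)
    case (Suc n)
    define c where "c = coeff f n / lead_coeff (b n)"
    define g where "g = f - Polynomial.smult c (b n)"
    have bn: "b n \<noteq> 0" "degree (b n) = n" using b[of n] Suc.prems by auto
    have "coeff (b n) n \<noteq> 0" using bn by (metis leading_coeff_neq_0)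
    then have "coeff g n = 0" using bn by (simp add: g_def c_def)
    moreover have "degree g \<le> n"
      using Suc.prems bn by (auto simp: g_def intro!: degree_diff_le)
    ultimately have "degree g < n \<or> g = 0"
      by (metis le_neq_implies_less leading_coeff_0_iff)
    then have "Q g" using Suc by auto
    then have "Q (g + Polynomial.smult c (b n))"
      using Suc.prems by (intro add smult basis) auto
    then show ?case by (simp add: g_def)
  qed (simp add: zero)
  from this[of N f] deg show ?thesis by simp
qed

context small_quantum_group
begin

text \<open>\<open>Psi\<close> is the minimal polynomial of the Casimir element, and \<open>Qp k\<close> is \<open>Psi / (X - gam k)\<close>.\<close>

definition Psi :: "complex poly" where "Psi = P 0 l"

definition Qp :: "int \<Rightarrow> complex poly" where "Qp k = P (k + 2) (l - 1)"

lemma Qp_cong: "int l dvd k - k' \<Longrightarrow> Qp k = Qp k'"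
  unfolding Qp_def by (rule P_cong) simp

lemma Qp_alt: "Qp k = P (k - 2 * int (l - 1)) (l - 1)"
  unfolding Qp_def
proof (rule P_cong)
  have "k + 2 - (k - 2 * int (l - 1)) = int l * 2" using l_ge by (simp add: of_nat_diff)
  then show "int l dvd k + 2 - (k - 2 * int (l - 1))" by simp
qed

lemma Qp_monic: "degree (Qp k) = l - 1" "lead_coeff (Qp k) = 1" "Qp k \<noteq> 0"
  unfolding Qp_def using P_monic[of "k + 2" "l - 1"] by simp_all

text \<open>\<open>(l + 1) / 2\<close> inverts 2 modulo \<open>l\<close>. With a natural number as
  half, a property stable under \<open>k\<close> to \<open>k + 2\<close> reaches every residue by
  induction.\<close>

lemma ex_double: "\<exists>i::nat. int l dvd k - 2 * int i"
proof -
  define h where "h = (int l + 1) div 2"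
  have "even (int l + 1)" using l_odd by simp
  then have h: "2 * h = int l + 1" unfolding h_def by (rule dvd_mult_div_cancel)
  have "k - 2 * ((k * h) mod int l) = k - k * (2 * h) + int l * (2 * ((k * h) div int l))"
    by (simp add: minus_mult_div_eq_mod[symmetric] algebra_simps)
  also have "\<dots> = int l * (2 * ((k * h) div int l) - k)" unfolding h by (simp add: algebra_simps)
  finally have "int l dvd k - 2 * ((k * h) mod int l)" by simp
  then show ?thesis by (intro exI[of _ "nat ((k * h) mod int l)"]) simp
qed

text \<open>Shifting the start by 2 removes the factor at \<open>k\<close> and adds the one at
  \<open>k + 2 l\<close>, which is equal to it; steps of 2 reach every residue.\<close>

lemma P_l: "P k l = Psi"
proof -
  have step: "P (k + 2) l = P k l" for k
  proof -
    have "[:- gam k, 1:] * P (k + 2) l = P k l * [:- gam (k + 2 * int l), 1:]"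
      using P_Suc_shift[of k l] P_Suc[of k l] by simp
    moreover have "gam (k + 2 * int l) = gam k" by (rule gam_cong) simp
    ultimately have "[:- gam k, 1:] * P (k + 2) l = [:- gam k, 1:] * P k l"
      by (simp only: mult.commute)
    then show ?thesis by (simp only: mult_cancel_left) simp
  qed
  have even: "P (2 * int i) l = Psi" for i
    by (induction i) (use step[of "2 * int _"] in \<open>simp_all add: Psi_def algebra_simps\<close>)
  obtain i where "int l dvd k - 2 * int i" using ex_double by blast
  then show ?thesis using even[of i] P_cong[of k "2 * int i" l] by simp
qed

lemma Psi_monic: "degree Psi = l" "Psi \<noteq> 0"
  unfolding Psi_def using P_monic[of 0 l] by simp_all

lemma Qp_Psi: "[:- gam k, 1:] * Qp k = Psi"
proof -
  have "Psi = P k (Suc (l - 1))" using l_ge by (simp add: P_l)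
  then show ?thesis by (simp only: Qp_def P_Suc_shift)
qed

lemma pc_Psi: "pc Psi \<doteq> 0"
proof (rule eqv_by_e)
  fix k
  have "pc Psi * e k \<doteq> gF ^ l * gE ^ l * e k"
    using eqv_sym[OF FE_pow_e[of l k]] by (simp add: P_l)
  also have "\<dots> \<doteq> 0 * gE ^ l * e k" by (intro eqv_mult_right rel_Fl)
  finally show "pc Psi * e k \<doteq> 0 * e k" by simp
qed

text \<open>\<open>Qp k (C) e_k\<close> is \<open>E^(l-1) F^(l-1) e_k\<close>, so one more
  \<open>E\<close> annihilates it. In \<open>F_Qp\<close> the roles of \<open>E\<close> and
  \<open>F\<close> are exchanged.\<close>

lemma E_Qp: "gE * (pc (Qp k) * e k) \<doteq> 0"
proof -
  have "gE * (pc (Qp k) * e k) \<doteq> gE * (gE ^ (l - 1) * gF ^ (l - 1) * e k)"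
    unfolding Qp_alt by (intro eqv_mult_left eqv_sym[OF EF_pow_e])
  also have "\<dots> = gE ^ Suc (l - 1) * (gF ^ (l - 1) * e k)" by (simp only: power_Suc mult.assoc)
  also have "\<dots> \<doteq> 0 * (gF ^ (l - 1) * e k)" by (intro eqv_mult_right E_pow_ge) simp
  finally show ?thesis by simp
qed

lemma F_Qp: "gF * (pc (Qp (k - 2)) * e k) \<doteq> 0"
proof -
  have "gF * (pc (Qp (k - 2)) * e k) \<doteq> gF * (gF ^ (l - 1) * gE ^ (l - 1) * e k)"
    using eqv_mult_left[OF eqv_sym[OF FE_pow_e[of "l - 1" k]], of gF] by (simp add: Qp_def)
  also have "\<dots> = gF ^ Suc (l - 1) * (gE ^ (l - 1) * e k)" by (simp only: power_Suc mult.assoc)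
  also have "\<dots> \<doteq> 0 * (gE ^ (l - 1) * e k)" by (intro eqv_mult_right F_pow_ge) simp
  finally show ?thesis by simp
qed

section \<open>Elements commuting with K, and central elements\<close>

definition periodic :: "(int \<Rightarrow> 'a) \<Rightarrow> bool" where
  "periodic f \<longleftrightarrow> (\<forall>k k'. int l dvd k - k' \<longrightarrow> f k = f k')"

lemma periodicD: "periodic f \<Longrightarrow> int l dvd k - k' \<Longrightarrow> f k = f k'"
  by (auto simp: periodic_def)

text \<open>Components are indexed by integers to make shifts such as \<open>k + 2\<close>
  available; for periodic \<open>f\<close> the choice of the representatives \<open>Res\<close> does
  not matter.\<close>

definition ev :: "(int \<Rightarrow> complex poly) \<Rightarrow> free_alg" where
  "ev f = (\<Sum>k\<in>Res. pc (f k) * e k)"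

lemma ev_shift: "periodic f \<Longrightarrow> (\<Sum>k\<in>Res. pc (f (k + a)) * e (k + a)) = ev f"
  unfolding ev_def by (rule sum_Res_shift[of "\<lambda>k. pc (f k) * e k"]) (metis periodicD e_cong)

lemma ev_E: "periodic f \<Longrightarrow> ev f * gE \<doteq> gE * (\<Sum>k\<in>Res. pc (f (k + 2)) * e k)"
proof -
  assume f: "periodic f"
  have "ev f * gE = (\<Sum>k\<in>Res. pc (f (k + 2)) * (e (k + 2) * gE))"
    unfolding ev_shift[OF f, of 2, symmetric] by (simp only: sum_distrib_right mult.assoc)
  also have "\<dots> \<doteq> (\<Sum>k\<in>Res. pc (f (k + 2)) * (gE * e k))"
    by (intro eqv_sum eqv_mult_left eqv_sym[OF E_e])
  also have "\<dots> = (\<Sum>k\<in>Res. pc (f (k + 2)) * gE * e k)" by (simp add: mult.assoc)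
  also have "\<dots> \<doteq> (\<Sum>k\<in>Res. gE * pc (f (k + 2)) * e k)"
    by (intro eqv_sum eqv_mult_right pc_comm)
  finally show ?thesis by (simp add: sum_distrib_left mult.assoc)
qed

lemma ev_F: "periodic f \<Longrightarrow> ev f * gF \<doteq> gF * (\<Sum>k\<in>Res. pc (f (k - 2)) * e k)"
proof -
  assume f: "periodic f"
  have "ev f * gF = (\<Sum>k\<in>Res. pc (f (k - 2)) * (e (k - 2) * gF))"
  proof -
    have "ev f = (\<Sum>k\<in>Res. pc (f (k - 2)) * e (k - 2))"
      using ev_shift[OF f, of "- 2"] by simp
    then show ?thesis by (simp only: sum_distrib_right mult.assoc)
  qed
  also have "\<dots> \<doteq> (\<Sum>k\<in>Res. pc (f (k - 2)) * (gF * e k))"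
    by (intro eqv_sum eqv_mult_left eqv_sym[OF F_e])
  also have "\<dots> = (\<Sum>k\<in>Res. pc (f (k - 2)) * gF * e k)" by (simp add: mult.assoc)
  also have "\<dots> \<doteq> (\<Sum>k\<in>Res. gF * pc (f (k - 2)) * e k)"
    by (intro eqv_sum eqv_mult_right pc_comm)
  finally show ?thesis by (simp add: sum_distrib_left mult.assoc)
qed

lemma ev_K: "ev f * gK \<doteq> gK * ev f"
proof -
  have "ev f * gK = (\<Sum>k\<in>Res. pc (f k) * (e k * gK))" by (simp add: ev_def sum_distrib_right mult.assoc)
  also have "\<dots> \<doteq> (\<Sum>k\<in>Res. pc (f k) * (w k \<cdot> e k))" by (intro eqv_sum eqv_mult_left e_K)
  also have "\<dots> \<doteq> (\<Sum>k\<in>Res. pc (f k) * (gK * e k))" by (intro eqv_sum eqv_mult_left eqv_sym[OF K_e])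
  also have "\<dots> = (\<Sum>k\<in>Res. pc (f k) * gK * e k)" by (simp add: mult.assoc)
  also have "\<dots> \<doteq> (\<Sum>k\<in>Res. gK * pc (f k) * e k)" by (intro eqv_sum eqv_mult_right pc_comm)
  finally show ?thesis by (simp add: ev_def sum_distrib_left mult.assoc)
qed

text \<open>Moving \<open>E\<close> through \<open>ev f\<close> shifts the components by 2, so the
  commutator is the sum of the \<open>t k\<close> times \<open>E Qp k (C) e_k\<close>, and these are
  0; likewise for \<open>F\<close>.\<close>

lemma ev_central:
  assumes f: "periodic f" and t: "\<And>k. f k - f (k + 2) = Polynomial.smult (t k) (Qp k)"
  shows "ev f * x \<doteq> x * ev f"
proof (rule commute_all)
  have "gE * ev f - gE * (\<Sum>k\<in>Res. pc (f (k + 2)) * e k) = (\<Sum>k\<in>Res. t k \<cdot> (gE * (pc (Qp k) * e k)))"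
    by (simp add: ev_def sum_distrib_left flip: sum_subtractf right_diff_distrib left_diff_distrib peval_diff t)
      (simp add: t peval_smult)
  also have "\<dots> \<doteq> (\<Sum>k\<in>Res. t k \<cdot> 0)" by (intro eqv_sum eqv_smul E_Qp)
  finally have "gE * ev f \<doteq> gE * (\<Sum>k\<in>Res. pc (f (k + 2)) * e k)"
    by (subst eqv_iff_diff) simp
  then show "ev f * gE \<doteq> gE * ev f" using ev_E[OF f] eqv_trans eqv_sym by blast
  have t': "f (k - 2) - f k = Polynomial.smult (t (k - 2)) (Qp (k - 2))" for k
    using t[of "k - 2"] by simp
  have "gF * (\<Sum>k\<in>Res. pc (f (k - 2)) * e k) - gF * ev f = (\<Sum>k\<in>Res. t (k - 2) \<cdot> (gF * (pc (Qp (k - 2)) * e k)))"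
    by (simp add: ev_def sum_distrib_left flip: sum_subtractf right_diff_distrib left_diff_distrib peval_diff)
      (simp add: t' peval_smult)
  also have "\<dots> \<doteq> (\<Sum>k\<in>Res. t (k - 2) \<cdot> 0)" by (intro eqv_sum eqv_smul F_Qp)
  finally have "gF * (\<Sum>k\<in>Res. pc (f (k - 2)) * e k) \<doteq> gF * ev f"
    by (subst eqv_iff_diff) simp
  then show "ev f * gF \<doteq> gF * ev f" using ev_F[OF f] eqv_trans by blast
  show "ev f * gK \<doteq> gK * ev f" by (rule ev_K)
qed

lemma ev_e: "j \<in> Res \<Longrightarrow> ev f * e j \<doteq> pc (f j) * e j"
proof -
  assume j: "j \<in> Res"
  have "ev f * e j = (\<Sum>k\<in>Res. pc (f k) * (e k * e j))"
    by (simp add: ev_def sum_distrib_right mult.assoc)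
  also have "\<dots> \<doteq> (\<Sum>k\<in>Res. pc (f k) * (if k = j then e j else 0))"
  proof (intro eqv_sum eqv_mult_left)
    fix k assume "k \<in> Res"
    show "e k * e j \<doteq> (if k = j then e j else 0)"
      using e_mult_e[of k j] unfolding l_dvd_Res[OF \<open>k \<in> Res\<close> j] .
  qed
  also have "\<dots> = (\<Sum>k\<in>Res. if k = j then pc (f j) * e j else 0)"
    by (intro sum.cong refl) auto
  also have "\<dots> = pc (f j) * e j" using j by (subst sum.delta) simp_all
  finally show ?thesis .
qed

lemma ev_const: "ev (\<lambda>k. f) = pc f"
  by (simp add: ev_def sum_e flip: sum_distrib_left)

lemma ev_add: "ev (\<lambda>k. f k + g k) = ev f + ev g"
  by (simp add: ev_def peval_add distrib_right sum.distrib)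

lemma ev_smult: "ev (\<lambda>k. Polynomial.smult c (f k)) = c \<cdot> ev f"
  by (simp add: ev_def peval_smult smul_sum_right)

text \<open>Modulo \<open>l\<close>, the monomial \<open>F^a E^c e_k\<close> changes the weight
  unless \<open>a = c\<close>, and \<open>F^a E^a e_k\<close> is a polynomial of degree
  \<open>a < l\<close> in \<open>C\<close>.\<close>

lemma e_x_e: "\<exists>f. degree f < l \<and> e k * x * e k \<doteq> pc f * e k"
proof (induction x rule: pbw_induct)
  case zero
  show ?case by (rule exI[of _ 0]) simp
next
  case (bas a c k')
  have "e k * bas a c k' * e k = e k * (gF ^ a * gE ^ c * (e k' * e k))" by (simp add: bas_def mult.assoc)
  also have "\<dots> \<doteq> e k * (gF ^ a * gE ^ c * (if int l dvd k' - k then e k else 0))"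
    by (intro eqv_mult_left e_mult_e)
  also have "\<dots> = (if int l dvd k' - k then e k * bas a c k else 0)" by (simp add: bas_def)
  finally have 1: "e k * bas a c k' * e k \<doteq> (if int l dvd k' - k then e k * bas a c k else 0)" .
  show ?case
  proof (cases "a = c")
    case True
    have "e k * bas a c k \<doteq> bas a c k" using e_bas[of k a c k] True by simp
    also have "\<dots> \<doteq> pc (P k a) * e k" unfolding bas_def True by (rule FE_pow_e)
    finally have 2: "e k * bas a c k \<doteq> pc (P k a) * e k" .
    show ?thesis
    proof (cases "int l dvd k' - k")
      case True
      then show ?thesis using eqv_trans[OF _ 2] 1 bas P_monic(1)[of k a] by (intro exI[of _ "P k a"]) simp
    next
      case False
      then show ?thesis using 1 by (intro exI[of _ 0]) simp
    qed
  next
    case False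
    have "\<not> int l dvd k - (k + 2 * int c - 2 * int a)"
    proof
      assume "int l dvd k - (k + 2 * int c - 2 * int a)"
      also have "k - (k + 2 * int c - 2 * int a) = 2 * (int a - int c)" by simp
      finally have "int l dvd int a - int c" unfolding l_dvd_double .
      then show False using l_dvd_Res[of "int a" "int c"] bas False by simp
    qed
    then have "e k * bas a c k \<doteq> 0" using e_bas[of k a c k] by (simp only: if_False)
    then have "e k * bas a c k' * e k \<doteq> 0" using eqv_trans[OF 1] by (cases "int l dvd k' - k") simp_all
    then show ?thesis by (intro exI[of _ 0]) simp
  qed
next
  case (add x y)
  then obtain f g where "degree f < l" "e k * x * e k \<doteq> pc f * e k" "degree g < l" "e k * y * e k \<doteq> pc g * e k"
    by blast
  then have "degree (f + g) < l" "e k * (x + y) * e k \<doteq> pc (f + g) * e k"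
    by (simp_all add: degree_add_less distrib_left distrib_right peval_add eqv_add)
  then show ?case by blast
next
  case (smul r x)
  then obtain f where "degree f < l" "e k * x * e k \<doteq> pc f * e k"
    by blast
  then have "degree (Polynomial.smult r f) < l" "e k * (r \<cdot> x) * e k \<doteq> pc (Polynomial.smult r f) * e k"
    by (simp_all add: peval_smult eqv_smul)
  then show ?case by blast
next
  case (eqv x y)
  then have "e k * y * e k \<doteq> e k * x * e k" by (intro eqv_mult_left eqv_mult_right)
  then show ?case using eqv(1) eqv_trans by blast
qed

lemma commute_K_ev:
  assumes "x * gK \<doteq> gK * x"
  obtains f where "periodic f" and "\<And>k. degree (f k) < l" and "x \<doteq> ev f"
proof -
  obtain f0 where f0: "\<And>k. degree (f0 k) < l" "\<And>k. e k * x * e k \<doteq> pc (f0 k) * e k"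
    using e_x_e[of _ x] by metis
  \<comment> \<open>The polynomials were chosen independently for each integer; passing to residues
    makes the family periodic.\<close>
  define f where "f k = f0 (k mod int l)" for k
  have "periodic f" by (simp add: periodic_def f_def mod_eq_dvd_iff[symmetric])
  moreover have "x \<doteq> ev f"
  proof -
    have c: "x * e k \<doteq> e k * x" for k
      using e_twist[of x 0 k] eqv_sym[OF assms] eqv_sym by simp
    have "x = (\<Sum>k\<in>Res. x * e k)" by (simp add: sum_e flip: sum_distrib_left)
    also have "\<dots> \<doteq> (\<Sum>k\<in>Res. x * (e k * e k))" by (intro eqv_sum eqv_mult_left eqv_sym[OF e_idem])
    also have "\<dots> = (\<Sum>k\<in>Res. (x * e k) * e k)" by (simp add: mult.assoc)
    also have "\<dots> \<doteq> (\<Sum>k\<in>Res. e k * x * e k)" by (intro eqv_sum eqv_mult_right c)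
    also have "\<dots> \<doteq> (\<Sum>k\<in>Res. pc (f0 k) * e k)" by (intro eqv_sum f0)
    also have "\<dots> = ev f" by (simp add: ev_def f_def)
    finally show ?thesis .
  qed
  ultimately show ?thesis using that[of f] f0(1) by (simp add: f_def)
qed

end

context quantum_integral
begin

text \<open>The \<open>P k m\<close> with \<open>m < l\<close> form a basis adapted to the integral:
  \<open>P k m (C) e_k\<close> is \<open>bas m m k\<close>, and only \<open>m = l - 1\<close> has
  degree \<open>l - 1\<close>.\<close>

lemma L_pc_e: "degree f < l \<Longrightarrow> L (pc f * e k) = coeff f (l - 1) * (L0 * w k / of_nat l)"
proof (induction f rule: poly_basis_induct[where N = l and b = "P k"])
  case (deg m)
  show ?case by (simp add: P_monic)
next
  case (basis m)
  have "L (pc (P k m) * e k) = L (bas m m k)"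
    unfolding bas_def by (rule L_eqv[OF eqv_sym[OF FE_pow_e]])
  also have "\<dots> = (if m = l - 1 then 1 else 0) * (L0 * w k / of_nat l)" by (simp add: L_bas)
  also have "(if m = l - 1 then 1 else 0) = coeff (P k m) (l - 1)"
    using P_monic[of k m] basis by (cases "m = l - 1") (simp_all add: coeff_eq_0)
  finally show ?case .
qed (simp_all add: peval_add peval_smult distrib_right L_simps mult.assoc add_divide_distrib)

text \<open>Independence of the powers of \<open>C\<close> below \<open>l\<close>, extracted from
  the nonvanishing of the integral.\<close>

lemma pc_e_eq_0:
  assumes "pc f * e k \<doteq> 0"
  shows "Psi dvd f"
proof (rule ccontr)
  assume "\<not> Psi dvd f"
  define r where "r = f mod Psi"
  have r: "r \<noteq> 0" "degree r < l"
    using \<open>\<not> Psi dvd f\<close> degree_mod_less[OF Psi_monic(2), of f] Psi_monic(1)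
    by (auto simp: r_def dvd_eq_mod_eq_0)
  have "pc r * e k \<doteq> 0"
  proof -
    have "f = Psi * (f div Psi) + r" by (simp add: r_def)
    then have "pc f * e k = pc Psi * (pc (f div Psi) * e k) + pc r * e k"
      by (metis peval_add peval_mult distrib_right mult.assoc)
    moreover have "pc Psi * (pc (f div Psi) * e k) \<doteq> 0"
      using eqv_mult_right[OF pc_Psi] by simp
    ultimately show ?thesis
      using eqv_diff[OF assms, of "pc Psi * (pc (f div Psi) * e k)" 0] by simp
  qed
  \<comment> \<open>The remainder is raised to degree exactly \<open>l - 1\<close>, the one
    coefficient that \<open>L_pc_e\<close> detects.\<close>
  define g where "g = monom 1 (l - 1 - degree r) * r"
  have deg: "degree g = l - 1"
    using r by (simp add: g_def degree_mult_eq degree_monom_eq)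
  have "lead_coeff g \<noteq> 0" using r by (simp add: g_def)
  then have "L (pc g * e k) \<noteq> 0"
    using L_pc_e[of g k] deg L0_nz l_ge by simp
  moreover have "pc g * e k \<doteq> 0"
    using eqv_mult_left[OF \<open>pc r * e k \<doteq> 0\<close>, of "pc (monom 1 (l - 1 - degree r))"]
    by (simp add: g_def peval_mult mult.assoc)
  ultimately show False using L_eqv[of "pc g * e k" 0] by (simp add: L_simps)
qed

text \<open>\<open>E\<close> annihilates the component of \<open>f k - f (k + 2)\<close> at weight
  \<open>k\<close>. Applying \<open>F\<close> multiplies this difference by
  \<open>X - gam k\<close>, so \<open>Psi\<close> divides the product and \<open>Qp k\<close> the
  difference; the degree bound leaves only a constant quotient.\<close>

lemma central_ev:
  assumes f: "periodic f" and deg: "\<And>k. degree (f k) < l" and c: "ev f * gE \<doteq> gE * ev f"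
  shows "\<exists>t. f k - f (k + 2) = Polynomial.smult t (Qp k)"
proof -
  have *: "\<exists>t. f k - f (k + 2) = Polynomial.smult t (Qp k)" if k: "k \<in> Res" for k
  proof -
    let ?d = "f k - f (k + 2)"
    have "gE * ev f \<doteq> gE * ev (\<lambda>k. f (k + 2))"
      using eqv_trans[OF eqv_sym[OF c] ev_E[OF f]] by (simp add: ev_def)
    from eqv_mult_right[OF this, of "e k"]
    have "gE * (ev f * e k) \<doteq> gE * (ev (\<lambda>k. f (k + 2)) * e k)"
      by (simp add: mult.assoc)
    then have "gE * (pc (f k) * e k) \<doteq> gE * (pc (f (k + 2)) * e k)"
      using eqv_mult_left[OF ev_e[OF k, of f], of gE] eqv_mult_left[OF ev_e[OF k, of "\<lambda>k. f (k + 2)"], of gE]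
      by (meson eqv_sym eqv_trans)
    then have "gE * (pc ?d * e k) \<doteq> 0"
      unfolding eqv_iff_diff[of "gE * (pc (f k) * e k)"]
      by (simp add: peval_diff left_diff_distrib right_diff_distrib)
    then have 1: "gF * (gE * (pc ?d * e k)) \<doteq> 0" using eqv_mult_left[of _ 0 gF] by simp
    have "pc ([:- gam k, 1:] * ?d) * e k = pc ?d * ((casimir - gam k \<cdot> 1) * e k)"
      by (simp only: mult.commute[of "[:- gam k, 1:]"] peval_mult pc_lin mult.assoc)
    also have "\<dots> \<doteq> pc ?d * (gF * gE * e k)" by (intro eqv_mult_left eqv_sym[OF FE_e])
    also have "\<dots> = (pc ?d * (gF * gE)) * e k" by (simp add: mult.assoc)
    also have "\<dots> \<doteq> (gF * gE * pc ?d) * e k" by (intro eqv_mult_right pc_comm)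
    also have "\<dots> = gF * (gE * (pc ?d * e k))" by (simp add: mult.assoc)
    also have "\<dots> \<doteq> 0" by (rule 1)
    finally have "Psi dvd [:- gam k, 1:] * ?d" by (rule pc_e_eq_0)
    then have "Qp k dvd ?d" unfolding Qp_Psi[of k, symmetric] by (subst (asm) dvd_mult_cancel_left) simp
    then obtain h where h: "?d = Qp k * h" by (auto simp: dvd_def)
    have "degree ?d < l" using deg by (intro degree_diff_less) simp_all
    have "degree h = 0"
    proof (cases "h = 0")
      case False
      then have "degree ?d = (l - 1) + degree h"
        unfolding h using Qp_monic by (subst degree_mult_eq) simp_all
      then show ?thesis using \<open>degree ?d < l\<close> by simp
    qed simp
    then obtain t where "h = [:t:]" by (rule degree_eq_zeroE)
    then have "?d = Polynomial.smult t (Qp k)" using h by simp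
    then show ?thesis by blast
  qed
  have "k mod int l \<in> Res" by simp
  from *[OF this] obtain t where t: "f (k mod int l) - f (k mod int l + 2) = Polynomial.smult t (Qp (k mod int l))"
    by blast
  have d: "int l dvd k - k mod int l" by (simp add: mod_eq_dvd_iff[symmetric])
  then have "f k = f (k mod int l)" "f (k + 2) = f (k mod int l + 2)"
    using periodicD[OF f] by simp_all
  then show ?thesis using t Qp_cong[OF d] by auto
qed

end

section \<open>The map J on twisted traces\<close>

lemma smul_single: "c \<cdot> Poly_Mapping.single w d = Poly_Mapping.single w (c * d)"
  by (simp add: smul_eq_map map_single)

definition slice_lift :: "(free_alg \<Rightarrow> complex) \<Rightarrow> free_alg2 \<Rightarrow> free_alg" where
  "slice_lift g x = (\<Sum>vw\<in>Poly_Mapping.keys x.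
     Poly_Mapping.single (snd vw) (Poly_Mapping.lookup x vw * g (Poly_Mapping.single (fst vw) 1)))"

lemma slice_lift_add: "slice_lift g (x + y) = slice_lift g x + slice_lift g y"
  unfolding slice_lift_def by (rule sum_keys_add) (simp_all add: single_add distrib_right)

lemma slice_lift_smul: "slice_lift g (c \<cdot> x) = c \<cdot> slice_lift g x"
  unfolding slice_lift_def
  by (rule sum_keys_smul[where F = "\<lambda>vw a. Poly_Mapping.single (snd vw) (a * g (Poly_Mapping.single (fst vw) 1))"])
    (simp_all add: smul_add_right smul_single mult.assoc)

lemma slice_lift_0: "slice_lift g 0 = 0"
  by (simp add: slice_lift_def)

lemma slice_lift_sum: "slice_lift g (\<Sum>i\<in>A. f i) = (\<Sum>i\<in>A. slice_lift g (f i))"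
  by (induction A rule: infinite_finite_induct) (simp_all add: slice_lift_0 slice_lift_add)

lemma slice_lift_tens:
  assumes "lin g"
  shows "slice_lift g (tens a b) = g a \<cdot> b"
proof (induction a rule: poly_mapping_span_induct)
  case (single v)
  show ?case
  proof (induction b rule: poly_mapping_span_induct)
    case (single w)
    show ?case
      by (simp add: tens_single) (simp add: slice_lift_def single_eq_smul[of w "g _"])
  qed (simp_all add: tens_add_right tens_smul_right slice_lift_0 slice_lift_add slice_lift_smul smul_add_right mult.commute)
qed (simp_all add: tens_add_left tens_smul_left slice_lift_0 slice_lift_add slice_lift_smul smul_add_left lin_simps[OF assms])

lemma slice_lift_lin2: "slice_lift (\<lambda>x. c * g x + d * h x) y = c \<cdot> slice_lift g y + d \<cdot> slice_lift h y"
  by (simp add: slice_lift_def smul_sum_right smul_single distrib_left single_add sum.distrib mult.left_commute)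

lemma tens_slice_jraw: "tens_slice l q p x = cls l q (slice_lift (\<lambda>y. p (cls l q y)) x)"
  by (simp add: tens_slice_def slice_lift_def case_prod_beta)

context small_quantum_group
begin

section \<open>The R-matrix in terms of weight idempotents\<close>

definition q_num :: "nat \<Rightarrow> complex" where "q_num s = (w (int s) - w (- int s)) / dq"

definition R_coeff :: "nat \<Rightarrow> complex" where
  "R_coeff m = q ^ (m * (m - 1) div 2) * (q - inverse q) ^ m / q_fact q m"

lemma q_num_nz:
  assumes "0 < s" "s < l"
  shows "q_num s \<noteq> 0"
proof
  assume "q_num s = 0"
  then have "w (int s) = w (- int s)" by (simp add: q_num_def)
  then have "int l dvd 2 * int s" by (simp add: w_eq_iff)
  then have "l dvd s" unfolding l_dvd_double of_nat_dvd_iff .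
  then show False using assms dvd_imp_le[of l s] by simp
qed

lemma q_fact_prod: "q_fact q m = (\<Prod>s = 1..m. q_num s)"
  by (simp add: q_fact_def q_num_def dq_def w_minus w_of_nat power_inverse)

lemma R_coeff_nz: "m < l \<Longrightarrow> R_coeff m \<noteq> 0"
  using q_num_nz dq_nz by (simp add: R_coeff_def q_fact_prod dq_def)

lemma R_coeff_Suc: "R_coeff (Suc m) = R_coeff m * w (int m) * dq / q_num (Suc m)"
proof -
  have "Suc m * (Suc m - 1) = m * (m - 1) + m * 2"
    by (cases m) (simp_all add: algebra_simps)
  then have "Suc m * (Suc m - 1) div 2 = m * (m - 1) div 2 + m"
    by (simp only: div_mult_self1 zero_neq_numeral[symmetric] not_False_eq_True)
  then show ?thesis
    by (simp add: R_coeff_def q_fact_prod dq_def w_of_nat power_add mult.commute)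
qed

text \<open>A product-to-sum formula; it brings differences of \<open>gam\<close> into the form in
  which the quantum integers of the R-matrix cancel.\<close>

lemma gam_diff: "gam (b + 2 * int s) - gam b = q_num s / dq * (w (b + int s + 1) - w (- (b + int s + 1)))"
proof -
  let ?s = "int s" and ?B = "b + int s + 1"
  have "(w ?s - w (- ?s)) * (w ?B - w (- ?B)) = w ?s * w ?B - w ?s * w (- ?B) - (w (- ?s) * w ?B - w (- ?s) * w (- ?B))"
    by (simp add: algebra_simps)
  also have "\<dots> = w (?s + ?B) - w (?s + - ?B) - (w (- ?s + ?B) - w (- ?s + - ?B))"
    by (simp only: w_add[symmetric])
  also have "?s + ?B = b + 2 * ?s + 1" by simp
  also have "?s + - ?B = - b - 1" by simp
  also have "- ?s + ?B = b + 1" by simp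
  also have "- ?s + - ?B = - (b + 2 * ?s) - 1" by simp
  finally show ?thesis
    by (simp add: gam_def q_num_def power2_eq_square diff_divide_distrib[symmetric] algebra_simps)
qed

definition Dmat :: free_alg2 where
  "Dmat = scal (1 / of_nat l) * (\<Sum>i<l. \<Sum>j<l. scal (inverse q ^ (2 * i * j)) * tens (gK ^ i) (gK ^ j))"

text \<open>Summing out either index turns that leg of the Cartan part into idempotents. Of the two
  forms, \<open>Dmat_2\<close> serves \<open>R12\<close> and \<open>Dmat_1\<close> serves
  \<open>R21\<close>: in both cases the leg to which the functional is applied carries the
  idempotent.\<close>

lemma Dmat_1: "Dmat = (\<Sum>i<l. tens (gK ^ i) (e (2 * int i)))"
proof -
  have "w (- (2 * int i) * int j) = inverse q ^ (2 * i * j)" for i j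
    by (simp add: w_minus power_inverse flip: w_of_nat)
  then show ?thesis
    by (simp add: Dmat_def e_def tens_sum_right tens_smul_right smul_sum_right flip: smul_def)
qed

lemma Dmat_2: "Dmat = (\<Sum>j<l. tens (e (2 * int j)) (gK ^ j))"
proof -
  have "w (- (2 * int j) * int i) = inverse q ^ (2 * i * j)" for i j
    by (simp add: w_minus power_inverse mult.commute mult.left_commute flip: w_of_nat)
  then show ?thesis
    unfolding Dmat_def
    by (subst sum.swap) (simp add: e_def tens_sum_left tens_smul_left smul_sum_right flip: smul_def)
qed

lemma R12_Dmat: "R12 l q = Dmat * (\<Sum>m<l. R_coeff m \<cdot> tens (gF ^ m) (gE ^ m))"
  by (simp add: R12_def Dmat_def R_coeff_def smul_def)

lemma R12_eq: "R12 l q = (\<Sum>j<l. \<Sum>m<l. R_coeff m \<cdot> tens (e (2 * int j) * gF ^ m) (gK ^ j * gE ^ m))"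
  unfolding R12_Dmat Dmat_2 by (simp add: sum_product tens_mult)

lemma R21_eq: "R21 l q = (\<Sum>i<l. \<Sum>m<l. R_coeff m \<cdot> tens (e (2 * int i) * gE ^ m) (gK ^ i * gF ^ m))"
proof -
  have "R12 l q = (\<Sum>i<l. \<Sum>m<l. R_coeff m \<cdot> tens (gK ^ i * gF ^ m) (e (2 * int i) * gE ^ m))"
    unfolding R12_Dmat Dmat_1 by (simp add: sum_product tens_mult)
  then show ?thesis
    by (simp add: R21_def tflip_sum tflip_smul tflip_tens flip: tflip_def)
qed

definition J_lift :: "(free_alg \<Rightarrow> complex) \<Rightarrow> free_alg" where
  "J_lift g = slice_lift g (R21 l q * R12 l q)"

lemma J_map_Jel: "J_map l q p = cl (J_lift (\<lambda>y. p (cl y)))"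
  by (simp add: J_map_def tens_slice_jraw J_lift_def)

lemma J_lift_sum:
  assumes "lin g"
  shows "J_lift g = (\<Sum>i<l. \<Sum>m<l. \<Sum>j<l. \<Sum>m'<l.
    (R_coeff m * R_coeff m' * g (e (2 * int i) * gE ^ m * (e (2 * int j) * gF ^ m'))) \<cdot>
      (gK ^ i * gF ^ m * (gK ^ j * gE ^ m')))"
  unfolding J_lift_def R12_eq R21_eq
  unfolding sum_distrib_right unfolding sum_distrib_left
  by (simp only: smul_mult_left smul_mult_right smul_smul tens_mult slice_lift_sum slice_lift_smul slice_lift_tens[OF assms]
      mult.commute[of "R_coeff _" "R_coeff _"])

end

section \<open>The image under J of a twisted trace\<close>

locale trace_form = small_quantum_group l q for l q +
  fixes t :: "free_alg \<Rightarrow> complex"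
  assumes dual_t: "dual t" and t_comm: "t (x * y) = t (y * x)"
begin

lemmas t_simps = lin_simps[OF dual_lin[OF dual_t]]

lemma t_eqv: "x \<doteq> y \<Longrightarrow> t x = t y"
  by (rule dual_eqv[OF dual_t])

text \<open>The traces that survive in the image under \<open>J\<close>; the weights are even
  because the idempotents in the R-matrix are \<open>e (2 i)\<close>.\<close>

definition tau :: "nat \<Rightarrow> int \<Rightarrow> complex" where
  "tau m i = t (gE ^ m * gF ^ m * e (2 * i))"

lemma tau_cong: "int l dvd i - i' \<Longrightarrow> tau m i = tau m i'"
proof -
  assume "int l dvd i - i'"
  then have "int l dvd 2 * (i - i')" by (rule dvd_mult)
  then have "e (2 * i) = e (2 * i')" by (intro e_cong) (simp add: right_diff_distrib)
  then show ?thesis by (simp add: tau_def)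
qed

lemma tau_pc: "tau m i = t (pc (P (2 * i - 2 * int m) m) * e (2 * i))"
  unfolding tau_def by (rule t_eqv[OF EF_pow_e])

text \<open>\<open>C - gam k\<close> is \<open>F E\<close> on weight \<open>k\<close> and
  \<open>E F\<close> on weight \<open>k + 2\<close>, and cyclicity carries one into the
  other.\<close>

lemma t_weight: "t (pc ([:- gam k, 1:] * h) * e k) = t (pc ([:- gam k, 1:] * h) * e (k + 2))"
proof -
  have "pc ([:- gam k, 1:] * h) * e k = pc h * ((casimir - gam k \<cdot> 1) * e k)"
    by (simp only: mult.commute[of "[:- gam k, 1:]"] peval_mult pc_lin mult.assoc)
  also have "\<dots> \<doteq> pc h * (gF * gE * e k)" by (intro eqv_mult_left eqv_sym[OF FE_e])
  also have "\<dots> = (pc h * gF) * (gE * e k)" by (simp add: mult.assoc)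
  finally have "t (pc ([:- gam k, 1:] * h) * e k) = t ((pc h * gF) * (gE * e k))" by (rule t_eqv)
  also have "\<dots> = t ((gE * e k) * (pc h * gF))" by (rule t_comm)
  also have "\<dots> = t (gE * (pc h * (e k * gF)))"
  proof (rule t_eqv)
    have "gE * e k * (pc h * gF) = gE * ((e k * pc h) * gF)" by (simp add: mult.assoc)
    also have "\<dots> \<doteq> gE * ((pc h * e k) * gF)" by (intro eqv_mult_left eqv_mult_right eqv_sym[OF pc_comm])
    finally show "gE * e k * (pc h * gF) \<doteq> gE * (pc h * (e k * gF))" by (simp add: mult.assoc)
  qed
  also have "\<dots> = t (pc h * (gE * gF * e (k + 2)))"
  proof (rule t_eqv)
    have "gE * (pc h * (e k * gF)) \<doteq> gE * (pc h * (gF * e (k + 2)))" by (intro eqv_mult_left e_F)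
    also have "\<dots> = gE * pc h * (gF * e (k + 2))" by (simp add: mult.assoc)
    also have "\<dots> \<doteq> pc h * gE * (gF * e (k + 2))" by (intro eqv_mult_right eqv_sym[OF pc_comm])
    finally show "gE * (pc h * (e k * gF)) \<doteq> pc h * (gE * gF * e (k + 2))" by (simp add: mult.assoc)
  qed
  also have "\<dots> = t (pc h * ((casimir - gam k \<cdot> 1) * e (k + 2)))"
    using EF_e[of "k + 2"] by (intro t_eqv eqv_mult_left) simp
  also have "pc h * ((casimir - gam k \<cdot> 1) * e (k + 2)) = pc ([:- gam k, 1:] * h) * e (k + 2)"
    by (simp only: mult.commute[of "[:- gam k, 1:]"] peval_mult pc_lin mult.assoc)
  finally show ?thesis .
qed

text \<open>By \<open>t_weight\<close> both traces can be taken at weight \<open>2 i\<close>. There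
  the two polynomials differ only in one linear factor, so their difference is a scalar times the
  polynomial of \<open>tau m i\<close>.\<close>

lemma tau_step: "tau (Suc m) (i + 1) - tau (Suc m) i = (gam (2 * i - 2 * int m - 2) - gam (2 * i)) * tau m i"
proof -
  let ?h = "P (2 * i - 2 * int m) m"
  have 1: "tau (Suc m) (i + 1) = t (pc ([:- gam (2 * i), 1:] * ?h) * e (2 * i))"
  proof -
    have "tau (Suc m) (i + 1) = t (pc (P (2 * (i + 1) - 2 * int (Suc m)) (Suc m)) * e (2 * (i + 1)))"
      by (rule tau_pc)
    also have "2 * (i + 1) - 2 * int (Suc m) = 2 * i - 2 * int m" by simp
    also have "P (2 * i - 2 * int m) (Suc m) = [:- gam (2 * i), 1:] * ?h"
      by (simp only: P_Suc diff_add_cancel mult.commute)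
    also have "2 * (i + 1) = 2 * i + 2" by simp
    finally show ?thesis unfolding t_weight .
  qed
  have 2: "tau (Suc m) i = t (pc ([:- gam (2 * i - 2 * int m - 2), 1:] * ?h) * e (2 * i))"
  proof -
    have "tau (Suc m) i = t (pc (P (2 * i - 2 * int (Suc m)) (Suc m)) * e (2 * i))" by (rule tau_pc)
    also have "2 * i - 2 * int (Suc m) = 2 * i - 2 * int m - 2" by simp
    also have "P (2 * i - 2 * int m - 2) (Suc m) = [:- gam (2 * i - 2 * int m - 2), 1:] * ?h"
      by (simp only: P_Suc_shift diff_add_cancel)
    finally show ?thesis .
  qed
  have "[:- gam (2 * i), 1:] * ?h - [:- gam (2 * i - 2 * int m - 2), 1:] * ?h =
      Polynomial.smult (gam (2 * i - 2 * int m - 2) - gam (2 * i)) ?h"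
    by (simp add: smult_diff_left)
  then show ?thesis
    unfolding 1 2 lin_diff[OF dual_lin[OF dual_t], symmetric] left_diff_distrib[symmetric] peval_diff[symmetric]
    by (simp add: peval_smult t_simps tau_pc)
qed

text \<open>A cyclic functional sees only weight zero, which forces \<open>m = m'\<close>; adjacent
  idempotents fix \<open>j\<close> modulo \<open>l\<close>. So the fourfold sum for \<open>J\<close>
  collapses to a double sum.\<close>

lemma t_slice:
  assumes "m < l" "m' < l"
  shows "t (gK * (e (2 * i) * gE ^ m * (e (2 * j) * gF ^ m'))) =
    (if int l dvd i - int m - j \<and> m = m' then w (2 * i) * tau m i else 0)"
proof -
  define r where "r = 2 * j + 2 * int m'"
  have "gK * (e (2 * i) * gE ^ m * (e (2 * j) * gF ^ m')) \<doteq>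
      gK * (gE ^ m * e (2 * i - 2 * int m) * (e (2 * j) * gF ^ m'))"
    using eqv_sym[OF Epow_e[of m "2 * i - 2 * int m"]] by (intro eqv_mult_left eqv_mult_right) simp
  also have "\<dots> = gK * (gE ^ m * (e (2 * i - 2 * int m) * e (2 * j) * gF ^ m'))" by (simp add: mult.assoc)
  also have "\<dots> \<doteq> gK * (gE ^ m * ((if int l dvd 2 * i - 2 * int m - 2 * j then e (2 * j) else 0) * gF ^ m'))"
    by (intro eqv_mult_left eqv_mult_right e_mult_e)
  also have "(int l dvd 2 * i - 2 * int m - 2 * j) = (int l dvd i - int m - j)"
    using l_dvd_double[of "i - int m - j"] by (simp add: algebra_simps)
  finally have 1: "gK * (e (2 * i) * gE ^ m * (e (2 * j) * gF ^ m')) \<doteq>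
      (if int l dvd i - int m - j then gK * (gE ^ m * (e (2 * j) * gF ^ m')) else 0)"
    by (cases "int l dvd i - int m - j") simp_all
  have "gK * (gE ^ m * (e (2 * j) * gF ^ m')) \<doteq> gK * (gE ^ m * (gF ^ m' * e r))"
    using eqv_sym[OF Fpow_e[of m' r]] by (intro eqv_mult_left) (simp add: r_def)
  also have "\<dots> \<doteq> gK * (gE ^ m * (gF ^ m' * (e r * e r)))"
    by (intro eqv_mult_left eqv_sym[OF e_idem])
  also have "\<dots> = (gK * (gE ^ m * gF ^ m' * e r)) * e r" by (simp add: mult.assoc)
  finally have "t (gK * (gE ^ m * (e (2 * j) * gF ^ m'))) = t ((gK * (gE ^ m * gF ^ m' * e r)) * e r)"
    by (rule t_eqv)
  also have "\<dots> = t (e r * (gK * (gE ^ m * gF ^ m' * e r)))" by (rule t_comm)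
  also have "\<dots> = t ((if int l dvd 2 * int m' - 2 * int m then w r \<cdot> (gE ^ m * gF ^ m' * e r) else 0))"
  proof (rule t_eqv)
    let ?s = "r - 2 * int m' + 2 * int m"
    have W: "gE ^ m * gF ^ m' * e r \<doteq> e ?s * (gE ^ m * gF ^ m')"
    proof -
      have "gE ^ m * gF ^ m' * e r = gE ^ m * (gF ^ m' * e r)" by (simp add: mult.assoc)
      also have "\<dots> \<doteq> gE ^ m * (e (r - 2 * int m') * gF ^ m')" by (intro eqv_mult_left Fpow_e)
      also have "\<dots> = gE ^ m * e (r - 2 * int m') * gF ^ m'" by (simp add: mult.assoc)
      also have "\<dots> \<doteq> e ?s * gE ^ m * gF ^ m'" by (intro eqv_mult_right Epow_e)
      finally show ?thesis by (simp add: mult.assoc)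
    qed
    have "e r * (gK * (gE ^ m * gF ^ m' * e r)) = e r * gK * (gE ^ m * gF ^ m' * e r)" by (simp add: mult.assoc)
    also have "\<dots> \<doteq> w r \<cdot> e r * (e ?s * (gE ^ m * gF ^ m'))" by (intro eqv_mult e_K W)
    also have "\<dots> = w r \<cdot> (e r * e ?s * (gE ^ m * gF ^ m'))" by (simp add: mult.assoc)
    also have "\<dots> \<doteq> w r \<cdot> ((if int l dvd r - ?s then e ?s else 0) * (gE ^ m * gF ^ m'))"
      by (intro eqv_smul eqv_mult_right e_mult_e)
    also have "r - ?s = 2 * int m' - 2 * int m" by simp
    also have "w r \<cdot> ((if int l dvd 2 * int m' - 2 * int m then e ?s else 0) * (gE ^ m * gF ^ m')) =
        (if int l dvd 2 * int m' - 2 * int m then w r \<cdot> (e ?s * (gE ^ m * gF ^ m')) else 0)"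
      by simp
    also have "\<dots> \<doteq> (if int l dvd 2 * int m' - 2 * int m then w r \<cdot> (gE ^ m * gF ^ m' * e r) else 0)"
      using eqv_smul[OF eqv_sym[OF W], of "w r"] by simp
    finally show "e r * (gK * (gE ^ m * gF ^ m' * e r)) \<doteq>
      (if int l dvd 2 * int m' - 2 * int m then w r \<cdot> (gE ^ m * gF ^ m' * e r) else 0)" .
  qed
  also have "(int l dvd 2 * int m' - 2 * int m) = (m = m')"
  proof -
    have "(int l dvd 2 * int m' - 2 * int m) = (int l dvd int m' - int m)"
      using l_dvd_double[of "int m' - int m"] by (simp add: algebra_simps)
    then show ?thesis using l_dvd_Res[of "int m'" "int m"] assms by auto
  qed
  finally have 2: "t (gK * (gE ^ m * (e (2 * j) * gF ^ m'))) =
      t (if m = m' then w r \<cdot> (gE ^ m * gF ^ m' * e r) else 0)" .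
  have 3: "w r * t (gE ^ m * gF ^ m * e r) = w (2 * i) * tau m i" if "int l dvd i - int m - j" "m = m'"
  proof -
    have "int l dvd (i - int m - j) * (- 2)" using that(1) by (rule dvd_mult2)
    also have "(i - int m - j) * (- 2) = r - 2 * i" using that(2) by (simp add: r_def algebra_simps)
    finally show ?thesis using e_cong[of r "2 * i"] by (simp add: tau_def w_eq_iff[symmetric])
  qed
  show ?thesis
    using t_eqv[OF 1] 2 3 by (simp add: t_simps split: if_splits)
qed

text \<open>The exponents of \<open>q\<close> collected from three places: the twist by
  \<open>K\<close> on weight \<open>2 i\<close>, then \<open>K^i\<close> on weight \<open>k\<close>,
  and \<open>K^(i-m)\<close> on weight \<open>k + 2 m\<close>.\<close>

definition ex :: "nat \<Rightarrow> int \<Rightarrow> int \<Rightarrow> int" where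
  "ex m k i = 2 * i + i * k + (i - int m) * (k + 2 * int m)"

definition A :: "nat \<Rightarrow> int \<Rightarrow> complex" where
  "A m k = (R_coeff m)\<^sup>2 * (\<Sum>i\<in>Res. w (ex m k i) * tau m i)"

text \<open>\<open>jf k\<close> is the component at \<open>e k\<close> of the image under \<open>J\<close> of the twisted form \<open>t (K x)\<close>.\<close>

definition jf :: "int \<Rightarrow> complex poly" where
  "jf k = (\<Sum>m<l. Polynomial.smult (A m k) (P k m))"

lemma J_lift_simp: "J_lift (\<lambda>x. t (gK * x)) = (\<Sum>i<l. \<Sum>m<l.
    ((R_coeff m)\<^sup>2 * (w (2 * int i) * tau m (int i))) \<cdot>
      (gK ^ i * gF ^ m * (gK ^ nat ((int i - int m) mod int l) * gE ^ m)))"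
proof -
  have "lin (\<lambda>x. t (gK * x))" by (rule lin_mult_left[OF dual_lin[OF dual_t]])
  note J_lift_sum[OF this]
  also have "(\<Sum>i<l. \<Sum>m<l. \<Sum>j<l. \<Sum>m'<l.
    (R_coeff m * R_coeff m' * t (gK * (e (2 * int i) * gE ^ m * (e (2 * int j) * gF ^ m')))) \<cdot>
      (gK ^ i * gF ^ m * (gK ^ j * gE ^ m'))) = (\<Sum>i<l. \<Sum>m<l.
    ((R_coeff m)\<^sup>2 * (w (2 * int i) * tau m (int i))) \<cdot>
      (gK ^ i * gF ^ m * (gK ^ nat ((int i - int m) mod int l) * gE ^ m)))"
  proof (intro sum.cong refl)
    fix i m assume i: "i \<in> {..<l}" and m: "m \<in> {..<l}"
    let ?j = "nat ((int i - int m) mod int l)"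
    let ?T = "\<lambda>j. (R_coeff m * R_coeff m * (w (2 * int i) * tau m (int i))) \<cdot> (gK ^ i * gF ^ m * (gK ^ j * gE ^ m))"
    have j: "?j < l" by (simp add: nat_less_iff)
    have "(\<Sum>j<l. \<Sum>m'<l. (R_coeff m * R_coeff m' * t (gK * (e (2 * int i) * gE ^ m * (e (2 * int j) * gF ^ m')))) \<cdot>
        (gK ^ i * gF ^ m * (gK ^ j * gE ^ m'))) = (\<Sum>j<l. \<Sum>m'<l. if m = m' then if j = ?j then ?T j else 0 else 0)"
    proof (intro sum.cong refl)
      fix j m' assume "j \<in> {..<l}" "m' \<in> {..<l}"
      then have "int l dvd int i - int m - int j \<longleftrightarrow> j = ?j"
        using l_dvd_Res[of "(int i - int m) mod int l" "int j"] by (auto simp: mod_eq_dvd_iff[symmetric])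
      then show "(R_coeff m * R_coeff m' * t (gK * (e (2 * int i) * gE ^ m * (e (2 * int j) * gF ^ m')))) \<cdot>
        (gK ^ i * gF ^ m * (gK ^ j * gE ^ m')) = (if m = m' then if j = ?j then ?T j else 0 else 0)"
        using t_slice[of m m' "int i" "int j"] m \<open>m' \<in> {..<l}\<close> by simp
    qed
    also have "\<dots> = (\<Sum>j<l. if j = ?j then ?T j else 0)"
      by (intro sum.cong refl, subst sum.delta') (use m in simp_all)
    also have "\<dots> = ?T ?j" by (subst sum.delta) (use j in simp_all)
    finally show "(\<Sum>j<l. \<Sum>m'<l. (R_coeff m * R_coeff m' * t (gK * (e (2 * int i) * gE ^ m * (e (2 * int j) * gF ^ m')))) \<cdot>
        (gK ^ i * gF ^ m * (gK ^ j * gE ^ m'))) = ((R_coeff m)\<^sup>2 * (w (2 * int i) * tau m (int i))) \<cdot>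
      (gK ^ i * gF ^ m * (gK ^ ?j * gE ^ m))" by (simp add: power2_eq_square)
  qed
  finally show ?thesis .
qed

lemma J_lift_term: "gK ^ i * gF ^ m * (gK ^ nat ((int i - int m) mod int l) * gE ^ m) * e k \<doteq>
  w (int i * k + (int i - int m) * (k + 2 * int m)) \<cdot> (pc (P k m) * e k)"
proof -
  let ?j = "nat ((int i - int m) mod int l)"
  have "gK ^ i * gF ^ m * (gK ^ ?j * gE ^ m) * e k = gK ^ i * gF ^ m * (gK ^ ?j * (gE ^ m * e k))"
    by (simp add: mult.assoc)
  also have "\<dots> \<doteq> gK ^ i * gF ^ m * (gK ^ ?j * (e (k + 2 * int m) * gE ^ m))"
    by (intro eqv_mult_left Epow_e)
  also have "\<dots> = gK ^ i * gF ^ m * (gK ^ ?j * e (k + 2 * int m) * gE ^ m)" by (simp add: mult.assoc)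
  also have "\<dots> \<doteq> gK ^ i * gF ^ m * (w (int ?j * (k + 2 * int m)) \<cdot> e (k + 2 * int m) * gE ^ m)"
    by (intro eqv_mult_left eqv_mult_right Kpow_e)
  also have "w (int ?j * (k + 2 * int m)) = w ((int i - int m) * (k + 2 * int m))"
  proof -
    have "int l dvd int ?j - (int i - int m)" by (simp add: mod_eq_dvd_iff[symmetric])
    then have "int l dvd (int ?j - (int i - int m)) * (k + 2 * int m)" by (rule dvd_mult2)
    then show ?thesis unfolding w_eq_iff left_diff_distrib .
  qed
  also have "gK ^ i * gF ^ m * (w ((int i - int m) * (k + 2 * int m)) \<cdot> e (k + 2 * int m) * gE ^ m) =
      w ((int i - int m) * (k + 2 * int m)) \<cdot> (gK ^ i * (gF ^ m * e (k + 2 * int m)) * gE ^ m)"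
    by (simp add: mult.assoc)
  also have "\<dots> \<doteq> w ((int i - int m) * (k + 2 * int m)) \<cdot> (gK ^ i * (e k * gF ^ m) * gE ^ m)"
    using Fpow_e[of m "k + 2 * int m"] by (intro eqv_smul eqv_mult_left eqv_mult_right) simp
  also have "\<dots> = w ((int i - int m) * (k + 2 * int m)) \<cdot> (gK ^ i * e k * gF ^ m * gE ^ m)"
    by (simp add: mult.assoc)
  also have "\<dots> \<doteq> w ((int i - int m) * (k + 2 * int m)) \<cdot> (w (int i * k) \<cdot> e k * gF ^ m * gE ^ m)"
    by (intro eqv_smul eqv_mult_right Kpow_e)
  also have "\<dots> = w (int i * k + (int i - int m) * (k + 2 * int m)) \<cdot> (e k * (gF ^ m * gE ^ m))"
    by (simp add: mult.assoc w_add mult.commute)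
  also have "\<dots> \<doteq> w (int i * k + (int i - int m) * (k + 2 * int m)) \<cdot> (bas m m k)"
    using eqv_sym[OF bas_weight[of m m k]] by (intro eqv_smul) simp
  also have "\<dots> \<doteq> w (int i * k + (int i - int m) * (k + 2 * int m)) \<cdot> (pc (P k m) * e k)"
    unfolding bas_def by (intro eqv_smul FE_pow_e)
  finally show ?thesis .
qed

lemma J_lift_ev: "J_lift (\<lambda>x. t (gK * x)) \<doteq> ev jf"
proof -
  let ?J = "J_lift (\<lambda>x. t (gK * x))"
  have "?J * e k \<doteq> pc (jf k) * e k" for k
  proof -
    have "?J * e k \<doteq> (\<Sum>i<l. \<Sum>m<l. ((R_coeff m)\<^sup>2 * (w (2 * int i) * tau m (int i))) \<cdot>
        w (int i * k + (int i - int m) * (k + 2 * int m)) \<cdot> (pc (P k m) * e k))"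
      unfolding J_lift_simp sum_distrib_right smul_mult_left by (intro eqv_sum eqv_smul J_lift_term)
    also have "\<dots> = (\<Sum>m<l. \<Sum>i<l. ((R_coeff m)\<^sup>2 * (w (ex m k (int i)) * tau m (int i))) \<cdot> (pc (P k m) * e k))"
      by (subst sum.swap) (simp add: ex_def w_add mult_ac)
    also have "\<dots> = pc (jf k) * e k"
      by (simp add: jf_def A_def sum_Res_nat sum_distrib_left peval_sum peval_smult sum_distrib_right smul_sum_left)
    finally show ?thesis .
  qed
  then have "(\<Sum>k\<in>Res. ?J * e k) \<doteq> (\<Sum>k\<in>Res. pc (jf k) * e k)" by (intro eqv_sum)
  then show ?thesis by (simp add: ev_def sum_e flip: sum_distrib_left)
qed

lemma A_cong: "int l dvd k - k' \<Longrightarrow> A m k = A m k'"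
proof -
  assume d: "int l dvd k - k'"
  have "w (ex m k i) = w (ex m k' i)" for i
  proof -
    have "ex m k i - ex m k' i = (k - k') * (2 * i - int m)" by (simp add: ex_def algebra_simps)
    then show ?thesis using d by (simp add: w_eq_iff)
  qed
  then show ?thesis by (simp add: A_def)
qed

lemma periodic_jf: "periodic jf"
  unfolding periodic_def
proof (intro allI impI)
  fix k k' assume d: "int l dvd k - k'"
  show "jf k = jf k'" unfolding jf_def A_cong[OF d] P_cong[OF d] ..
qed

text \<open>Summation by parts around the cycle of residues: \<open>tau_step\<close> replaces
  \<open>tau m\<close> by differences of \<open>tau (Suc m)\<close>, and shifting the index turns
  their weighted sum into a multiple of one sum \<open>T\<close>, to which
  \<open>A (Suc m) k\<close> is also proportional.\<close>

lemma A_step: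
  assumes m: "Suc m < l"
  shows "A m k - A m (k + 2) + (gam (k + 2 * int (Suc m)) - gam k) * A (Suc m) k = 0"
proof -
  let ?n = "q_num (Suc m)" and ?s = "k + int m + 2"
  have n: "?n \<noteq> 0" using q_num_nz[of "Suc m"] m by simp
  \<comment> \<open>\<open>y i\<close> is the midpoint of the exponents \<open>ex m k i\<close> and
    \<open>ex m (k + 2) i\<close>; so the difference of the two powers of \<open>q\<close> splits
    off exactly the factor that occurs in \<open>tau_step\<close>.\<close>
  define y where "y i = ex m k i + 2 * i - int m" for i
  define T where "T = (\<Sum>i\<in>Res. w (y i) * tau (Suc m) i)"
  have trm: "(w (ex m k i) - w (ex m (k + 2) i)) * tau m i =
      dq / ?n * (w (y i) * tau (Suc m) (i + 1) - w (y i) * tau (Suc m) i)" for i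
  proof -
    have "gam (2 * i - 2 * int m - 2) - gam (2 * i) = ?n / dq * (w (int m - 2 * i) - w (2 * i - int m))"
      using gam_diff[of "2 * i - 2 * int m - 2" "Suc m"] by (simp add: algebra_simps)
    then have tau: "tau (Suc m) (i + 1) - tau (Suc m) i = ?n / dq * (w (int m - 2 * i) - w (2 * i - int m)) * tau m i"
      by (simp only: tau_step)
    have "y i + (int m - 2 * i) = ex m k i" "y i + (2 * i - int m) = ex m (k + 2) i"
      by (simp_all add: y_def ex_def algebra_simps)
    then have "w (y i) * (w (int m - 2 * i) - w (2 * i - int m)) = w (ex m k i) - w (ex m (k + 2) i)"
      by (simp only: right_diff_distrib w_add[symmetric])
    then have "(w (ex m k i) - w (ex m (k + 2) i)) * tau m i =
        dq / ?n * (w (y i) * (?n / dq * (w (int m - 2 * i) - w (2 * i - int m)) * tau m i))"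
      using n by simp
    also have "\<dots> = dq / ?n * (w (y i) * (tau (Suc m) (i + 1) - tau (Suc m) i))"
      unfolding tau ..
    finally show ?thesis by (simp only: right_diff_distrib)
  qed
  \<comment> \<open>\<open>y\<close> is affine in \<open>i\<close> with slope \<open>2 ?s\<close>,
    so a shift of the index costs only a constant factor.\<close>
  have y_step: "w (y i) = w (- 2 * ?s) * w (y (i + 1))" for i
    unfolding w_add[symmetric] by (rule arg_cong[where f = w]) (simp add: y_def ex_def algebra_simps)
  have "(\<Sum>i\<in>Res. w (y i) * tau (Suc m) (i + 1)) = w (- 2 * ?s) * (\<Sum>i\<in>Res. w (y (i + 1)) * tau (Suc m) (i + 1))"
    unfolding sum_distrib_left mult.assoc[symmetric] y_step[symmetric] ..
  also have "(\<Sum>i\<in>Res. w (y (i + 1)) * tau (Suc m) (i + 1)) = T"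
    unfolding T_def
  proof (rule sum_Res_shift)
    fix i i' assume d: "int l dvd i - i'"
    have "y i - y i' = (i - i') * (2 * k + 2 * int m + 4)" by (simp add: y_def ex_def algebra_simps)
    then have "w (y i) = w (y i')" using d by (simp only: w_eq_iff dvd_mult2)
    then show "w (y i) * tau (Suc m) i = w (y i') * tau (Suc m) i'" using tau_cong[OF d] by simp
  qed
  finally have S: "(\<Sum>i\<in>Res. w (y i) * tau (Suc m) (i + 1)) = w (- 2 * ?s) * T" .
  have "A m k - A m (k + 2) = (R_coeff m)\<^sup>2 * (\<Sum>i\<in>Res. (w (ex m k i) - w (ex m (k + 2) i)) * tau m i)"
    by (simp only: A_def right_diff_distrib[symmetric] sum_subtractf[symmetric] left_diff_distrib[symmetric])
  also have "(\<Sum>i\<in>Res. (w (ex m k i) - w (ex m (k + 2) i)) * tau m i) = dq / ?n * (w (- 2 * ?s) * T - T)"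
    by (simp only: trm sum_distrib_left[symmetric] sum_subtractf S T_def[symmetric])
  finally have 1: "A m k - A m (k + 2) = (R_coeff m)\<^sup>2 * (dq / ?n * (w (- 2 * ?s) * T - T))" .
  have "w (ex (Suc m) k i) = w (- k - 3 * int m - 2) * w (y i)" for i
    unfolding w_add[symmetric] by (rule arg_cong[where f = w]) (simp add: y_def ex_def algebra_simps)
  then have 2: "A (Suc m) k = (R_coeff m * w (int m) * dq / ?n)\<^sup>2 * (w (- k - 3 * int m - 2) * T)"
    unfolding A_def R_coeff_Suc T_def by (simp only: sum_distrib_left mult.assoc)
  have 3: "gam (k + 2 * int (Suc m)) - gam k = ?n / dq * (w ?s - w (- ?s))"
  proof -
    have "k + int (Suc m) + 1 = ?s" by simp
    then show ?thesis unfolding gam_diff by (simp only:)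
  qed
  have 4: "(w (int m))\<^sup>2 * w (- k - 3 * int m - 2) * (w ?s - w (- ?s)) = 1 - w (- 2 * ?s)"
  proof -
    have "int m + int m + (- k - 3 * int m - 2) + ?s = 0"
      "int m + int m + (- k - 3 * int m - 2) + - ?s = - 2 * ?s" by simp_all
    then show ?thesis
      unfolding power2_eq_square right_diff_distrib w_add[symmetric] by (simp only: w_0)
  qed
  have alg: "?n / dq * D * ((r * v * dq / ?n)\<^sup>2 * (W * T)) = r\<^sup>2 * (dq / ?n) * T * (v\<^sup>2 * W * D)" for D r v W :: complex
    using n by (simp add: power2_eq_square field_simps)
  have "(gam (k + 2 * int (Suc m)) - gam k) * A (Suc m) k = (R_coeff m)\<^sup>2 * (dq / ?n) * T * (1 - w (- 2 * ?s))"
    unfolding 2 3 alg 4 ..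
  also have "\<dots> = - (A m k - A m (k + 2))"
    unfolding 1 by (simp only: right_diff_distrib mult_1_right minus_diff_eq) (simp only: mult_ac)
  finally show ?thesis by simp
qed

text \<open>Rewriting \<open>jf k\<close> in the basis \<open>P (k + 2) m\<close> produces a
  neighbouring term for each \<open>m\<close>; by \<open>A_step\<close> all coefficients of the
  difference cancel except the one at \<open>m = l - 1\<close>, where
  \<open>P (k + 2) (l - 1)\<close> is \<open>Qp k\<close>.\<close>

lemma jf_step: "jf k - jf (k + 2) = Polynomial.smult (A (l - 1) k - A (l - 1) (k + 2)) (Qp k)"
proof -
  define l' where "l' = l - 1"
  have l: "Suc l' = l" by (simp add: l'_def)
  have first: "(\<Sum>m<l. h m) = h 0 + (\<Sum>m<l'. h (Suc m))" for h :: "nat \<Rightarrow> complex poly"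
    using sum.lessThan_Suc_shift[of h l'] by (simp only: l)
  have last: "(\<Sum>m<l. h m) = (\<Sum>m<l'. h m) + h l'" for h :: "nat \<Rightarrow> complex poly"
    using sum.lessThan_Suc[of h l'] by (simp only: l)
  have P: "P k (Suc m) = P (k + 2) (Suc m) + Polynomial.smult (gam (k + 2 * int (Suc m)) - gam k) (P (k + 2) m)" for m
  proof -
    have "P k (Suc m) - P (k + 2) (Suc m) = ([:- gam k, 1:] - [:- gam (k + 2 * int (Suc m)), 1:]) * P (k + 2) m"
      unfolding P_Suc_shift[of k] P_Suc[of "k + 2"] left_diff_distrib
      by (simp only: mult.commute[of "P (k + 2) m"]) (simp add: algebra_simps)
    then show ?thesis by (simp add: algebra_simps)
  qed
  have "jf k = Polynomial.smult (A 0 k) (P k 0) + (\<Sum>m<l'. Polynomial.smult (A (Suc m) k) (P k (Suc m)))"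
    unfolding jf_def by (rule first)
  also have "\<dots> = Polynomial.smult (A 0 k) (P (k + 2) 0) + (\<Sum>m<l'. Polynomial.smult (A (Suc m) k) (P (k + 2) (Suc m)))
      + (\<Sum>m<l'. Polynomial.smult ((gam (k + 2 * int (Suc m)) - gam k) * A (Suc m) k) (P (k + 2) m))"
    unfolding P by (simp add: smult_add_right sum.distrib mult.commute)
  also have "\<dots> = (\<Sum>m<l. Polynomial.smult (A m k) (P (k + 2) m))
      + (\<Sum>m<l'. Polynomial.smult ((gam (k + 2 * int (Suc m)) - gam k) * A (Suc m) k) (P (k + 2) m))"
    unfolding first by simp
  finally have "jf k - jf (k + 2) = (\<Sum>m<l. Polynomial.smult (A m k - A m (k + 2)) (P (k + 2) m))
      + (\<Sum>m<l'. Polynomial.smult ((gam (k + 2 * int (Suc m)) - gam k) * A (Suc m) k) (P (k + 2) m))"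
    by (simp add: jf_def[of "k + 2"] smult_diff_left sum_subtractf)
  also have "\<dots> = (\<Sum>m<l'. Polynomial.smult (A m k - A m (k + 2) + (gam (k + 2 * int (Suc m)) - gam k) * A (Suc m) k)
      (P (k + 2) m)) + Polynomial.smult (A l' k - A l' (k + 2)) (P (k + 2) l')"
    unfolding last by (simp add: smult_add_left sum.distrib)
  also have "(\<Sum>m<l'. Polynomial.smult (A m k - A m (k + 2) + (gam (k + 2 * int (Suc m)) - gam k) * A (Suc m) k)
      (P (k + 2) m)) = 0"
    using A_step by (intro sum.neutral) (simp add: l'_def)
  finally show ?thesis by (simp add: l'_def Qp_def)
qed

lemma J_lift_central: "J_lift (\<lambda>x. t (gK * x)) * x \<doteq> x * J_lift (\<lambda>x. t (gK * x))"
proof -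
  have "J_lift (\<lambda>x. t (gK * x)) * x \<doteq> ev jf * x" by (intro eqv_mult_right J_lift_ev)
  also have "\<dots> \<doteq> x * ev jf" by (rule ev_central[OF periodic_jf jf_step])
  also have "\<dots> \<doteq> x * J_lift (\<lambda>x. t (gK * x))" by (intro eqv_mult_left eqv_sym[OF J_lift_ev])
  finally show ?thesis .
qed

end

section \<open>The decomposition of the center\<close>

lemma R_r_E:
  assumes "r \<in> R_r l q"
  obtains P c where "finite P" "P \<subseteq> {K_trace l q \<rho> | n \<rho>. simple_module l q n \<rho>}"
    "r = (\<lambda>a\<in>carrier (U l q). \<Sum>p\<in>P. c p * p a)"
  using assms unfolding R_r_def by blast

context small_quantum_group
begin

lemma wt_cong: "int l dvd k - k' \<Longrightarrow> wt n k = wt n k'"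
proof -
  assume d: "int l dvd k - k'"
  have "int l dvd k - (int n - 2 * int j) \<longleftrightarrow> int l dvd k' - (int n - 2 * int j)" for j
  proof -
    have "k - (int n - 2 * int j) = (k - k') + (k' - (int n - 2 * int j))" by simp
    then show ?thesis by (simp only: dvd_add_right_iff[OF d])
  qed
  then show ?thesis by (simp add: wt_def)
qed

lemma wt_minus: "wt n (- k) = wt n k"
proof -
  have "wt n k" if k: "wt n (- k)" for k
  proof -
    obtain j where j: "j \<le> n" "int l dvd - k - (int n - 2 * int j)" using k by (auto simp: wt_def)
    have "k - (int n - 2 * int (n - j)) = - (- k - (int n - 2 * int j))"
      using j(1) by (simp add: of_nat_diff)
    then have "int l dvd k - (int n - 2 * int (n - j))" using j(2) by (simp only: dvd_minus_iff)
    then show ?thesis unfolding wt_def by (intro exI[of _ "n - j"]) simp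
  qed
  from this[of k] this[of "- k"] show ?thesis by auto
qed

lemma poly_P: "poly (P k m) x = (\<Prod>s<m. x - gam (k + 2 * int s))"
  by (simp add: P_def poly_prod)

text \<open>\<open>E^m F^m\<close> has nonzero trace only as long as \<open>F^m\<close> is nonzero
  on the weight vector: never for \<open>m > n\<close>, and for \<open>m = n\<close> on the highest
  weight vector alone. There the exponent \<open>ex n k i\<close> depends on \<open>k\<close> only
  through a multiple of \<open>2 i - n\<close>, which is 0 modulo \<open>l\<close>, so the
  \<open>n\<close>-th coefficient is constant in \<open>k\<close> and, by \<open>jf_step\<close>, so
  is the whole polynomial.\<close>

lemma J_lift_rho:
  assumes n: "n < l"
  shows "\<exists>f. f \<noteq> 0 \<and> degree f = n \<and> J_lift (\<lambda>x. tr n (gK * x)) \<doteq> pc f"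
proof -
  interpret t: trace_form l q "tr n"
    by unfold_locales (use dual_tr[OF n] tr_comm in auto)
  have tau: "t.tau m i = (if wt n (2 * i) then (\<Prod>s<m. gam (int n) - gam (2 * i - 2 * int m + 2 * int s)) else 0)" for m i
    by (simp add: t.tau_pc tr_pc_e[OF n] poly_P)
  have tau_0: "t.tau m i = 0" if "j \<le> n" "int l dvd 2 * i - (int n - 2 * int j)" "n - j < m" for m i j
  proof -
    \<comment> \<open>The factor with this index sits at the weight \<open>- n - 2\<close> just
      below the lowest one, where \<open>gam\<close> takes the value \<open>gam n\<close>
      again.\<close>
    define s where "s = m - (n - j + 1)"
    have s: "s < m" using that by (simp add: s_def)
    have eq: "2 * i - 2 * int m + 2 * int s - (- int n - 2) = 2 * i - (int n - 2 * int j)"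
      using that by (simp add: s_def of_nat_diff)
    have "gam (2 * i - 2 * int m + 2 * int s) = gam (- int n - 2)"
      by (rule gam_cong) (simp only: eq that(2))
    then have "gam (int n) - gam (2 * i - 2 * int m + 2 * int s) = 0"
      by (simp add: gam_reflect)
    then have "(\<Prod>s<m. gam (int n) - gam (2 * i - 2 * int m + 2 * int s)) = 0"
      using s by (intro prod_zero) auto
    then show ?thesis by (simp add: tau)
  qed
  have tau_gt: "t.tau m i = 0" if "n < m" for m i
  proof (cases "wt n (2 * i)")
    case True
    then obtain j where "j \<le> n" "int l dvd 2 * i - (int n - 2 * int j)" by (auto simp: wt_def)
    then show ?thesis by (rule tau_0) (use that in simp)
  qed (simp add: tau)
  have tau_n0: "t.tau n i = 0" if "\<not> int l dvd 2 * i - int n" for i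
  proof (cases "wt n (2 * i)")
    case True
    then obtain j where j: "j \<le> n" "int l dvd 2 * i - (int n - 2 * int j)" by (auto simp: wt_def)
    have "j \<noteq> 0"
    proof
      assume "j = 0"
      then have "int l dvd 2 * i - int n" using j(2) by simp
      then show False using that by simp
    qed
    then show ?thesis using j by (intro tau_0[OF j]) simp
  qed (simp add: tau)
  obtain i1 :: nat where i1: "int l dvd int n - 2 * int i1" using ex_double by blast
  \<comment> \<open>Half of \<open>n\<close> modulo \<open>l\<close>: the one index for which
    \<open>e (2 i)\<close> projects to the highest weight vector.\<close>
  define i0 where "i0 = int i1 mod int l"
  have i0: "i0 \<in> Res" by (simp add: i0_def)
  have i0d: "int l dvd 2 * i0 - int n"
  proof -
    have "2 * i0 - int n = - (int n - 2 * int i1) - int l * (2 * (int i1 div int l))"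
      by (simp add: i0_def minus_mult_div_eq_mod[symmetric] algebra_simps)
    then show ?thesis using i1 by (simp only: dvd_diff dvd_minus_iff dvd_triv_left)
  qed
  have tau_nz: "t.tau n i0 \<noteq> 0"
  proof -
    have "wt n (2 * i0)" unfolding wt_def using i0d by (intro exI[of _ 0]) simp
    moreover have "gam (int n) - gam (2 * i0 - 2 * int n + 2 * int s) \<noteq> 0" if "s < n" for s
    proof -
      have eq: "2 * i0 - 2 * int n + 2 * int s - (int n - 2 * int (n - s)) = 2 * i0 - int n"
        using that by (simp add: of_nat_diff)
      have "gam (2 * i0 - 2 * int n + 2 * int s) = gam (int n - 2 * int (n - s))"
        by (rule gam_cong) (simp only: eq i0d)
      then show ?thesis using gam_ne[OF n, of "n - s"] that by simp
    qed
    ultimately show ?thesis by (simp add: tau)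
  qed
  have A_n: "t.A n k = (R_coeff n)\<^sup>2 * (w (t.ex n k i0) * t.tau n i0)" for k
  proof -
    have "(\<Sum>i\<in>Res. w (t.ex n k i) * t.tau n i) = (\<Sum>i\<in>{i0}. w (t.ex n k i) * t.tau n i)"
    proof (rule sum.mono_neutral_right)
      show "\<forall>i\<in>Res - {i0}. w (t.ex n k i) * t.tau n i = 0"
      proof
        fix i assume i: "i \<in> Res - {i0}"
        have "\<not> int l dvd 2 * i - int n"
        proof
          assume "int l dvd 2 * i - int n"
          from dvd_diff[OF this i0d] have "int l dvd 2 * (i - i0)" by (simp add: right_diff_distrib)
          then have "int l dvd i - i0" unfolding l_dvd_double .
          then show False using i l_dvd_Res[OF _ i0, of i] by simp
        qed
        then have "t.tau n i = 0" by (rule tau_n0)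
        then show "w (t.ex n k i) * t.tau n i = 0" by simp
      qed
    qed (use i0 in simp_all)
    then show ?thesis by (simp add: t.A_def)
  qed
  have A_n_const: "t.A n k = t.A n k'" for k k'
  proof -
    have "t.ex n k i0 - t.ex n k' i0 = (2 * i0 - int n) * (k - k')"
      by (simp add: t.ex_def algebra_simps)
    then have "w (t.ex n k i0) = w (t.ex n k' i0)"
      unfolding w_eq_iff using i0d by (simp only: dvd_mult2)
    then show ?thesis by (simp add: A_n)
  qed
  have A_n_nz: "t.A n k \<noteq> 0" for k
    using R_coeff_nz[OF n] tau_nz by (simp add: A_n)
  have A_gt: "t.A m k = 0" if "n < m" for m k
    using tau_gt[OF that] by (simp add: t.A_def)
  \<comment> \<open>The obstruction in \<open>jf_step\<close>: for \<open>n = l - 1\<close> it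
    vanishes because the coefficient is constant, and for smaller \<open>n\<close> because both
    coefficients are 0.\<close>
  have "t.A (l - 1) k = t.A (l - 1) (k + 2)" for k
  proof (cases "n = l - 1")
    case True
    then show ?thesis using A_n_const by blast
  next
    case False
    then show ?thesis using n A_gt[of "l - 1"] by simp
  qed
  then have step: "t.jf k = t.jf (k + 2)" for k
    using t.jf_step[of k] by simp
  have even: "t.jf (2 * int i) = t.jf 0" for i
    by (induction i) (use step[of "2 * int _"] in \<open>simp_all add: algebra_simps\<close>)
  have const: "t.jf k = t.jf 0" for k
  proof -
    obtain i where "int l dvd k - 2 * int i" using ex_double by blast
    then show ?thesis using even[of i] periodicD[OF t.periodic_jf, of k "2 * int i"] by simp
  qed
  have "t.jf = (\<lambda>k. t.jf 0)" using const by blast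
  then have J: "J_lift (\<lambda>x. tr n (gK * x)) \<doteq> pc (t.jf 0)"
    using t.J_lift_ev ev_const[of "t.jf 0"] by metis
  have co: "coeff (t.jf 0) n = t.A n 0"
  proof -
    have "coeff (t.jf 0) n = (\<Sum>m<l. t.A m 0 * coeff (P 0 m) n)" by (simp add: t.jf_def coeff_sum)
    also have "\<dots> = (\<Sum>m\<in>{n}. t.A m 0 * coeff (P 0 m) n)"
    proof (rule sum.mono_neutral_right)
      show "\<forall>m\<in>{..<l} - {n}. t.A m 0 * coeff (P 0 m) n = 0"
      proof
        fix m assume "m \<in> {..<l} - {n}"
        then consider "m < n" | "n < m" by force
        then show "t.A m 0 * coeff (P 0 m) n = 0"
          by cases (simp_all add: A_gt coeff_eq_0 P_monic)
      qed
    qed (use n in simp_all)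
    also have "coeff (P 0 n) n = 1" using P_monic[of 0 n] by simp
    then have "(\<Sum>m\<in>{n}. t.A m 0 * coeff (P 0 m) n) = t.A n 0" by simp
    finally show ?thesis .
  qed
  have "degree (t.jf 0) \<le> n"
    unfolding t.jf_def
  proof (rule degree_sum_le)
    fix m assume "m \<in> {..<l}"
    show "degree (Polynomial.smult (t.A m 0) (P 0 m)) \<le> n"
    proof (cases "n < m")
      case False
      then show ?thesis using degree_smult_le[of "t.A m 0" "P 0 m"] by (simp add: P_monic)
    qed (simp add: A_gt)
  qed simp
  moreover have "n \<le> degree (t.jf 0)" using co A_n_nz by (intro le_degree) simp
  ultimately show ?thesis using J co A_n_nz by (intro exI[of _ "t.jf 0"]) auto
qed

section \<open>The span of the twisted traces\<close>

definition in_R_r :: "(free_alg \<Rightarrow> complex) \<Rightarrow> bool" where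
  "in_R_r g \<longleftrightarrow> (\<exists>r\<in>R_r l q. \<forall>x. r (cl x) = g x)"

lemma in_R_r_lin2:
  assumes "in_R_r g" "in_R_r h"
  shows "in_R_r (\<lambda>x. c * g x + d * h x)"
proof -
  obtain r where r: "r \<in> R_r l q" "\<And>x. r (cl x) = g x" using assms(1) by (auto simp: in_R_r_def)
  obtain r' where r': "r' \<in> R_r l q" "\<And>x. r' (cl x) = h x" using assms(2) by (auto simp: in_R_r_def)
  obtain P a where P: "finite P" "P \<subseteq> {K_trace l q \<rho> | n \<rho>. simple_module l q n \<rho>}"
    "r = (\<lambda>x\<in>carrier (U l q). \<Sum>p\<in>P. a p * p x)" using R_r_E[OF r(1)] .
  obtain P' a' where P': "finite P'" "P' \<subseteq> {K_trace l q \<rho> | n \<rho>. simple_module l q n \<rho>}"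
    "r' = (\<lambda>x\<in>carrier (U l q). \<Sum>p\<in>P'. a' p * p x)" using R_r_E[OF r'(1)] .
  define b where "b p = c * (if p \<in> P then a p else 0) + d * (if p \<in> P' then a' p else 0)" for p
  have "(\<Sum>p\<in>P \<union> P'. b p * p (cl x)) = c * g x + d * h x" for x
  proof -
    have 1: "(\<Sum>p\<in>P \<union> P'. (if p \<in> P then a p else 0) * p (cl x)) = g x"
      unfolding r(2)[symmetric] P(3)
      by (simp add: sum.mono_neutral_cong_right[OF _ Un_upper1] P(1) P'(1))
    have 2: "(\<Sum>p\<in>P \<union> P'. (if p \<in> P' then a' p else 0) * p (cl x)) = h x"
      unfolding r'(2)[symmetric] P'(3)
      by (simp add: sum.mono_neutral_cong_right[OF _ Un_upper2] P(1) P'(1))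
    have "(\<Sum>p\<in>P \<union> P'. b p * p (cl x)) =
        c * (\<Sum>p\<in>P \<union> P'. (if p \<in> P then a p else 0) * p (cl x)) +
        d * (\<Sum>p\<in>P \<union> P'. (if p \<in> P' then a' p else 0) * p (cl x))"
      unfolding b_def by (simp only: distrib_right sum.distrib sum_distrib_left mult.assoc)
    then show ?thesis unfolding 1 2 .
  qed
  moreover have "(\<lambda>x\<in>carrier (U l q). \<Sum>p\<in>P \<union> P'. b p * p x) \<in> R_r l q"
    unfolding R_r_def using P(1,2) P'(1,2) by (intro CollectI exI[of _ "P \<union> P'"] exI[of _ b]) auto
  ultimately show ?thesis unfolding in_R_r_def by (intro bexI) auto
qed

lemma in_R_r_smul: "in_R_r g \<Longrightarrow> in_R_r (\<lambda>x. c * g x)"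
  using in_R_r_lin2[of g g c 0] by simp

lemma in_R_r_add: "in_R_r g \<Longrightarrow> in_R_r h \<Longrightarrow> in_R_r (\<lambda>x. g x + h x)"
  using in_R_r_lin2[of g h 1 1] by simp

lemma in_R_r_tr:
  assumes n: "n < l"
  shows "in_R_r (\<lambda>x. tr n (gK * x))"
proof -
  have "(\<lambda>a\<in>carrier (U l q). \<Sum>p\<in>{K_trace l q (rho n)}. (1 :: complex) * p a) \<in> R_r l q"
    unfolding R_r_def using simple_rho[OF n]
    by (intro CollectI exI[of _ "{K_trace l q (rho n)}"] exI[of _ "\<lambda>p. 1"]) auto
  then show ?thesis
    unfolding in_R_r_def by (rule rev_bexI) (simp add: K_trace_rho[OF n])
qed

lemma in_R_r_0: "in_R_r (\<lambda>x. 0)"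
  using in_R_r_smul[OF in_R_r_tr[of 0], of 0] by simp

text \<open>Reduces statements about the span over all simple modules to cyclic functionals composed
  with multiplication by \<open>K\<close>.\<close>

lemma in_R_r_induct [consumes 1, case_names zero add trace]:
  assumes g: "in_R_r g" and zero: "Q (\<lambda>x. 0)"
    and add: "\<And>g h c. Q g \<Longrightarrow> Q h \<Longrightarrow> Q (\<lambda>x. c * g x + h x)"
    and trace: "\<And>t. dual t \<Longrightarrow> (\<And>x y. t (x * y) = t (y * x)) \<Longrightarrow> Q (\<lambda>x. t (gK * x))"
  shows "Q g"
proof -
  obtain r where r: "r \<in> R_r l q" "\<And>x. r (cl x) = g x" using g by (auto simp: in_R_r_def)
  obtain P a where P: "finite P" "P \<subseteq> {K_trace l q \<rho> | n \<rho>. simple_module l q n \<rho>}"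
    "r = (\<lambda>x\<in>carrier (U l q). \<Sum>p\<in>P. a p * p x)" using R_r_E[OF r(1)] .
  have "Q (\<lambda>x. \<Sum>p\<in>P. a p * p (cl x))"
    using P(1,2)
  proof (induction P rule: finite_induct)
    case (insert p P)
    then obtain n \<rho> where p: "p = K_trace l q \<rho>" "simple_module l q n \<rho>" by auto
    obtain t where "dual t" "\<And>x y. t (x * y) = t (y * x)" and t: "\<And>x. K_trace l q \<rho> (cl x) = t (gK * x)"
      using simple_module_trace[OF p(2)] by blast
    then have "Q (\<lambda>x. t (gK * x))" by (intro trace)
    then have "Q (\<lambda>x. p (cl x))" using t p(1) by simp
    then have "Q (\<lambda>x. a p * p (cl x) + (\<Sum>p\<in>P. a p * p (cl x)))"
      using insert by (intro add) auto
    then show ?case using insert by simp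
  qed (use zero in simp)
  moreover have "(\<lambda>x. \<Sum>p\<in>P. a p * p (cl x)) = g"
    using r(2) P(3) by auto
  ultimately show ?thesis by simp
qed

lemma Z_tilde_iff: "cl x \<in> Z_tilde l q \<longleftrightarrow> (\<exists>g. in_R_r g \<and> J_lift g \<doteq> x)"
proof
  assume "cl x \<in> Z_tilde l q"
  then obtain r where r: "r \<in> R_r l q" "cl x = J_map l q r" by (auto simp: Z_tilde_def)
  then have "J_lift (\<lambda>y. r (cl y)) \<doteq> x" by (simp add: J_map_Jel cls_eq_iff eqv_sym)
  moreover have "in_R_r (\<lambda>y. r (cl y))" using r(1) by (auto simp: in_R_r_def)
  ultimately show "\<exists>g. in_R_r g \<and> J_lift g \<doteq> x" by blast
next
  assume "\<exists>g. in_R_r g \<and> J_lift g \<doteq> x"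
  then obtain g r where g: "J_lift g \<doteq> x" "r \<in> R_r l q" "\<And>y. r (cl y) = g y" by (auto simp: in_R_r_def)
  then have "J_map l q r = cl x" by (simp add: J_map_Jel cls_eq_iff)
  then show "cl x \<in> Z_tilde l q" using g(2) by (auto simp: Z_tilde_def)
qed

lemma J_lift_lin2: "J_lift (\<lambda>x. c * g x + d * h x) = c \<cdot> J_lift g + d \<cdot> J_lift h"
  unfolding J_lift_def by (rule slice_lift_lin2)

lemma Z_tilde_central: "in_R_r g \<Longrightarrow> J_lift g * y \<doteq> y * J_lift g"
proof (induction g rule: in_R_r_induct)
  case zero
  show ?case using J_lift_lin2[of 0 "\<lambda>x. 0" 0 "\<lambda>x. 0"] by simp
next
  case (add g h c)
  have "J_lift (\<lambda>x. c * g x + h x) = c \<cdot> J_lift g + J_lift h" using J_lift_lin2[of c g 1 h] by simp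
  then show ?case using eqv_add[OF eqv_smul[OF add(1), of c] add(2)] by (simp add: distrib_left distrib_right)
next
  case (trace t)
  interpret t: trace_form l q t by unfold_locales (use trace in auto)
  show ?case by (rule t.J_lift_central)
qed

lemma pc_Z_tilde: "degree f < l \<Longrightarrow> \<exists>g. in_R_r g \<and> J_lift g \<doteq> pc f"
proof -
  obtain b where b: "\<And>n. n < l \<Longrightarrow> b n \<noteq> 0 \<and> degree (b n) = n \<and> J_lift (\<lambda>x. tr n (gK * x)) \<doteq> pc (b n)"
    using J_lift_rho by metis
  assume "degree f < l"
  then show ?thesis
  proof (induction f rule: poly_basis_induct[where N = l and b = b])
    case (deg m)
    then show ?case using b by blast
  next
    case zero
    show ?case using in_R_r_0 J_lift_lin2[of 0 "\<lambda>x. 0" 0 "\<lambda>x. 0"] by (intro exI[of _ "\<lambda>x. 0"]) simp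
  next
    case (add f1 f2)
    then obtain g h where *: "in_R_r g" "J_lift g \<doteq> pc f1" "in_R_r h" "J_lift h \<doteq> pc f2" by blast
    then have "J_lift (\<lambda>x. g x + h x) \<doteq> pc (f1 + f2)"
      using J_lift_lin2[of 1 g 1 h] eqv_add[OF *(2,4)] by (simp add: peval_add)
    then show ?case using in_R_r_add[OF *(1,3)] by blast
  next
    case (smult c f)
    then obtain g where *: "in_R_r g" "J_lift g \<doteq> pc f" by blast
    then have "J_lift (\<lambda>x. c * g x) \<doteq> pc (Polynomial.smult c f)"
      using J_lift_lin2[of c g 0 g] eqv_smul[OF *(2)] by (simp add: peval_smult)
    then show ?case using in_R_r_smul[OF *(1)] by blast
  next
    case (basis m)
    then show ?case using b in_R_r_tr by blast
  qed
qed

lemma ev_e': "periodic f \<Longrightarrow> ev f * e j \<doteq> pc (f j) * e j"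
proof -
  assume f: "periodic f"
  have d: "int l dvd j - j mod int l" by (simp add: mod_eq_dvd_iff[symmetric])
  have "ev f * e (j mod int l) \<doteq> pc (f (j mod int l)) * e (j mod int l)" by (rule ev_e) simp
  then show ?thesis using e_cong[OF d] periodicD[OF f d] by simp
qed

lemma dual_weight_0:
  assumes f: "dual f" and K: "\<And>x. f (gK * x) = f (x * gK)" and "a < l" "c < l" "a \<noteq> c"
  shows "f (bas a c k) = 0"
proof -
  let ?k = "k + 2 * int c - 2 * int a"
  have "w ?k * f (bas a c k) = f (gK * bas a c k)"
    using dual_eqv[OF f K_bas[of a c k]] by (simp add: lin_simps[OF dual_lin[OF f]])
  also have "\<dots> = f (bas a c k * gK)" by (rule K)
  also have "\<dots> = f (w k \<cdot> bas a c k)" by (rule dual_eqv[OF f bas_K])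
  finally have "(w ?k - w k) * f (bas a c k) = 0"
    by (simp add: lin_simps[OF dual_lin[OF f]] left_diff_distrib)
  moreover have "w ?k \<noteq> w k"
  proof
    assume "w ?k = w k"
    then have "int l dvd ?k - k" unfolding w_eq_iff .
    also have "?k - k = 2 * (int c - int a)" by simp
    finally have "int l dvd int c - int a" unfolding l_dvd_double .
    then show False using l_dvd_Res[of "int c" "int a"] assms by simp
  qed
  ultimately show ?thesis by simp
qed

text \<open>Commuting with \<open>K\<close> makes a functional vanish on every monomial of nonzero
  weight; the remaining ones, \<open>F^a E^a e_k\<close>, are polynomials in \<open>C\<close> times
  \<open>e_k\<close>.\<close>

lemma dual_eq_weight_0:
  assumes f: "dual f" and Kf: "\<And>x. f (gK * x) = f (x * gK)"
    and g: "dual g" and Kg: "\<And>x. g (gK * x) = g (x * gK)"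
    and eq: "\<And>h k. f (pc h * e k) = g (pc h * e k)"
  shows "f x = g x"
proof (rule dual_eq_bas[OF f g])
  fix a c k assume ac: "a < l" "c < l"
  show "f (bas a c k) = g (bas a c k)"
  proof (cases "a = c")
    case True
    have "bas a c k \<doteq> pc (P k a) * e k" unfolding bas_def True by (rule FE_pow_e)
    then show ?thesis using dual_eqv[OF f] dual_eqv[OF g] eq by metis
  qed (simp add: dual_weight_0 f g Kf Kg ac)
qed

text \<open>The components of the central element that \<open>\<phi>\<close> maps to a multiple of the twisted trace of the
  module of highest weight \<open>n\<close>.\<close>

definition trace_comp :: "nat \<Rightarrow> int \<Rightarrow> complex poly" where
  "trace_comp n k = (if wt n k then Qp (int n) else 0)"

lemma periodic_zf: "periodic (trace_comp n)"
  by (simp add: periodic_def trace_comp_def) (metis wt_cong)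

text \<open>The antipode fixes \<open>C\<close> and sends \<open>e_k\<close> to
  \<open>e_(-k)\<close>, and the set of weights is symmetric. This removes the antipode from
  \<open>phi\<close> for these elements.\<close>

lemma antip_ev_zf: "antip (ev (trace_comp n)) \<doteq> ev (trace_comp n)"
proof -
  have "antip (ev (trace_comp n)) = (\<Sum>j\<in>Res. antip (e j) * antip (pc (trace_comp n j)))"
    by (simp add: ev_def antip_simps)
  also have "\<dots> \<doteq> (\<Sum>j\<in>Res. e (- j) * pc (trace_comp n j))" by (intro eqv_sum eqv_mult antip_e antip_pc)
  also have "\<dots> \<doteq> (\<Sum>j\<in>Res. pc (trace_comp n j) * e (- j))" by (intro eqv_sum eqv_sym[OF pc_comm])
  also have "\<dots> = (\<Sum>j\<in>Res. pc (trace_comp n (- j)) * e (- j))" by (simp add: trace_comp_def wt_minus)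
  also have "\<dots> = ev (trace_comp n)"
    unfolding ev_def
  proof (rule sum.reindex_bij_witness[of _ "\<lambda>k. (- k) mod int l" "\<lambda>k. (- k) mod int l"])
    fix k assume k: "k \<in> Res"
    show "- (- k mod int l) mod int l = k" "- (- k mod int l) mod int l = k"
      using k by (simp_all add: mod_minus_eq)
    have d: "int l dvd (- k) mod int l - (- k)" by (simp only: mod_eq_dvd_iff[symmetric] mod_mod_trivial)
    show "pc (trace_comp n (- k mod int l)) * e (- k mod int l) = pc (trace_comp n (- k)) * e (- k)"
      using periodicD[OF periodic_zf d] e_cong[OF d] by simp
  qed simp_all
  finally show ?thesis .
qed

lemma Qp_gam: "gam k = gam k' \<Longrightarrow> Qp k = Qp k'"
  using Qp_Psi[of k] Qp_Psi[of k'] mult_cancel_left[of "[:- gam k, 1:]" "Qp k" "Qp k'"] by simp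

text \<open>Compare the orders of vanishing at \<open>gam k\<close>: it is one less for \<open>Qp k\<close> than for \<open>Psi\<close>, while
  every \<open>Qp j\<close> with \<open>gam j \<noteq> gam k\<close> vanishes there as much as \<open>Psi\<close>.\<close>

lemma Qp_independent:
  assumes "(\<Sum>k\<in>A. Polynomial.smult (t k) (Qp k)) = 0" and A: "finite A"
  shows "(\<Sum>j\<in>{j\<in>A. gam j = gam k}. t j) = 0"
proof (rule ccontr)
  let ?B = "{j\<in>A. gam j = gam k}" and ?X = "[:- gam k, 1:]"
  assume nz: "(\<Sum>j\<in>?B. t j) \<noteq> 0"
  define d where "d = order (gam k) Psi"
  have Psi_dvd: "?X ^ d dvd Psi" unfolding d_def by (rule order_1)
  have "?X ^ d dvd Qp j" if "gam j \<noteq> gam k" for j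
  proof -
    have "order (gam k) ([:- gam j, 1:] * Qp j) = order (gam k) [:- gam j, 1:] + order (gam k) (Qp j)"
      by (rule order_mult) (simp only: Qp_Psi Psi_monic(2) not_False_eq_True)
    moreover have "order (gam k) [:- gam j, 1:] = 0"
      using that by (intro order_0I) simp
    ultimately have "order (gam k) (Qp j) = d" by (simp only: Qp_Psi d_def)
    then show ?thesis using order_1[of "gam k" "Qp j"] by simp
  qed
  then have "?X ^ d dvd (\<Sum>j\<in>A - ?B. Polynomial.smult (t j) (Qp j))"
    by (intro dvd_sum dvd_smult) auto
  moreover have "(\<Sum>j\<in>A - ?B. Polynomial.smult (t j) (Qp j)) = - Polynomial.smult (\<Sum>j\<in>?B. t j) (Qp k)"
  proof -
    have "(\<Sum>j\<in>?B. Polynomial.smult (t j) (Qp j)) = (\<Sum>j\<in>?B. Polynomial.smult (t j) (Qp k))"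
    proof (rule sum.cong)
      fix j assume "j \<in> ?B"
      then have "gam j = gam k" by blast
      then have "Qp j = Qp k" by (rule Qp_gam)
      then show "Polynomial.smult (t j) (Qp j) = Polynomial.smult (t j) (Qp k)" by simp
    qed (rule refl)
    also have "\<dots> = Polynomial.smult (\<Sum>j\<in>?B. t j) (Qp k)" by (rule smult_sum[symmetric])
    finally have B: "(\<Sum>j\<in>?B. Polynomial.smult (t j) (Qp j)) = Polynomial.smult (\<Sum>j\<in>?B. t j) (Qp k)" .
    have "(\<Sum>j\<in>A. Polynomial.smult (t j) (Qp j)) =
        (\<Sum>j\<in>A - ?B. Polynomial.smult (t j) (Qp j)) + (\<Sum>j\<in>?B. Polynomial.smult (t j) (Qp j))"
      by (rule sum.subset_diff) (use A in blast)+
    then show ?thesis unfolding assms(1) B eq_neg_iff_add_eq_0 by (rule sym)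
  qed
  ultimately have "?X ^ d dvd Qp k" using nz by (simp add: dvd_smult_iff)
  then have "?X ^ Suc d dvd Psi"
    unfolding Qp_Psi[of k, symmetric] power_Suc by (rule mult_dvd_mono[OF dvd_refl])
  then show False
    using order_2[OF Psi_monic(2), of "gam k"] by (simp add: d_def)
qed

end

context quantum_integral
begin

text \<open>Modulo \<open>X - gam n\<close> the polynomial \<open>h\<close> is the constant
  \<open>h (gam n)\<close>, and multiples of \<open>Psi = (X - gam n) Qp n\<close> vanish at
  \<open>C\<close>. So \<open>L\<close> becomes evaluation at the central character.\<close>

lemma L_Qp: "L (pc (Qp n * h) * e k) = poly h (gam n) * (L0 * w k / of_nat l)"
proof -
  obtain h' where h': "h = [:poly h (gam n):] + [:- gam n, 1:] * h'"
  proof -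
    have "[:- gam n, 1:] dvd h - [:poly h (gam n):]" by (simp add: poly_eq_0_iff_dvd[symmetric])
    then obtain h' where "h - [:poly h (gam n):] = [:- gam n, 1:] * h'" by (auto simp: dvd_def)
    then have "h = [:poly h (gam n):] + [:- gam n, 1:] * h'" by (simp add: diff_eq_eq add.commute)
    then show ?thesis by (rule that)
  qed
  have "Qp n * h = Polynomial.smult (poly h (gam n)) (Qp n) + Psi * h'"
    by (subst h') (simp only: distrib_left mult.assoc[symmetric] mult.commute[of "Qp n"] Qp_Psi, simp)
  then have "pc (Qp n * h) * e k = poly h (gam n) \<cdot> (pc (Qp n) * e k) + pc Psi * (pc h' * e k)"
    by (simp add: peval_add peval_smult peval_mult distrib_right mult.assoc)
  then have "L (pc (Qp n * h) * e k) = poly h (gam n) * L (pc (Qp n) * e k) + L (pc Psi * (pc h' * e k))"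
    by (simp add: L_simps)
  moreover have "L (pc Psi * (pc h' * e k)) = 0"
    using L_eqv[OF eqv_mult_right[OF pc_Psi], of "pc h' * e k"] by (simp add: L_simps)
  moreover have "L (pc (Qp n) * e k) = L0 * w k / of_nat l"
    using L_pc_e[of "Qp n" k] Qp_monic[of n] by simp
  ultimately show ?thesis by simp
qed

text \<open>Both functionals commute with \<open>K\<close>, so it is enough to compare them on
  \<open>h(C) e_k\<close>. There both are \<open>h (gam n)\<close> times \<open>w k\<close> up to
  the same constant if \<open>k\<close> is a weight of the module, and 0 otherwise.\<close>

lemma trace_comp_trace:
  assumes n: "n < l"
  shows "L (ev (trace_comp n) * x) = L0 / of_nat l * tr n (gK * x)"
proof (rule dual_eq_weight_0[where f = "\<lambda>x. L (ev (trace_comp n) * x)" and g = "\<lambda>x. L0 / of_nat l * tr n (gK * x)"])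
  show "dual (\<lambda>x. L (ev (trace_comp n) * x))" by (rule dual_mult_left[OF dual_L])
  show "dual (\<lambda>x. L0 / of_nat l * tr n (gK * x))"
    using dual_mult_left[OF dual_tr[OF n], of gK]
    by (auto simp: dual_def lin_def algebra_simps add_divide_distrib)
  show "L (ev (trace_comp n) * (gK * x)) = L (ev (trace_comp n) * (x * gK))" for x
  proof -
    have "ev (trace_comp n) * (gK * x) = ev (trace_comp n) * gK * x" by (simp add: mult.assoc)
    also have "\<dots> \<doteq> gK * ev (trace_comp n) * x" by (intro eqv_mult_right ev_K)
    finally have "L (ev (trace_comp n) * (gK * x)) = L (gK * ev (trace_comp n) * x)" by (rule L_eqv)
    also have "\<dots> = L (ev (trace_comp n) * x * gK)" using L_twist_K[of "ev (trace_comp n) * x"] by (simp add: mult.assoc)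
    finally show ?thesis by (simp add: mult.assoc)
  qed
  show "L0 / of_nat l * tr n (gK * (gK * x)) = L0 / of_nat l * tr n (gK * (x * gK))" for x
    using tr_comm[of n gK "gK * x"] by (simp add: mult.assoc)
  show "L (ev (trace_comp n) * (pc h * e k)) = L0 / of_nat l * tr n (gK * (pc h * e k))" for h k
  proof -
    have "ev (trace_comp n) * (pc h * e k) = (ev (trace_comp n) * pc h) * e k" by (simp add: mult.assoc)
    also have "\<dots> \<doteq> pc h * ev (trace_comp n) * e k" by (intro eqv_mult_right eqv_sym[OF pc_comm])
    also have "\<dots> = pc h * (ev (trace_comp n) * e k)" by (simp add: mult.assoc)
    also have "\<dots> \<doteq> pc h * (pc (trace_comp n k) * e k)" by (intro eqv_mult_left ev_e' periodic_zf)
    also have "\<dots> = (if wt n k then pc (Qp (int n) * h) * e k else 0)"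
      by (simp add: trace_comp_def peval_mult mult.assoc[symmetric] mult.commute[of "Qp (int n)"])
    finally have "L (ev (trace_comp n) * (pc h * e k)) = (if wt n k then poly h (gam (int n)) * (L0 * w k / of_nat l) else 0)"
      using L_eqv L_Qp[of "int n" h k] by (cases "wt n k") (simp_all add: L_simps)
    moreover have "tr n (gK * (pc h * e k)) = w k * (if wt n k then poly h (gam (int n)) else 0)"
    proof -
      have "gK * (pc h * e k) = (gK * pc h) * e k" by (simp add: mult.assoc)
      also have "\<dots> \<doteq> pc h * gK * e k" by (intro eqv_mult_right eqv_sym[OF pc_comm])
      also have "\<dots> = pc h * (gK * e k)" by (simp add: mult.assoc)
      also have "\<dots> \<doteq> pc h * (w k \<cdot> e k)" by (intro eqv_mult_left K_e)
      finally have "tr n (gK * (pc h * e k)) = tr n (w k \<cdot> (pc h * e k))"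
        using dual_eqv[OF dual_tr[OF n]] by simp
      then show ?thesis
        by (simp only: lin_smul[OF dual_lin[OF dual_tr[OF n]]] tr_pc_e[OF n])
    qed
    ultimately show ?thesis by simp
  qed
qed

section \<open>The preimage under phi and its centrality\<close>

lemma phi_cls: "phi l q lam (cl a) (cl b) = L (antip a * b)"
  by (simp add: phi_def U_antipode_cls cls_mult L_def)

lemma Z_prime_iff: "cl a \<in> Z_prime l q lam \<longleftrightarrow> in_R_r (\<lambda>b. L (antip a * b))"
proof
  assume "cl a \<in> Z_prime l q lam"
  then have "phi l q lam (cl a) \<in> R_r l q" by (simp add: Z_prime_def)
  then show "in_R_r (\<lambda>b. L (antip a * b))"
    unfolding in_R_r_def by (rule rev_bexI) (simp add: phi_cls)
next
  assume "in_R_r (\<lambda>b. L (antip a * b))"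
  then obtain r where r: "r \<in> R_r l q" "\<And>b. r (cl b) = L (antip a * b)" unfolding in_R_r_def by blast
  obtain P c where "r = (\<lambda>a\<in>carrier (U l q). \<Sum>p\<in>P. c p * p a)" using R_r_E[OF r(1)] .
  then have "r \<in> extensional (carrier (U l q))" by simp
  moreover have "phi l q lam (cl a) \<in> extensional (carrier (U l q))" by (simp add: phi_def)
  moreover have "r X = phi l q lam (cl a) X" if "X \<in> carrier (U l q)" for X
  proof -
    from that obtain b where "X = cl b" unfolding U_carrier by blast
    then show ?thesis by (simp only: r(2) phi_cls)
  qed
  ultimately have "r = phi l q lam (cl a)" by (rule extensionalityI)
  then show "cl a \<in> Z_prime l q lam" using r(1) by (simp add: Z_prime_def)
qed

text \<open>Twisted traces obey the same commutation rule as the integral in \<open>L_twist\<close>.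
  Comparing the two rules gives centrality in \<open>Z_prime_central\<close>.\<close>

lemma in_R_r_twist: "in_R_r g \<Longrightarrow> g (x * y) = g (y * gK * x * gKinv)"
proof (induction g rule: in_R_r_induct)
  case (trace t)
  have "t (gK * (y * gK * x * gKinv)) = t (gKinv * (gK * (y * gK * x)))"
    using trace(2)[of "gK * (y * gK * x)" gKinv] by (simp add: mult.assoc)
  also have "\<dots> = t (gKinv * gK * (y * gK * x))" by (simp add: mult.assoc)
  also have "\<dots> = t (1 * (y * gK * x))" by (intro dual_eqv[OF trace(1)] eqv_mult_right rel_KiK)
  also have "\<dots> = t (gK * x * y)" using trace(2)[of y "gK * x"] by (simp add: mult.assoc)
  finally show ?case by (simp add: mult.assoc)
qed simp_all

lemma Z_prime_central:
  assumes "in_R_r (\<lambda>b. L (antip a * b))"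
  shows "a * x \<doteq> x * a"
proof -
  have c: "antip a * y \<doteq> y * antip a" for y
  proof -
    have "L ((antip a * y - y * antip a) * z) = 0" for z
    proof -
      have "L (antip a * (y * z)) = L (antip a * (z * gK * y * gKinv))" by (rule in_R_r_twist[OF assms])
      also have "\<dots> = L (y * (antip a * z))" using L_twist[of y "antip a * z"] by (simp add: mult.assoc)
      finally show ?thesis by (simp add: left_diff_distrib mult.assoc L_simps)
    qed
    then show ?thesis by (subst eqv_iff_diff) (rule L_nondegenerate)
  qed
  \<comment> \<open>Applying the antipode to the centrality of \<open>antip a\<close> gives a
    relation between conjugates of \<open>a\<close> and \<open>x\<close> by \<open>K\<close>; this
    identity undoes the conjugation.\<close>
  have KK: "gK * (gKinv * y * gK * (gKinv * z * gK)) * gKinv \<doteq> y * z" for y z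
  proof -
    have "gK * (gKinv * y * gK * (gKinv * z * gK)) * gKinv = gK * gKinv * (y * (gK * gKinv) * z) * (gK * gKinv)"
      by (simp add: mult.assoc)
    also have "\<dots> \<doteq> 1 * (y * 1 * z) * 1"
      by (intro eqv_mult rel_KKi eqv_refl)
    finally show ?thesis by simp
  qed
  have "antip (antip a * antip x) \<doteq> antip (antip x * antip a)" by (intro antip_eqv c)
  then have "antip (antip x) * antip (antip a) \<doteq> antip (antip a) * antip (antip x)" by (simp add: antip_simps)
  then have "gKinv * x * gK * (gKinv * a * gK) \<doteq> gKinv * a * gK * (gKinv * x * gK)"
    using eqv_mult[OF antip_anti[of x] antip_anti[of a]] eqv_mult[OF antip_anti[of a] antip_anti[of x]]
    by (meson eqv_sym eqv_trans)
  then have "gK * (gKinv * x * gK * (gKinv * a * gK)) * gKinv \<doteq> gK * (gKinv * a * gK * (gKinv * x * gK)) * gKinv"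
    by (intro eqv_mult_left eqv_mult_right)
  then show ?thesis using KK[of x a] KK[of a x] by (meson eqv_sym eqv_trans)
qed

lemma in_R_r_zf:
  assumes n: "n < l"
  shows "in_R_r (\<lambda>b. L (antip (c \<cdot> ev (trace_comp n)) * b))"
proof -
  have "L (antip (c \<cdot> ev (trace_comp n)) * b) = c * (L0 / of_nat l) * tr n (gK * b)" for b
    using L_eqv[OF eqv_mult_right[OF antip_ev_zf[of n]], of b]
    by (simp add: antip_simps L_simps trace_comp_trace[OF n])
  then show ?thesis using in_R_r_smul[OF in_R_r_tr[OF n], of "c * (L0 / of_nat l)"] by simp
qed

lemma in_R_r_zf_sum:
  assumes "\<And>s. s \<in> S \<Longrightarrow> n s < l"
  shows "in_R_r (\<lambda>b. L (antip (\<Sum>s\<in>S. c s \<cdot> ev (trace_comp (n s))) * b))"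
  using assms
proof (induction S rule: infinite_finite_induct)
  case (insert s S)
  have "in_R_r (\<lambda>b. L (antip (c s \<cdot> ev (trace_comp (n s))) * b) + L (antip (\<Sum>s\<in>S. c s \<cdot> ev (trace_comp (n s))) * b))"
    using insert by (intro in_R_r_add in_R_r_zf) auto
  then show ?case using insert by (simp add: antip_simps distrib_right L_simps)
qed (simp_all add: antip_simps L_simps in_R_r_0)

text \<open>Written as a sum over the weight vectors, the indicator of the weights telescopes under
  \<open>k\<close> to \<open>k + 2\<close>. What remains is the highest weight \<open>n\<close> and,
  with opposite sign, the residue \<open>- n - 2\<close> just below the lowest weight.\<close>

lemma trace_comp_step:
  assumes n: "n < l"
  shows "trace_comp n k - trace_comp n (k + 2) = Polynomial.smult ((if int l dvd k - int n then 1 else 0) -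
    (if int l dvd k + int n + 2 then 1 else 0)) (Qp (int n))"
proof -
  define a where "a j = (if int l dvd k - (int n - 2 * int j) then 1 else (0 :: complex))" for j
  have z: "trace_comp n k' = Polynomial.smult (\<Sum>j\<le>n. if int l dvd k' - (int n - 2 * int j) then 1 else 0) (Qp (int n))" for k'
    unfolding wt_sum[OF n] trace_comp_def by simp
  have shift: "k + 2 - (int n - 2 * int j) = k - (int n - 2 * int (Suc j))" for j by simp
  have "trace_comp n (k + 2) = Polynomial.smult (\<Sum>j\<le>n. a (Suc j)) (Qp (int n))"
    unfolding z a_def shift ..
  moreover have "trace_comp n k = Polynomial.smult (\<Sum>j\<le>n. a j) (Qp (int n))"
    unfolding z a_def ..
  ultimately have "trace_comp n k - trace_comp n (k + 2) = Polynomial.smult (\<Sum>j\<le>n. a j - a (Suc j)) (Qp (int n))"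
    by (simp add: smult_diff_left sum_subtractf)
  also have "(\<Sum>j\<le>n. a j - a (Suc j)) = a 0 - a (Suc n)" by (rule sum_telescope)
  also have "a 0 - a (Suc n) = (if int l dvd k - int n then 1 else 0) - (if int l dvd k + int n + 2 then 1 else 0)"
  proof -
    have "k - (int n - 2 * int 0) = k - int n" "k - (int n - 2 * int (Suc n)) = k + int n + 2" by simp_all
    then show ?thesis unfolding a_def by (simp only:)
  qed
  finally show ?thesis .
qed

text \<open>The jumps \<open>t k\<close> of the components are matched by a combination of the
  elements \<open>ev (trace_comp (2 s))\<close>, each of which jumps at \<open>2 s\<close> and at
  \<open>- 2 s - 2\<close> with opposite signs. The antisymmetry of \<open>t\<close> makes both
  jumps fit at once.\<close>

lemma central_decomp:
  assumes z: "\<And>x. z * x \<doteq> x * z"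
  obtains f c where "degree f < l" and "z \<doteq> pc f + (\<Sum>s<(l - 1) div 2. c s \<cdot> ev (trace_comp (2 * s)))"
proof -
  define h where "h = (l - 1) div 2"
  have l: "l = 2 * h + 1" using l_odd unfolding h_def by presburger
  obtain f where f: "periodic f" "\<And>k. degree (f k) < l" "z \<doteq> ev f"
    using commute_K_ev[OF z] by blast
  have "ev f * gE \<doteq> gE * ev f"
    using eqv_mult_right[OF f(3), of gE] eqv_mult_left[OF f(3), of gE] z[of gE] by (meson eqv_sym eqv_trans)
  then have "\<exists>t. f k - f (k + 2) = Polynomial.smult t (Qp k)" for k
    by (rule central_ev[OF f(1,2)])
  \<comment> \<open>As \<open>Qp k\<close> is monic of degree \<open>l - 1\<close>, this is the
    multiplier; given as a coefficient it inherits the periodicity of \<open>f\<close>.\<close>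
  define t where "t k = coeff (f k - f (k + 2)) (l - 1)" for k
  have t: "f k - f (k + 2) = Polynomial.smult (t k) (Qp k)" for k
  proof -
    obtain t' where t': "f k - f (k + 2) = Polynomial.smult t' (Qp k)"
      using \<open>\<And>k. \<exists>t. f k - f (k + 2) = Polynomial.smult t (Qp k)\<close> by blast
    have "t k = t'" unfolding t_def t' using Qp_monic[of k] by simp
    then show ?thesis using t' by simp
  qed
  have t_cong: "t k = t k'" if "int l dvd k - k'" for k k'
    using periodicD[OF f(1), of k k'] periodicD[OF f(1), of "k + 2" "k' + 2"] that by (simp add: t_def)
  \<comment> \<open>The jumps around the whole cycle add up to 0. By \<open>Qp_independent\<close>
    this splits into one equation for each value of \<open>gam\<close>.\<close>
  have "(\<Sum>k\<in>Res. Polynomial.smult (t k) (Qp k)) = (\<Sum>k\<in>Res. f k) - (\<Sum>k\<in>Res. f (k + 2))"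
    unfolding t[symmetric] by (rule sum_subtractf)
  also have "(\<Sum>k\<in>Res. f (k + 2)) = (\<Sum>k\<in>Res. f k)"
    by (rule sum_Res_shift) (rule periodicD[OF f(1)])
  finally have indep: "(\<Sum>j\<in>{j\<in>Res. gam j = gam k}. t j) = 0" for k
    by (intro Qp_independent) simp_all
  have t_anti: "t k + t (- k - 2) = 0" for k
  proof -
    define a where "a = k mod int l"
    define b where "b = (- k - 2) mod int l"
    have ab: "a \<in> Res" "b \<in> Res" "int l dvd k - a" "int l dvd - k - 2 - b"
      by (simp_all add: a_def b_def mod_eq_dvd_iff[symmetric])
    have "{j\<in>Res. gam j = gam k} = {a, b}"
    proof (intro equalityI subsetI)
      fix j assume "j \<in> {j\<in>Res. gam j = gam k}"
      then have j: "j \<in> Res" "int l dvd j - k \<or> int l dvd j + k + 2" by (auto simp: gam_eq_iff)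
      from j(2) show "j \<in> {a, b}"
      proof
        assume "int l dvd j - k"
        from dvd_add[OF this ab(3)] have "int l dvd j - a" by simp
        then show ?thesis using l_dvd_Res[OF j(1) ab(1)] by simp
      next
        assume "int l dvd j + k + 2"
        from dvd_add[OF this ab(4)] have "int l dvd j - b" by simp
        then show ?thesis using l_dvd_Res[OF j(1) ab(2)] by simp
      qed
    next
      fix j assume "j \<in> {a, b}"
      moreover have "gam a = gam k" using gam_cong[OF ab(3)] by simp
      moreover have "gam b = gam k" using gam_cong[OF ab(4)] gam_reflect[of k] by simp
      ultimately show "j \<in> {j\<in>Res. gam j = gam k}" using ab(1,2) by blast
    qed
    then have "(\<Sum>j\<in>{a, b}. t j) = 0" using indep[of k] by simp
    \<comment> \<open>At the fixed point \<open>a = b\<close> the sum over the set is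
      \<open>t a\<close> alone, which also makes \<open>t a + t b\<close> vanish.\<close>
    then have "t a + t b = 0" by (cases "a = b") simp_all
    then show ?thesis using t_cong[OF ab(3)] t_cong[OF ab(4)] by simp
  qed
  define W where "W k = (\<Sum>s<h. Polynomial.smult (t (2 * int s)) (trace_comp (2 * s) k))" for k
  have W: "W k - W (k + 2) = Polynomial.smult (t k) (Qp k)" for k
  proof -
    obtain i' where "int l dvd k - 2 * int i'" using ex_double by blast
    \<comment> \<open>Half of the weight, in \<open>{0..<l}\<close>. Indices below \<open>h\<close>
      are the jumps at \<open>2 s\<close>, those above \<open>h\<close> the jumps at
      \<open>- 2 s - 2\<close>, and \<open>h\<close> itself is the residue
      \<open>-1\<close>.\<close>
    define i where "i = i' mod l"
    have i: "i < l" by (simp add: i_def)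
    have ik: "int l dvd k - 2 * int i"
    proof -
      have "k - 2 * int i = (k - 2 * int i') + int l * (2 * (int i' div int l))"
        by (simp add: i_def zmod_int of_nat_div minus_mult_div_eq_mod[symmetric] algebra_simps)
      moreover have "int l dvd (k - 2 * int i') + int l * (2 * (int i' div int l))"
        using \<open>int l dvd k - 2 * int i'\<close> by (intro dvd_add) simp_all
      ultimately show ?thesis by (simp only:)
    qed
    have top: "int l dvd k - int (2 * s) \<longleftrightarrow> s = i" if "s < h" for s
    proof -
      have "int l dvd k - int (2 * s) \<longleftrightarrow> int l dvd (k - int (2 * s)) - (k - 2 * int i)"
        using ik by (simp only: dvd_diff_left_iff)
      also have "(k - int (2 * s)) - (k - 2 * int i) = 2 * (int i - int s)" by simp
      also have "int l dvd 2 * (int i - int s) \<longleftrightarrow> int i = int s"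
        unfolding l_dvd_double using that i l by (intro l_dvd_Res) auto
      finally show ?thesis by auto
    qed
    have bot: "int l dvd k + int (2 * s) + 2 \<longleftrightarrow> i + s + 1 = l" if "s < h" for s
    proof -
      have "int l dvd k + int (2 * s) + 2 \<longleftrightarrow> int l dvd (k + int (2 * s) + 2) - (k - 2 * int i)"
        using ik by (simp only: dvd_diff_left_iff)
      also have "(k + int (2 * s) + 2) - (k - 2 * int i) = 2 * int (i + s + 1)" by simp
      also have "int l dvd 2 * int (i + s + 1) \<longleftrightarrow> l dvd i + s + 1"
        unfolding l_dvd_double of_nat_dvd_iff ..
      also have "\<dots> \<longleftrightarrow> i + s + 1 = l"
      proof
        assume "l dvd i + s + 1"
        then obtain m where m: "i + s + 1 = l * m" by (auto simp: dvd_def)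
        moreover have "i + s + 1 < l * 2" using that i l by simp
        ultimately have "m < 2" using l_pos by (metis mult_less_cancel1)
        moreover have "m \<noteq> 0" using m by (intro notI) simp
        ultimately show "i + s + 1 = l" using m by (cases "m = 1") auto
      qed simp
      finally show ?thesis .
    qed
    have Qeq: "Qp (int (2 * s)) = Qp k" if "int l dvd k - int (2 * s) \<or> int l dvd k + int (2 * s) + 2" for s
      using that gam_eq_iff[of k "int (2 * s)"] by (intro Qp_gam) auto
    have "W k - W (k + 2) = (\<Sum>s<h. Polynomial.smult (t (2 * int s)) (trace_comp (2 * s) k - trace_comp (2 * s) (k + 2)))"
      by (simp add: W_def sum_subtractf smult_diff_right)
    also have "\<dots> = (\<Sum>s<h. Polynomial.smult (t (2 * int s) * ((if s = i then 1 else 0) - (if i + s + 1 = l then 1 else 0))) (Qp k))"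
    proof (intro sum.cong refl)
      fix s assume "s \<in> {..<h}"
      then have s: "s < h" by simp
      then have "2 * s < l" using l by simp
      have "Polynomial.smult ((if int l dvd k - int (2 * s) then 1 else 0) - (if int l dvd k + int (2 * s) + 2 then 1 else 0)) (Qp (int (2 * s)))
        = Polynomial.smult ((if s = i then 1 else 0) - (if i + s + 1 = l then 1 else 0)) (Qp k)"
      proof (cases "s = i \<or> i + s + 1 = l")
        case True
        then have "Qp (int (2 * s)) = Qp k" using Qeq[of s] top[OF s] bot[OF s] by blast
        then show ?thesis unfolding top[OF s] bot[OF s] by (simp only:)
      next
        case False
        then show ?thesis unfolding top[OF s] bot[OF s] by simp
      qed
      then show "Polynomial.smult (t (2 * int s)) (trace_comp (2 * s) k - trace_comp (2 * s) (k + 2)) =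
          Polynomial.smult (t (2 * int s) * ((if s = i then 1 else 0) - (if i + s + 1 = l then 1 else 0))) (Qp k)"
        unfolding trace_comp_step[OF \<open>2 * s < l\<close>] by (simp only: smult_smult[symmetric])
    qed
    also have "\<dots> = Polynomial.smult (\<Sum>s<h. t (2 * int s) * ((if s = i then 1 else 0) - (if i + s + 1 = l then 1 else 0))) (Qp k)"
      by (rule smult_sum[symmetric])
    also have "(\<Sum>s<h. t (2 * int s) * ((if s = i then 1 else 0) - (if i + s + 1 = l then 1 else 0))) = t k"
    proof -
      consider "i < h" | "i = h" | "h < i" by linarith
      then show ?thesis
      proof cases
        case 1
        have "(\<Sum>s<h. t (2 * int s) * ((if s = i then 1 else 0) - (if i + s + 1 = l then 1 else 0))) =
            (\<Sum>s<h. if s = i then t (2 * int i) else 0)"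
          using 1 l by (intro sum.cong refl) auto
        also have "\<dots> = t k" using 1 t_cong[OF ik] by simp
        finally show ?thesis .
      next
        case 2
        have "(\<Sum>s<h. t (2 * int s) * ((if s = i then 1 else 0) - (if i + s + 1 = l then 1 else 0))) = 0"
          using 2 l by (intro sum.neutral) auto
        \<comment> \<open>Here \<open>k\<close> is \<open>-1\<close> modulo \<open>l\<close>, its
          own reflection, so antisymmetry gives \<open>2 t k = 0\<close>; no jump has to be
          matched.\<close>
        moreover have "t k = 0"
        proof -
          have "- k - 2 - k = - (2 * (k - 2 * int i)) - int l * 2" using 2 l by simp
          moreover have "int l dvd - (2 * (k - 2 * int i))"
            unfolding dvd_minus_iff using ik by (rule dvd_mult)
          then have "int l dvd - (2 * (k - 2 * int i)) - int l * 2" by (rule dvd_diff) simp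
          ultimately have "int l dvd - k - 2 - k" by (simp only:)
          then have "t (- k - 2) = t k" by (rule t_cong)
          then show ?thesis using t_anti[of k] by simp
        qed
        ultimately show ?thesis by simp
      next
        case 3
        \<comment> \<open>The index whose reflected weight \<open>- 2 s0 - 2\<close> is congruent to
          \<open>2 i\<close>.\<close>
        define s0 where "s0 = l - 1 - i"
        have s0: "s0 < h" "\<And>s. i + s + 1 = l \<longleftrightarrow> s = s0" using 3 i l by (auto simp: s0_def)
        have "(\<Sum>s<h. t (2 * int s) * ((if s = i then 1 else 0) - (if i + s + 1 = l then 1 else 0))) =
            (\<Sum>s<h. if s = s0 then - t (2 * int s0) else 0)"
          unfolding s0(2) using 3 by (intro sum.cong refl) auto
        also have "\<dots> = - t (2 * int s0)" using s0(1) by simp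
        also have "t (2 * int s0) = t (- k - 2)"
        proof (rule t_cong)
          have "2 * int s0 - (- k - 2) = (k - 2 * int i) + int l * 2"
            using i by (simp add: s0_def of_nat_diff)
          moreover have "int l dvd (k - 2 * int i) + int l * 2" using ik by (intro dvd_add) simp_all
          ultimately show "int l dvd 2 * int s0 - (- k - 2)" by (simp only:)
        qed
        also have "- t (- k - 2) = t k" using t_anti[of k] by (simp add: add_eq_0_iff)
        finally show ?thesis .
      qed
    qed
    finally show ?thesis .
  qed
  have pW: "periodic W"
    unfolding periodic_def
  proof (intro allI impI)
    fix k k' assume d: "int l dvd k - k'"
    show "W k = W k'" unfolding W_def periodicD[OF periodic_zf d] ..
  qed
  \<comment> \<open>With equal jumps the difference is invariant under steps of 2, hence constant,
    and a constant family of components is a polynomial in \<open>C\<close>.\<close>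
  have step: "f k - W k = f (k + 2) - W (k + 2)" for k
    using t[of k] W[of k] by (simp add: algebra_simps)
  have even: "f (2 * int i) - W (2 * int i) = f 0 - W 0" for i
  proof (induction i)
    case (Suc i)
    have "2 * int (Suc i) = 2 * int i + 2" by simp
    then show ?case using Suc step[of "2 * int i"] by (simp only:)
  qed simp
  have const: "f k = (f 0 - W 0) + W k" for k
  proof -
    obtain i where "int l dvd k - 2 * int i" using ex_double by blast
    then have "f k - W k = f 0 - W 0"
      using even[of i] periodicD[OF f(1), of k "2 * int i"] periodicD[OF pW, of k "2 * int i"] by simp
    then show ?thesis by (simp add: algebra_simps)
  qed
  have "ev f = pc (f 0 - W 0) + ev W"
  proof -
    have "f = (\<lambda>k. (f 0 - W 0) + W k)" using const by blast
    then have "ev f = ev (\<lambda>k. (f 0 - W 0) + W k)" by (rule arg_cong)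
    then show ?thesis by (simp only: ev_add ev_const)
  qed
  also have "ev W = (\<Sum>s<h. t (2 * int s) \<cdot> ev (trace_comp (2 * s)))"
  proof -
    have "ev (\<lambda>k. \<Sum>s\<in>S. Polynomial.smult (t (2 * int s)) (trace_comp (2 * s) k)) = (\<Sum>s\<in>S. t (2 * int s) \<cdot> ev (trace_comp (2 * s)))"
      for S :: "nat set"
      by (induction S rule: infinite_finite_induct) (simp_all add: ev_add ev_smult ev_const[of 0, simplified])
    then show ?thesis unfolding W_def[abs_def] .
  qed
  finally have "z \<doteq> pc (f 0 - W 0) + (\<Sum>s<(l - 1) div 2. t (2 * int s) \<cdot> ev (trace_comp (2 * s)))"
    using f(3) by (simp add: h_def)
  moreover have "degree (f 0 - W 0) < l"
  proof -
    have "degree (W 0) \<le> l - 1"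
      unfolding W_def
    proof (rule degree_sum_le)
      fix s assume "s \<in> {..<h}"
      show "degree (Polynomial.smult (t (2 * int s)) (trace_comp (2 * s) 0)) \<le> l - 1"
        using degree_smult_le[of "t (2 * int s)" "trace_comp (2 * s) 0"] Qp_monic[of "int (2 * s)"]
        by (auto simp: trace_comp_def split: if_splits)
    qed simp
    then have "degree (W 0) < l" using l_pos by linarith
    then show ?thesis using f(2) by (intro degree_diff_less) simp_all
  qed
  ultimately show ?thesis using that[of "f 0 - W 0" "\<lambda>s. t (2 * int s)"] by (simp only:)
qed

lemma Z_tilde_plus_Z_prime: "Z_tilde l q <+>\<^bsub>U l q\<^esub> Z_prime l q lam = ring_center (U l q)"
proof (intro equalityI subsetI)
  have center: "cl z \<in> ring_center (U l q) \<longleftrightarrow> (\<forall>x. z * x \<doteq> x * z)" for z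
    unfolding ring_center_def U_carrier by (auto simp: cls_mult cls_eq_iff)
  fix X
  {
    assume "X \<in> Z_tilde l q <+>\<^bsub>U l q\<^esub> Z_prime l q lam"
    then obtain A B where AB: "A \<in> Z_tilde l q" "B \<in> Z_prime l q lam" "X = A \<oplus>\<^bsub>U l q\<^esub> B"
      by (auto simp: set_add_def')
    have "A \<in> carrier (U l q)" using AB(1) by (auto simp: Z_tilde_def J_map_Jel)
    then obtain a where a: "A = cl a" by (auto simp: U_carrier)
    have "B \<in> carrier (U l q)" using AB(2) by (auto simp: Z_prime_def)
    then obtain b where b: "B = cl b" by (auto simp: U_carrier)
    obtain g where g: "in_R_r g" "J_lift g \<doteq> a" using AB(1) a by (auto simp: Z_tilde_iff)
    have "(a + b) * x \<doteq> x * (a + b)" for x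
    proof -
      have "a * x \<doteq> J_lift g * x" by (intro eqv_mult_right eqv_sym[OF g(2)])
      also have "\<dots> \<doteq> x * J_lift g" by (rule Z_tilde_central[OF g(1)])
      also have "\<dots> \<doteq> x * a" by (intro eqv_mult_left g(2))
      finally have "a * x \<doteq> x * a" .
      moreover have "b * x \<doteq> x * b" using AB(2) b by (intro Z_prime_central) (simp add: Z_prime_iff)
      ultimately show ?thesis by (simp add: distrib_left distrib_right eqv_add)
    qed
    then show "X \<in> ring_center (U l q)" using AB(3) a b by (simp add: cls_add center)
  next
    assume X: "X \<in> ring_center (U l q)"
    then obtain z where z: "X = cl z" by (auto simp: ring_center_def U_carrier)
    then have "\<And>x. z * x \<doteq> x * z" using X center by simp
    then obtain f c where f: "degree f < l" "z \<doteq> pc f + (\<Sum>s<(l - 1) div 2. c s \<cdot> ev (trace_comp (2 * s)))"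
      using central_decomp by blast
    have "cl (pc f) \<in> Z_tilde l q" using pc_Z_tilde[OF f(1)] by (simp add: Z_tilde_iff)
    moreover have "cl (\<Sum>s<(l - 1) div 2. c s \<cdot> ev (trace_comp (2 * s))) \<in> Z_prime l q lam"
      unfolding Z_prime_iff by (rule in_R_r_zf_sum) auto
    moreover have "X = cl (pc f) \<oplus>\<^bsub>U l q\<^esub> cl (\<Sum>s<(l - 1) div 2. c s \<cdot> ev (trace_comp (2 * s)))"
      using f(2) by (simp add: z cls_add cls_eq_iff)
    ultimately show "X \<in> Z_tilde l q <+>\<^bsub>U l q\<^esub> Z_prime l q lam"
      unfolding set_add_def' by blast
  }
qed

end

theorem corollary6p2:
  fixes l :: nat and q :: complex and lam :: "free_alg set \<Rightarrow> complex"
  assumes "3 \<le> l" and "odd l"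
    and "q ^ l = 1" and "\<And>k. 0 < k \<Longrightarrow> k < l \<Longrightarrow> q ^ k \<noteq> 1"
    and "right_integral l q lam" and "\<exists>x\<in>carrier (U l q). lam x \<noteq> 0"
  shows "Z_tilde l q <+>\<^bsub>U l q\<^esub> Z_prime l q lam = ring_center (U l q)"
proof -
  interpret quantum_integral l q lam
    by unfold_locales (use assms in auto)
  show ?thesis by (rule Z_tilde_plus_Z_prime)
qed

end
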